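(* Let $G$ be an infinite elementary amenable (discrete) group and let $2<p<\infty$. Then there exist a closed $G$-invariant subspace $F\subseteq \ell^pG$ with $F\neq 0$ and an invariant exhaustion $(E_i)_{i\in\mathbb{N}}$ of $\ell^pG$ such that $E_i\cap F=0$ for all $i\in\mathbb{N}$.
   Context: For a discrete group $G$ and $1\le p<\infty$, $\ell^pG$ is the Banach space of $p$-summable complex-valued functions on $G$, on which $G$ acts by left translation, $(g.\xi)(h)=\xi(g^{-1}h)$. "Invariant" means invariant under this action. An invariant exhaustion of $\ell^pG$ is a sequence $(E_i)_{i\in\mathbb{N}}$ of closed $G$-invariant linear subspaces of $\ell^pG$ which is increasing ($E_i\subseteq E_{i+1}$ for all $i$) and whose union $\bigcup_i E_i$ is norm-dense in $\ell^pG$. The class of elementary amenable groups is the smallest class of groups containing all finite groups and all abelian groups and closed under taking subgroups, quotients, extensions and directed unions. *)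

theory Defs
  imports "HOL-Analysis.Analysis" "HOL-Algebra.Algebra"
begin

text \<open>Elements of \<open>lp p A\<close> are functions on the whole type that vanish off \<open>A\<close>, so that equality
  in \<open>lp p A\<close> is equality of functions.\<close>

definition lp :: "real \<Rightarrow> 'a set \<Rightarrow> ('a \<Rightarrow> complex) set" where
  "lp p A = {\<xi>. (\<forall>x. x \<notin> A \<longrightarrow> \<xi> x = 0) \<and> (\<lambda>x. cmod (\<xi> x) powr p) summable_on A}"

definition lp_norm :: "real \<Rightarrow> 'a set \<Rightarrow> ('a \<Rightarrow> complex) \<Rightarrow> real" where
  "lp_norm p A \<xi> = (\<Sum>\<^sub>\<infinity>x\<in>A. cmod (\<xi> x) powr p) powr (1 / p)"

definition lp_dist :: "real \<Rightarrow> 'a set \<Rightarrow> ('a \<Rightarrow> complex) \<Rightarrow> ('a \<Rightarrow> complex) \<Rightarrow> real" where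
  "lp_dist p A \<xi> \<eta> = lp_norm p A (\<lambda>x. \<xi> x - \<eta> x)"

text \<open>\<open>lp_topology\<close> is the norm topology only for \<open>1 \<le> p\<close>; see \<open>Metric_space_lp\<close> below.\<close>

definition lp_topology :: "real \<Rightarrow> 'a set \<Rightarrow> ('a \<Rightarrow> complex) topology" where
  "lp_topology p A = Metric_space.mtopology (lp p A) (lp_dist p A)"

lemma lp_zero: "(\<lambda>_. 0) \<in> lp p A"
  by (simp add: lp_def)

lemma lp_scale:
  assumes "\<xi> \<in> lp p A"
  shows "(\<lambda>x. c * \<xi> x) \<in> lp p A"
  using assms by (auto simp: lp_def norm_mult powr_mult intro!: summable_on_cmult_right)

lemma powr_convex_combination:
  fixes u v t p :: real
  assumes "1 \<le> p" "0 \<le> u" "0 \<le> v" "0 < t" "t < 1"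
  shows "((1 - t) * u + t * v) powr p \<le> (1 - t) * u powr p + t * v powr p"
proof -
  have shrink: "(s * w) powr p \<le> s * w powr p" if "0 < s" "s < 1" "0 \<le> w" for s w :: real
  proof -
    have "s powr p \<le> s powr 1"
      using that assms by (intro powr_mono') auto
    then show ?thesis
      using that by (simp add: powr_mult mult_right_mono)
  qed
  consider "u = 0" | "v = 0" | "0 < u" "0 < v"
    using assms by fastforce
  then show ?thesis
  proof cases
    case 1
    then show ?thesis using shrink[of t v] assms by simp
  next
    case 2
    then show ?thesis using shrink[of "1 - t" u] assms by simp
  next
    case 3
    have "convex_on {0<..} (\<lambda>x::real. x powr p)"
    proof (rule convex_on_realI[where f' = "\<lambda>x. p * x powr (p - 1)"])
      show "connected {0::real<..}" by simp
    next
      fix x :: real assume "x \<in> {0<..}"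
      then show "((\<lambda>x. x powr p) has_real_derivative p * x powr (p - 1)) (at x)"
        by (auto intro!: derivative_eq_intros)
    next
      fix x y :: real assume "x \<in> {0<..}" "y \<in> {0<..}" "x \<le> y"
      then show "p * x powr (p - 1) \<le> p * y powr (p - 1)"
        using assms by (intro mult_left_mono powr_mono2) auto
    qed
    from convex_onD[OF this, of t u v] show ?thesis
      using 3 assms by simp
  qed
qed

lemma lp_norm_nonneg: "0 \<le> lp_norm p A \<xi>"
  by (simp add: lp_norm_def)

lemma lp_norm_powr:
  assumes "1 \<le> p"
  shows "lp_norm p A \<xi> powr p = (\<Sum>\<^sub>\<infinity>x\<in>A. cmod (\<xi> x) powr p)"
  using assms by (simp add: lp_norm_def powr_powr infsum_nonneg)

lemma lp_norm_eq_0_iff: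
  assumes "1 \<le> p" "\<xi> \<in> lp p A"
  shows "lp_norm p A \<xi> = 0 \<longleftrightarrow> \<xi> = (\<lambda>_. 0)"
proof
  assume "lp_norm p A \<xi> = 0"
  then have sum0: "(\<Sum>\<^sub>\<infinity>x\<in>A. cmod (\<xi> x) powr p) = 0"
    using lp_norm_powr[OF assms(1), of A \<xi>] assms by simp
  have "\<xi> x = 0" for x
  proof (cases "x \<in> A")
    case True
    have "cmod (\<xi> x) powr p = 0"
      by (rule nonneg_infsum_le_0D[where A = A]) (use assms sum0 True in \<open>auto simp: lp_def\<close>)
    then show ?thesis by simp
  qed (use assms in \<open>auto simp: lp_def\<close>)
  then show "\<xi> = (\<lambda>_. 0)" by auto
qed (simp add: lp_norm_def)

lemma Minkowski_lp:
  assumes p: "1 \<le> p" and \<xi>: "\<xi> \<in> lp p A" and \<eta>: "\<eta> \<in> lp p A"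
  shows lp_add: "(\<lambda>x. \<xi> x + \<eta> x) \<in> lp p A"
    and lp_norm_triangle: "lp_norm p A (\<lambda>x. \<xi> x + \<eta> x) \<le> lp_norm p A \<xi> + lp_norm p A \<eta>"
proof -
  let ?a = "lp_norm p A \<xi>" and ?b = "lp_norm p A \<eta>"
  have "(\<lambda>x. \<xi> x + \<eta> x) \<in> lp p A \<and> lp_norm p A (\<lambda>x. \<xi> x + \<eta> x) \<le> ?a + ?b"
  proof (cases "?a = 0 \<or> ?b = 0")
    case True
    then have "\<xi> = (\<lambda>_. 0) \<or> \<eta> = (\<lambda>_. 0)"
      using lp_norm_eq_0_iff[OF p \<xi>] lp_norm_eq_0_iff[OF p \<eta>] by blast
    then show ?thesis
      using \<xi> \<eta> lp_norm_nonneg[of p A] by (elim disjE) simp_all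
  next
    case False
    then have a: "0 < ?a" and b: "0 < ?b"
      using lp_norm_nonneg[of p A \<xi>] lp_norm_nonneg[of p A \<eta>] by simp_all
    define t where "t = ?b / (?a + ?b)"
    have t: "0 < t" "t < 1" and t': "1 - t = ?a / (?a + ?b)"
      using a b by (simp_all add: t_def field_simps)
    have at: "(?a + ?b) * (1 - t) = ?a" and bt: "(?a + ?b) * t = ?b"
      unfolding t' unfolding t_def using a b by simp_all
    define C where "C = (?a + ?b) powr p"
    define g where "g x = C * ((1 - t) * (cmod (\<xi> x) powr p * (1 / ?a powr p))
                          + t * (cmod (\<eta> x) powr p * (1 / ?b powr p)))" for x
    have le: "cmod (\<xi> x + \<eta> x) powr p \<le> g x" for x
    proof -
      have "cmod (\<xi> x + \<eta> x) \<le> cmod (\<xi> x) + cmod (\<eta> x)"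
        by (rule norm_triangle_ineq)
      also have "\<dots> = (?a + ?b) * ((1 - t) * (cmod (\<xi> x) / ?a) + t * (cmod (\<eta> x) / ?b))"
        using at bt a b by (simp add: distrib_left mult.assoc[symmetric])
      finally have "cmod (\<xi> x + \<eta> x) powr p
          \<le> ((?a + ?b) * ((1 - t) * (cmod (\<xi> x) / ?a) + t * (cmod (\<eta> x) / ?b))) powr p"
        using p by (intro powr_mono2) auto
      also have "\<dots> = C * ((1 - t) * (cmod (\<xi> x) / ?a) + t * (cmod (\<eta> x) / ?b)) powr p"
        using a b t by (simp add: C_def powr_mult)
      also have "\<dots> \<le> C * ((1 - t) * (cmod (\<xi> x) / ?a) powr p + t * (cmod (\<eta> x) / ?b) powr p)"
        using a b t p by (intro mult_left_mono powr_convex_combination) (auto simp: C_def)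
      also have "\<dots> = g x"
        using a b by (simp add: g_def powr_divide)
      finally show ?thesis .
    qed
    have S\<xi>: "(\<lambda>x. cmod (\<xi> x) powr p) summable_on A" and S\<eta>: "(\<lambda>x. cmod (\<eta> x) powr p) summable_on A"
      using \<xi> \<eta> by (auto simp: lp_def)
    have g_sum: "(g has_sum (C * ((1 - t) * (?a powr p * (1 / ?a powr p))
                          + t * (?b powr p * (1 / ?b powr p))))) A"
      unfolding g_def lp_norm_powr[OF p]
      by (intro has_sum_cmult_right has_sum_cmult_left has_sum_add has_sum_infsum S\<xi> S\<eta>)
    then have g_sum': "(g has_sum C) A"
      using a b by simp
    have S: "(\<lambda>x. cmod (\<xi> x + \<eta> x) powr p) summable_on A"
      by (rule summable_on_comparison_test[OF has_sum_imp_summable[OF g_sum']]) (use le in auto)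
    have "(\<Sum>\<^sub>\<infinity>x\<in>A. cmod (\<xi> x + \<eta> x) powr p) \<le> C"
      using infsum_mono[OF S has_sum_imp_summable[OF g_sum'] le] infsumI[OF g_sum'] by simp
    then have "lp_norm p A (\<lambda>x. \<xi> x + \<eta> x) \<le> C powr (1 / p)"
      unfolding lp_norm_def using p by (intro powr_mono2) (auto simp: infsum_nonneg)
    also have "\<dots> = ?a + ?b"
      using a b p by (simp add: C_def powr_powr)
    finally show ?thesis
      using S \<xi> \<eta> by (auto simp: lp_def)
  qed
  then show "(\<lambda>x. \<xi> x + \<eta> x) \<in> lp p A"
    and "lp_norm p A (\<lambda>x. \<xi> x + \<eta> x) \<le> ?a + ?b" by auto
qed

lemma Metric_space_lp:
  assumes p: "1 \<le> p"
  shows "Metric_space (lp p A) (lp_dist p A)"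
proof
  show "0 \<le> lp_dist p A \<xi> \<eta>" for \<xi> \<eta>
    by (simp add: lp_dist_def lp_norm_nonneg)
  show "lp_dist p A \<xi> \<eta> = lp_dist p A \<eta> \<xi>" for \<xi> \<eta>
    by (simp add: lp_dist_def lp_norm_def norm_minus_commute)
  have diff: "(\<lambda>x. \<xi> x - \<eta> x) \<in> lp p A" if "\<xi> \<in> lp p A" "\<eta> \<in> lp p A" for \<xi> \<eta>
    using lp_add[OF p that(1) lp_scale[OF that(2), of "-1"]] by simp
  show "(lp_dist p A \<xi> \<eta> = 0) = (\<xi> = \<eta>)" if "\<xi> \<in> lp p A" "\<eta> \<in> lp p A" for \<xi> \<eta>
    using lp_norm_eq_0_iff[OF p diff[OF that]] by (auto simp: lp_dist_def fun_eq_iff)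
  show "lp_dist p A \<xi> \<zeta> \<le> lp_dist p A \<xi> \<eta> + lp_dist p A \<eta> \<zeta>"
    if "\<xi> \<in> lp p A" "\<eta> \<in> lp p A" "\<zeta> \<in> lp p A" for \<xi> \<eta> \<zeta>
    using lp_norm_triangle[OF p diff[OF that(1,2)] diff[OF that(2,3)]] by (simp add: lp_dist_def)
qed

definition linear_subspace :: "('a \<Rightarrow> complex) set \<Rightarrow> bool" where
  "linear_subspace S \<longleftrightarrow> (\<lambda>_. 0) \<in> S \<and> (\<forall>\<xi>\<in>S. \<forall>\<eta>\<in>S. (\<lambda>x. \<xi> x + \<eta> x) \<in> S)
     \<and> (\<forall>c. \<forall>\<xi>\<in>S. (\<lambda>x. c * \<xi> x) \<in> S)"

definition left_translate :: "('a, 'm) monoid_scheme \<Rightarrow> 'a \<Rightarrow> ('a \<Rightarrow> complex) \<Rightarrow> 'a \<Rightarrow> complex" where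
  "left_translate G g \<xi> = (\<lambda>h. if h \<in> carrier G then \<xi> (inv\<^bsub>G\<^esub> g \<otimes>\<^bsub>G\<^esub> h) else 0)"

definition closed_invariant_subspace ::
    "('a, 'm) monoid_scheme \<Rightarrow> real \<Rightarrow> ('a \<Rightarrow> complex) set \<Rightarrow> bool" where
  "closed_invariant_subspace G p S \<longleftrightarrow>
     linear_subspace S \<and> closedin (lp_topology p (carrier G)) S
     \<and> (\<forall>g\<in>carrier G. \<forall>\<xi>\<in>S. left_translate G g \<xi> \<in> S)"

definition invariant_exhaustion ::
    "('a, 'm) monoid_scheme \<Rightarrow> real \<Rightarrow> (nat \<Rightarrow> ('a \<Rightarrow> complex) set) \<Rightarrow> bool" where
  "invariant_exhaustion G p E \<longleftrightarrow>
     (\<forall>i. closed_invariant_subspace G p (E i)) \<and> (\<forall>i. E i \<subseteq> E (Suc i))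
     \<and> lp_topology p (carrier G) closure_of (\<Union>i. E i) = lp p (carrier G)"

text \<open>The class of elementary amenable groups, restricted to groups whose elements have type \<open>'u\<close>.
  Taking \<open>Q\<close> isomorphic to, rather than equal to, a quotient keeps all groups over \<open>'u\<close> and (with
  the trivial normal subgroup) makes the class closed under isomorphism.\<close>

inductive elementary_amenable_class :: "'u monoid \<Rightarrow> bool" where
  finite: "\<lbrakk>group G; finite (carrier G)\<rbrakk> \<Longrightarrow> elementary_amenable_class G"
| abelian: "comm_group G \<Longrightarrow> elementary_amenable_class G"
| subgroup: "\<lbrakk>elementary_amenable_class G; subgroup H G\<rbrakk>
    \<Longrightarrow> elementary_amenable_class (G\<lparr>carrier := H\<rparr>)"
| quotient: "\<lbrakk>elementary_amenable_class G; N \<lhd> G; group Q; G Mod N \<cong> Q\<rbrakk>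
    \<Longrightarrow> elementary_amenable_class Q"
| extension: "\<lbrakk>N \<lhd> G; elementary_amenable_class (G\<lparr>carrier := N\<rparr>);
      elementary_amenable_class Q; G Mod N \<cong> Q\<rbrakk>
    \<Longrightarrow> elementary_amenable_class G"
| directed_union: "\<lbrakk>group G; \<H> \<noteq> {}; \<And>H. H \<in> \<H> \<Longrightarrow> subgroup H G;
      \<And>H K. \<lbrakk>H \<in> \<H>; K \<in> \<H>\<rbrakk> \<Longrightarrow> \<exists>L\<in>\<H>. H \<union> K \<subseteq> L;
      carrier G = \<Union>\<H>; \<And>H. H \<in> \<H> \<Longrightarrow> elementary_amenable_class (G\<lparr>carrier := H\<rparr>)\<rbrakk>
    \<Longrightarrow> elementary_amenable_class G"

text \<open>HOL has no class of all groups, so the type \<open>'u\<close> plays the role of a universe: any given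
  derivation that \<open>G\<close> is elementary amenable involves only a set of groups and hence takes place,
  up to isomorphism, over some sufficiently large \<open>'u\<close>. A theorem assuming
  \<open>elementary_amenable TYPE('u) G\<close> with \<open>'u\<close> a free type variable independent of the type of \<open>G\<close>
  therefore covers every elementary amenable group.\<close>

definition elementary_amenable :: "'u itself \<Rightarrow> ('a, 'm) monoid_scheme \<Rightarrow> bool" where
  "elementary_amenable _ G \<longleftrightarrow>
     group G \<and> (\<exists>K :: 'u monoid. elementary_amenable_class K \<and> G \<cong> K)"

end

(*
  Everything is done by right convolution, which commutes with left translation. If convolvers c_i
  satisfy c_(i+1) = c_i e_i, then the kernels E_i = {xi. xi c_i = 0} increase, and they meet
  F = {xi. xi c_i = xi for all i} in 0; if moreover d_i c_i = c_i with the p-norms of d_i tending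
  to 0, then xi - xi d_i lies in E_i and the E_i exhaust. It remains to produce a nonzero F.

  An infinite elementary amenable group has an element of infinite order or an infinite subset all
  of whose finite subsets generate finite subgroups.

  In the first case c_i, d_i and the approximants f_i of an element of F are inverse Fourier
  transforms of functions on the circle supported on (neighbourhoods of) the stages of a Cantor set
  of measure zero that carries a measure with p-summable Fourier coefficients; the stage-j notches
  have relative width about 1/j and are repeated at a very high frequency M_j, which makes the
  p-norms of the products asymptotically multiplicative.

  In the second case c_i = d_i = r_i is a decreasing sequence of projections in the group algebras of
  finite subgroups, with r_i(1) tending to 0 and r_i / r_i(1) bounded in p-norm: r_(i+1) = r_i - u,
  where u <= r_i has relative trace about 1/i and is nearly proportional to r_i on the support of r_i.
  Such a u is a sum of minimal projections, which have small trace in a large finite group; away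
  from the support of r_i its coefficients are controlled by |u(g)| <= u(1) and the 2-norm.
*)
theory Submission
  imports Defs "Jordan_Normal_Form.Spectral_Radius"
begin

section \<open>Right convolution by summable functions and its commutation with left
  translation\<close>

section \<open>Convolution\<close>

text \<open>The hypothesis p > 2 enters through one comparison. Removing a proportion a from the
  identity (a notch of width a, a subprojection of relative trace a) lowers the coefficient at the
  neutral element from 1 to 1 - a. On the circle the other coefficients are at most a and have
  square sum at most a, hence p-power sum at most a^(p-1). With a of order 1/j the losses multiply
  to 0, because the harmonic series diverges; after division of each factor by 1 - a, only an error
  of order j^(-(p-1)) remains, up to a small power of j for projections, and it is summable because
  p - 1 > 1. So one construction yields convolvers with norms tending to 0 and, normalised, a
  bounded sequence with a nonzero limit. A pointwise limit is enough, since l^1 convolvers commute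
  with bounded pointwise limits.

  The integers have no nontrivial idempotents in l^1, so three nested notches share there the roles
  of one projection. Elementary amenability serves only to obtain the two cases; the alternative is
  inherited neither by subgroups nor by quotients, so it is proved for all subquotients at
  once.\<close>

definition bounded_functions :: "'a set \<Rightarrow> ('a \<Rightarrow> complex) set" where
  "bounded_functions A = {\<xi>. (\<forall>x. x \<notin> A \<longrightarrow> \<xi> x = 0) \<and> (\<exists>C. \<forall>x. cmod (\<xi> x) \<le> C)}"

definition convol :: "('a, 'm) monoid_scheme \<Rightarrow> ('a \<Rightarrow> complex) \<Rightarrow> ('a \<Rightarrow> complex) \<Rightarrow> 'a \<Rightarrow> complex" where
  "convol G a b = (\<lambda>x. if x \<in> carrier G
     then \<Sum>\<^sub>\<infinity>y\<in>carrier G. a y * b (inv\<^bsub>G\<^esub> y \<otimes>\<^bsub>G\<^esub> x) else 0)"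

definition point_mass :: "'a \<Rightarrow> 'a \<Rightarrow> complex" where
  "point_mass g = (\<lambda>x. if x = g then 1 else 0)"

lemma lp_zero_outside: "\<xi> \<in> lp p A \<Longrightarrow> x \<notin> A \<Longrightarrow> \<xi> x = 0"
  by (auto simp: lp_def)

lemma lp1_iff: "a \<in> lp 1 A \<longleftrightarrow> (\<forall>x. x \<notin> A \<longrightarrow> a x = 0) \<and> (\<lambda>x. cmod (a x)) summable_on A"
  by (simp add: lp_def)

lemma lp_norm_1: "lp_norm 1 A a = (\<Sum>\<^sub>\<infinity>x\<in>A. cmod (a x))"
  by (simp add: lp_norm_def infsum_nonneg)

lemma norm_le_lp_norm:
  assumes "\<xi> \<in> lp p A" "1 \<le> p"
  shows "cmod (\<xi> x) \<le> lp_norm p A \<xi>"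
proof (cases "x \<in> A")
  case True
  have "cmod (\<xi> x) powr p = (\<Sum>\<^sub>\<infinity>y\<in>{x}. cmod (\<xi> y) powr p)" by simp
  also have "\<dots> \<le> (\<Sum>\<^sub>\<infinity>y\<in>A. cmod (\<xi> y) powr p)"
    using assms True by (intro infsum_mono2) (auto simp: lp_def)
  finally have "(cmod (\<xi> x) powr p) powr (1/p) \<le> lp_norm p A \<xi>"
    unfolding lp_norm_def using assms by (intro powr_mono2) auto
  then show ?thesis using assms by (simp add: powr_powr)
next
  case False
  then show ?thesis using lp_zero_outside[OF assms(1)] lp_norm_nonneg by simp
qed

lemma lp_subset_bounded: "1 \<le> p \<Longrightarrow> \<xi> \<in> lp p A \<Longrightarrow> \<xi> \<in> bounded_functions A"
  unfolding bounded_functions_def using norm_le_lp_norm lp_zero_outside by fastforce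

lemma lp1_subset_lp:
  assumes "a \<in> lp 1 A" "1 \<le> p"
  shows "a \<in> lp p A"
proof -
  let ?N = "lp_norm 1 A a"
  have le: "cmod (a x) powr p \<le> ?N powr (p - 1) * cmod (a x)" for x
  proof (cases "a x = 0")
    case False
    have "cmod (a x) powr p = cmod (a x) powr (p - 1) * cmod (a x)"
      using False by (simp add: powr_diff)
    also have "\<dots> \<le> ?N powr (p - 1) * cmod (a x)"
      using norm_le_lp_norm[OF assms(1)] assms by (intro mult_right_mono powr_mono2) auto
    finally show ?thesis .
  qed simp
  have "(\<lambda>x. ?N powr (p - 1) * cmod (a x)) summable_on A"
    using assms by (auto simp: lp1_iff intro!: summable_on_cmult_right)
  then have "(\<lambda>x. cmod (a x) powr p) summable_on A"
    by (rule summable_on_comparison_test) (use le in auto)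
  then show ?thesis using assms by (auto simp: lp_def)
qed

text \<open>The pointwise bound \<open>|a x|^p <= N^(p-1) * |a x|\<close>, with \<open>N\<close> the
  1-norm, sums to \<open>N^p\<close>.\<close>

lemma lp_norm_le_lp_norm_1:
  assumes "a \<in> lp 1 A" "1 \<le> p"
  shows "lp_norm p A a \<le> lp_norm 1 A a"
proof (cases "lp_norm 1 A a = 0")
  case True
  then have "a = (\<lambda>_. 0)" using lp_norm_eq_0_iff[OF _ assms(1)] by simp
  then show ?thesis by (simp add: lp_norm_def)
next
  case False
  let ?N = "lp_norm 1 A a"
  have N: "?N > 0" using False lp_norm_nonneg[of 1 A a] by simp
  have le: "cmod (a x) powr p \<le> ?N powr (p - 1) * cmod (a x)" for x
  proof (cases "a x = 0")
    case False
    have "cmod (a x) powr p = cmod (a x) powr (p - 1) * cmod (a x)"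
      using False by (simp add: powr_diff)
    also have "\<dots> \<le> ?N powr (p - 1) * cmod (a x)"
      using norm_le_lp_norm[OF assms(1)] assms by (intro mult_right_mono powr_mono2) auto
    finally show ?thesis .
  qed simp
  have "(\<Sum>\<^sub>\<infinity>x\<in>A. cmod (a x) powr p) \<le> (\<Sum>\<^sub>\<infinity>x\<in>A. ?N powr (p - 1) * cmod (a x))"
    using assms lp1_subset_lp[OF assms] le
    by (intro infsum_mono) (auto simp: lp_def intro!: summable_on_cmult_right)
  also have "\<dots> = ?N powr (p - 1) * ?N"
    using assms by (simp add: infsum_cmult_right' lp_norm_1)
  also have "\<dots> = ?N powr p" using N by (simp add: powr_diff)
  finally have "(\<Sum>\<^sub>\<infinity>x\<in>A. cmod (a x) powr p) powr (1/p) \<le> (?N powr p) powr (1/p)"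
    using assms by (intro powr_mono2) (auto simp: infsum_nonneg)
  then show ?thesis
    using assms N by (simp add: powr_powr lp_norm_def[of p])
qed

lemma point_mass_lp1: "g \<in> A \<Longrightarrow> point_mass g \<in> lp 1 A"
proof -
  assume "g \<in> A"
  have "(\<lambda>x. cmod (point_mass g x)) summable_on A"
    by (rule finite_nonzero_values_imp_summable_on, rule finite_subset[of _ "{g}"])
      (auto simp: point_mass_def)
  then show ?thesis using \<open>g \<in> A\<close> by (auto simp: lp1_iff point_mass_def)
qed

lemma lp_diff:
  assumes "1 \<le> p" "\<xi> \<in> lp p A" "\<eta> \<in> lp p A"
  shows "(\<lambda>x. \<xi> x - \<eta> x) \<in> lp p A"
  using lp_add[OF assms(1,2) lp_scale[OF assms(3), of "-1"]] by simp

lemma bounded_functions_scale: "\<xi> \<in> bounded_functions A \<Longrightarrow> (\<lambda>x. c * \<xi> x) \<in> bounded_functions A"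
proof -
  assume "\<xi> \<in> bounded_functions A"
  then obtain C where "\<forall>x. cmod (\<xi> x) \<le> C" and "\<forall>x. x \<notin> A \<longrightarrow> \<xi> x = 0"
    by (auto simp: bounded_functions_def)
  then show ?thesis unfolding bounded_functions_def
    by (auto intro!: exI[of _ "cmod c * C"] mult_left_mono simp: norm_mult)
qed

context group
begin

lemma mult_inv_cancel: "x \<in> carrier G \<Longrightarrow> y \<in> carrier G \<Longrightarrow> x \<otimes> (inv x \<otimes> y) = y"
  by (simp flip: m_assoc)

lemma inv_mult_cancel: "x \<in> carrier G \<Longrightarrow> y \<in> carrier G \<Longrightarrow> inv x \<otimes> (x \<otimes> y) = y"
  by (simp flip: m_assoc)

lemma bij_inv_mult: "x \<in> carrier G \<Longrightarrow> bij_betw (\<lambda>y. inv y \<otimes> x) (carrier G) (carrier G)"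
  by (rule bij_betw_byWitness[where f' = "\<lambda>z. x \<otimes> inv z"])
    (auto simp: inv_mult_group m_assoc mult_inv_cancel)

lemma bij_inv_mult_left: "x \<in> carrier G \<Longrightarrow> bij_betw (\<lambda>y. inv x \<otimes> y) (carrier G) (carrier G)"
  by (rule bij_betw_byWitness[where f' = "\<lambda>z. x \<otimes> z"]) (auto simp: mult_inv_cancel inv_mult_cancel)

text \<open>The map \<open>y\<close> to \<open>inv y \<otimes> x\<close> permutes the group, so the
  second factor is summable in \<open>y\<close>; boundedness of the first is then enough.\<close>

lemma convol_abs_summable:
  assumes \<xi>: "\<xi> \<in> bounded_functions (carrier G)" and a: "a \<in> lp 1 (carrier G)" and x: "x \<in> carrier G"
  shows "(\<lambda>y. norm (\<xi> y * a (inv y \<otimes> x))) summable_on carrier G"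
proof -
  obtain C where C: "\<And>y. cmod (\<xi> y) \<le> C" using \<xi> by (auto simp: bounded_functions_def)
  have "(\<lambda>y. cmod (a (inv y \<otimes> x))) summable_on carrier G"
    using a summable_on_reindex_bij_betw[OF bij_inv_mult[OF x], of "\<lambda>z. cmod (a z)"]
    by (simp add: lp1_iff)
  then have "(\<lambda>y. C * cmod (a (inv y \<otimes> x))) summable_on carrier G"
    by (rule summable_on_cmult_right)
  then show ?thesis
    by (rule summable_on_comparison_test) (use C in \<open>auto simp: norm_mult mult_right_mono\<close>)
qed

lemma convol_summable:
  assumes "\<xi> \<in> bounded_functions (carrier G)" "a \<in> lp 1 (carrier G)" "x \<in> carrier G"
  shows "(\<lambda>y. \<xi> y * a (inv y \<otimes> x)) summable_on carrier G"
  by (rule Infinite_Sum.abs_summable_summable) (rule convol_abs_summable[OF assms])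

lemma norm_convol_le:
  assumes \<xi>: "\<xi> \<in> bounded_functions (carrier G)" and a: "a \<in> lp 1 (carrier G)"
    and C: "\<And>y. cmod (\<xi> y) \<le> C"
  shows "cmod (convol G \<xi> a x) \<le> C * lp_norm 1 (carrier G) a"
proof (cases "x \<in> carrier G")
  case True
  have s: "(\<lambda>y. cmod (a (inv y \<otimes> x))) summable_on carrier G"
    using a summable_on_reindex_bij_betw[OF bij_inv_mult[OF True], of "\<lambda>z. cmod (a z)"]
    by (simp add: lp1_iff)
  have "cmod (convol G \<xi> a x) \<le> (\<Sum>\<^sub>\<infinity>y\<in>carrier G. cmod (\<xi> y * a (inv y \<otimes> x)))"
    using True norm_infsum_bound[OF convol_abs_summable[OF \<xi> a True]] by (simp add: convol_def)
  also have "\<dots> \<le> (\<Sum>\<^sub>\<infinity>y\<in>carrier G. C * cmod (a (inv y \<otimes> x)))"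
    using C by (intro infsum_mono convol_abs_summable \<xi> a True summable_on_cmult_right s)
      (auto simp: norm_mult mult_right_mono)
  also have "\<dots> = C * (\<Sum>\<^sub>\<infinity>y\<in>carrier G. cmod (a (inv y \<otimes> x)))"
    by (simp add: infsum_cmult_right')
  also have "(\<Sum>\<^sub>\<infinity>y\<in>carrier G. cmod (a (inv y \<otimes> x))) = lp_norm 1 (carrier G) a"
    using infsum_reindex_bij_betw[OF bij_inv_mult[OF True], of "\<lambda>z. cmod (a z)"]
    by (simp add: lp_norm_1)
  finally show ?thesis .
next
  case False
  have "0 \<le> C" using C[of x] norm_ge_zero order_trans by blast
  then show ?thesis using False by (simp add: convol_def lp_norm_nonneg)
qed

lemma convol_add_left:
  assumes "\<xi> \<in> bounded_functions (carrier G)" "\<eta> \<in> bounded_functions (carrier G)" "a \<in> lp 1 (carrier G)"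
  shows "convol G (\<lambda>x. \<xi> x + \<eta> x) a = (\<lambda>x. convol G \<xi> a x + convol G \<eta> a x)"
  using infsum_add[OF convol_summable[OF assms(1,3)] convol_summable[OF assms(2,3)]]
  by (auto simp: convol_def fun_eq_iff distrib_right)

lemma convol_scale_left: "convol G (\<lambda>x. c * \<xi> x) a = (\<lambda>x. c * convol G \<xi> a x)"
  by (auto simp: convol_def fun_eq_iff mult.assoc infsum_cmult_right')

lemma convol_diff_left:
  assumes "\<xi> \<in> bounded_functions (carrier G)" "\<eta> \<in> bounded_functions (carrier G)" "a \<in> lp 1 (carrier G)"
  shows "convol G (\<lambda>x. \<xi> x - \<eta> x) a = (\<lambda>x. convol G \<xi> a x - convol G \<eta> a x)"
  using convol_add_left[OF assms(1) bounded_functions_scale[OF assms(2), of "-1"] assms(3)]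
    convol_scale_left[of "-1" \<eta> a] by simp

text \<open>Substitute \<open>inv g \<otimes> y\<close> for \<open>y\<close>. This is why spaces cut
  out by right convolution are invariant.\<close>

lemma convol_left_translate:
  assumes g: "g \<in> carrier G"
  shows "convol G (left_translate G g \<xi>) a = left_translate G g (convol G \<xi> a)"
proof
  fix x
  show "convol G (left_translate G g \<xi>) a x = left_translate G g (convol G \<xi> a) x"
  proof (cases "x \<in> carrier G")
    case True
    have "(\<Sum>\<^sub>\<infinity>y\<in>carrier G. \<xi> (inv g \<otimes> y) * a (inv (inv g \<otimes> y) \<otimes> (inv g \<otimes> x)))
        = (\<Sum>\<^sub>\<infinity>y\<in>carrier G. \<xi> y * a (inv y \<otimes> (inv g \<otimes> x)))"
      by (rule infsum_reindex_bij_betw[OF bij_inv_mult_left[OF g]])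
    moreover have "inv (inv g \<otimes> y) \<otimes> (inv g \<otimes> x) = inv y \<otimes> x" if "y \<in> carrier G" for y
      using that g True by (simp add: inv_mult_group m_assoc mult_inv_cancel)
    ultimately show ?thesis
      using True g by (simp add: convol_def left_translate_def cong: infsum_cong)
  qed (simp add: convol_def left_translate_def)
qed

lemma convol_point_mass_left:
  assumes g: "g \<in> carrier G"
  shows "convol G (point_mass g) a = left_translate G g (\<lambda>x. if x \<in> carrier G then a x else 0)"
proof
  fix x
  show "convol G (point_mass g) a x = left_translate G g (\<lambda>x. if x \<in> carrier G then a x else 0) x"
  proof (cases "x \<in> carrier G")
    case True
    have "(\<Sum>\<^sub>\<infinity>y\<in>carrier G. point_mass g y * a (inv y \<otimes> x))
        = (\<Sum>\<^sub>\<infinity>y\<in>{g}. point_mass g y * a (inv y \<otimes> x))"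
      using g by (intro infsum_cong_neutral) (auto simp: point_mass_def)
    then show ?thesis using True g by (simp add: convol_def left_translate_def point_mass_def)
  qed (simp add: convol_def left_translate_def)
qed

lemma convol_double_summable:
  assumes a: "a \<in> lp 1 (carrier G)" and b: "b \<in> lp 1 (carrier G)"
  shows "(\<lambda>(y, x). cmod (a y * b (inv y \<otimes> x))) summable_on carrier G \<times> carrier G"
proof (rule summable_on_SigmaI[where g = "\<lambda>y. cmod (a y) * lp_norm 1 (carrier G) b"])
  show "((\<lambda>x. case (y, x) of (y, x) \<Rightarrow> cmod (a y * b (inv y \<otimes> x))) has_sum
      cmod (a y) * lp_norm 1 (carrier G) b) (carrier G)" if y: "y \<in> carrier G" for y
  proof -
    have "((\<lambda>x. cmod (b (inv y \<otimes> x))) has_sum lp_norm 1 (carrier G) b) (carrier G)"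
      using b has_sum_reindex_bij_betw[OF bij_inv_mult_left[OF y], of "\<lambda>z. cmod (b z)"]
      by (simp add: lp1_iff lp_norm_1)
    then show ?thesis by (simp add: norm_mult has_sum_cmult_right)
  qed
  show "(\<lambda>y. cmod (a y) * lp_norm 1 (carrier G) b) summable_on carrier G"
    using a by (auto simp: lp1_iff intro: summable_on_cmult_left)
qed auto

lemma convol_lp1:
  assumes a: "a \<in> lp 1 (carrier G)" and b: "b \<in> lp 1 (carrier G)"
  shows "convol G a b \<in> lp 1 (carrier G)"
proof -
  have s: "(\<lambda>(x, y). cmod (a y * b (inv y \<otimes> x))) summable_on carrier G \<times> carrier G"
    using convol_double_summable[OF assms] by (subst summable_on_swap) simp
  have "(\<lambda>x. \<Sum>\<^sub>\<infinity>y\<in>carrier G. cmod (a y * b (inv y \<otimes> x))) summable_on carrier G"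
    using summable_on_Sigma_banach[OF s] by simp
  then have "(\<lambda>x. cmod (convol G a b x)) summable_on carrier G"
  proof (rule summable_on_comparison_test)
    fix x assume x: "x \<in> carrier G"
    show "cmod (convol G a b x) \<le> (\<Sum>\<^sub>\<infinity>y\<in>carrier G. cmod (a y * b (inv y \<otimes> x)))"
      using x norm_infsum_bound[OF convol_abs_summable[OF lp_subset_bounded[OF _ a] b x]]
      by (simp add: convol_def)
  qed auto
  then show ?thesis by (auto simp: lp1_iff convol_def)
qed

text \<open>Fubini. The left factor is only assumed bounded, so that the lemma serves the vectors of
  every \<open>lp p\<close> as well as the characters of the integers in
  \<open>fourier_convol\<close>.\<close>

lemma convol_assoc:
  assumes \<xi>: "\<xi> \<in> bounded_functions (carrier G)" and a: "a \<in> lp 1 (carrier G)" and b: "b \<in> lp 1 (carrier G)"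
  shows "convol G (convol G \<xi> a) b = convol G \<xi> (convol G a b)"
proof
  fix x
  show "convol G (convol G \<xi> a) b x = convol G \<xi> (convol G a b) x"
  proof (cases "x \<in> carrier G")
    case x: True
    obtain C where C: "\<And>y. cmod (\<xi> y) \<le> C" using \<xi> by (auto simp: bounded_functions_def)
    define F where "F z y = \<xi> z * a (inv z \<otimes> y) * b (inv y \<otimes> x)" for z y
    \<comment> \<open>A majorant of the double family: summing over \<open>z\<close> first leaves
      the 1-norm of \<open>a\<close> times a summable function of \<open>y\<close>.\<close>
    have "(\<lambda>(y, z). cmod (b (inv y \<otimes> x)) * cmod (a (inv z \<otimes> y))) summable_on carrier G \<times> carrier G"
    proof (rule summable_on_SigmaI[where g = "\<lambda>y. cmod (b (inv y \<otimes> x)) * lp_norm 1 (carrier G) a"])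
      fix y assume y: "y \<in> carrier G"
      have "((\<lambda>z. cmod (a (inv z \<otimes> y))) has_sum lp_norm 1 (carrier G) a) (carrier G)"
        using a has_sum_reindex_bij_betw[OF bij_inv_mult[OF y], of "\<lambda>z. cmod (a z)"]
        by (simp add: lp1_iff lp_norm_1)
      then show "((\<lambda>z. case (y, z) of (y, z) \<Rightarrow> cmod (b (inv y \<otimes> x)) * cmod (a (inv z \<otimes> y))) has_sum
          cmod (b (inv y \<otimes> x)) * lp_norm 1 (carrier G) a) (carrier G)"
        by (simp add: has_sum_cmult_right)
    next
      have "(\<lambda>y. cmod (b (inv y \<otimes> x))) summable_on carrier G"
        using b summable_on_reindex_bij_betw[OF bij_inv_mult[OF x], of "\<lambda>z. cmod (b z)"]
        by (simp add: lp1_iff)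
      then show "(\<lambda>y. cmod (b (inv y \<otimes> x)) * lp_norm 1 (carrier G) a) summable_on carrier G"
        by (rule summable_on_cmult_left)
    qed auto
    then have "(\<lambda>p. C * (case p of (y, z) \<Rightarrow> cmod (b (inv y \<otimes> x)) * cmod (a (inv z \<otimes> y))))
        summable_on carrier G \<times> carrier G"
      by (rule summable_on_cmult_right)
    then have "(\<lambda>p. norm (case p of (y, z) \<Rightarrow> F z y)) summable_on carrier G \<times> carrier G"
    proof (rule summable_on_comparison_test)
      fix p assume "p \<in> carrier G \<times> carrier G"
      then obtain y z where p: "p = (y, z)" by auto
      have "cmod (\<xi> z) * (cmod (b (inv y \<otimes> x)) * cmod (a (inv z \<otimes> y)))
          \<le> C * (cmod (b (inv y \<otimes> x)) * cmod (a (inv z \<otimes> y)))"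
        using C by (intro mult_right_mono) auto
      then show "norm (case p of (y, z) \<Rightarrow> F z y)
          \<le> C * (case p of (y, z) \<Rightarrow> cmod (b (inv y \<otimes> x)) * cmod (a (inv z \<otimes> y)))"
        by (simp add: p F_def norm_mult mult_ac)
    qed auto
    then have S: "(\<lambda>(y, z). F z y) summable_on carrier G \<times> carrier G"
      by (rule Infinite_Sum.abs_summable_summable)
    have "convol G (convol G \<xi> a) b x
        = (\<Sum>\<^sub>\<infinity>y\<in>carrier G. \<Sum>\<^sub>\<infinity>z\<in>carrier G. F z y)"
      using x by (auto simp: convol_def F_def infsum_cmult_left' intro!: infsum_cong)
    also have "\<dots> = (\<Sum>\<^sub>\<infinity>z\<in>carrier G. \<Sum>\<^sub>\<infinity>y\<in>carrier G. F z y)"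
      using infsum_swap_banach[OF S] .
    also have "\<dots> = (\<Sum>\<^sub>\<infinity>z\<in>carrier G. \<xi> z * convol G a b (inv z \<otimes> x))"
    proof (rule infsum_cong)
      fix z assume z: "z \<in> carrier G"
      have "(\<Sum>\<^sub>\<infinity>y\<in>carrier G. F z y)
          = \<xi> z * (\<Sum>\<^sub>\<infinity>y\<in>carrier G. a (inv z \<otimes> y) * b (inv y \<otimes> x))"
        by (simp add: F_def mult.assoc infsum_cmult_right')
      also have "(\<Sum>\<^sub>\<infinity>y\<in>carrier G. a (inv z \<otimes> y) * b (inv y \<otimes> x))
          = (\<Sum>\<^sub>\<infinity>y\<in>carrier G. a (inv z \<otimes> y) * b (inv (inv z \<otimes> y) \<otimes> (inv z \<otimes> x)))"
      proof (rule infsum_cong)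
        fix y assume y: "y \<in> carrier G"
        have "inv (inv z \<otimes> y) \<otimes> (inv z \<otimes> x) = inv y \<otimes> x"
          using x y z by (simp add: inv_mult_group m_assoc mult_inv_cancel)
        then show "a (inv z \<otimes> y) * b (inv y \<otimes> x)
            = a (inv z \<otimes> y) * b (inv (inv z \<otimes> y) \<otimes> (inv z \<otimes> x))"
          using x y z by simp
      qed
      also have "\<dots> = (\<Sum>\<^sub>\<infinity>y\<in>carrier G. a y * b (inv y \<otimes> (inv z \<otimes> x)))"
        by (rule infsum_reindex_bij_betw[OF bij_inv_mult_left[OF z]])
      finally show "(\<Sum>\<^sub>\<infinity>y\<in>carrier G. F z y) = \<xi> z * convol G a b (inv z \<otimes> x)"
        using x z by (simp add: convol_def)
    qed
    finally show ?thesis using x by (simp add: convol_def)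
  qed (simp add: convol_def)
qed

end

section \<open>Kernels and fixed spaces of convolvers\<close>

section \<open>Exhaustions from convolvers\<close>

text \<open>Dominated convergence for counting measure on an arbitrary set: a finite set carries all
  but \<open>r/4\<close> of \<open>h\<close>, which bounds both tails, and on it the convergence is
  that of a finite sum.\<close>

lemma infsum_dominated_convergence:
  fixes F :: "nat \<Rightarrow> 'a \<Rightarrow> 'b :: banach"
  assumes lim: "\<And>y. y \<in> A \<Longrightarrow> (\<lambda>i. F i y) \<longlonglongrightarrow> F' y"
    and dom: "\<And>i y. y \<in> A \<Longrightarrow> norm (F i y) \<le> h y" and h: "h summable_on A"
  shows "(\<lambda>i. infsum (F i) A) \<longlonglongrightarrow> infsum F' A"
proof (rule LIMSEQ_I)
  fix r :: real assume r: "r > 0"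
  have h0: "h y \<ge> 0" if "y \<in> A" for y using dom[OF that, of 0] norm_ge_zero order_trans by blast
  have dom': "norm (F' y) \<le> h y" if "y \<in> A" for y
    using lim[OF that] dom[OF that] by (intro Lim_bounded[OF tendsto_norm]) auto
  have smF: "(\<lambda>y. norm (F i y)) summable_on B" if "B \<subseteq> A" for i B
    by (rule summable_on_comparison_test[OF summable_on_subset_banach[OF h that]])
      (use dom that in auto)
  have smF': "(\<lambda>y. norm (F' y)) summable_on B" if "B \<subseteq> A" for B
    by (rule summable_on_comparison_test[OF summable_on_subset_banach[OF h that]])
      (use dom' that in auto)
  note sF = Infinite_Sum.abs_summable_summable[OF smF]
  note sF' = Infinite_Sum.abs_summable_summable[OF smF']
  obtain S where S: "finite S" "S \<subseteq> A" "dist (sum h S) (infsum h A) \<le> r/4"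
    using infsum_finite_approximation[OF h, of "r/4"] r by auto
  have tail: "infsum h (A - S) \<le> r/4"
  proof -
    have "infsum h A = sum h S + infsum h (A - S)"
      using infsum_Un_disjoint[of h S "A - S"] S summable_on_subset_banach[OF h, of "A - S"]
      by (simp add: Un_absorb1)
    then show ?thesis using S(3) by (simp add: dist_real_def abs_le_iff)
  qed
  have "(\<lambda>i. \<Sum>y\<in>S. F i y) \<longlonglongrightarrow> (\<Sum>y\<in>S. F' y)"
    using lim S by (intro tendsto_sum) auto
  then obtain N where N: "\<And>i. i \<ge> N \<Longrightarrow> norm ((\<Sum>y\<in>S. F i y) - (\<Sum>y\<in>S. F' y)) < r/4"
    using LIMSEQ_D[of _ _ "r/4"] r by fastforce
  have "norm (infsum (F i) A - infsum F' A) < r" if i: "i \<ge> N" for i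
  proof -
    have e1: "infsum (F i) A = (\<Sum>y\<in>S. F i y) + infsum (F i) (A - S)"
      using infsum_Un_disjoint[of "F i" S "A - S"] S sF[of "A - S" i] by (simp add: Un_absorb1)
    have e2: "infsum F' A = (\<Sum>y\<in>S. F' y) + infsum F' (A - S)"
      using infsum_Un_disjoint[of F' S "A - S"] S sF'[of "A - S"] by (simp add: Un_absorb1)
    have "norm (infsum (F i) (A - S)) \<le> infsum (\<lambda>y. norm (F i y)) (A - S)"
      by (rule norm_infsum_bound) (use smF in auto)
    also have "\<dots> \<le> infsum h (A - S)"
      using dom by (intro infsum_mono smF summable_on_subset_banach[OF h]) auto
    finally have b1: "norm (infsum (F i) (A - S)) \<le> r/4" using tail by simp
    have "norm (infsum F' (A - S)) \<le> infsum (\<lambda>y. norm (F' y)) (A - S)"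
      by (rule norm_infsum_bound) (use smF' in auto)
    also have "\<dots> \<le> infsum h (A - S)"
      using dom' by (intro infsum_mono smF' summable_on_subset_banach[OF h]) auto
    finally have b2: "norm (infsum F' (A - S)) \<le> r/4" using tail by simp
    have "infsum (F i) A - infsum F' A = ((\<Sum>y\<in>S. F i y) - (\<Sum>y\<in>S. F' y))
        + (infsum (F i) (A - S) - infsum F' (A - S))" by (simp add: e1 e2)
    then have "norm (infsum (F i) A - infsum F' A) \<le> norm ((\<Sum>y\<in>S. F i y) - (\<Sum>y\<in>S. F' y))
        + norm (infsum (F i) (A - S) - infsum F' (A - S))"
      by (simp only: norm_triangle_ineq)
    moreover have "norm (infsum (F i) (A - S) - infsum F' (A - S))
        \<le> norm (infsum (F i) (A - S)) + norm (infsum F' (A - S))"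
      by (rule norm_triangle_ineq4)
    ultimately show ?thesis using N[OF i] b1 b2 r by linarith
  qed
  then show "\<exists>N. \<forall>i\<ge>N. norm (infsum (F i) A - infsum F' A) < r" by blast
qed

lemma lp_norm_scale:
  assumes "1 \<le> p"
  shows "lp_norm p A (\<lambda>x. c * \<xi> x) = cmod c * lp_norm p A \<xi>"
proof -
  have "(\<Sum>\<^sub>\<infinity>x\<in>A. cmod (c * \<xi> x) powr p) = cmod c powr p * (\<Sum>\<^sub>\<infinity>x\<in>A. cmod (\<xi> x) powr p)"
    by (simp add: norm_mult powr_mult infsum_cmult_right')
  then show ?thesis
    using assms by (simp add: lp_norm_def powr_mult powr_powr infsum_nonneg)
qed

text \<open>Fatou's lemma: finite partial sums pass to the limit and stay below
  \<open>C powr p\<close>.\<close>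

lemma lp_pointwise_limit:
  assumes p: "1 \<le> p" and f: "\<And>i. f i \<in> lp p A" and C: "\<And>i. lp_norm p A (f i) \<le> C"
    and lim: "\<And>x. (\<lambda>i. f i x) \<longlonglongrightarrow> \<eta> x"
  shows "\<eta> \<in> lp p A"
proof -
  have "sum (\<lambda>x. cmod (\<eta> x) powr p) S \<le> C powr p" if S: "finite S" "S \<subseteq> A" for S
  proof (rule Lim_bounded)
    show "(\<lambda>i. \<Sum>x\<in>S. cmod (f i x) powr p) \<longlonglongrightarrow> (\<Sum>x\<in>S. cmod (\<eta> x) powr p)"
      using p by (intro tendsto_sum tendsto_powr' tendsto_norm lim) auto
    show "\<forall>i\<ge>0. (\<Sum>x\<in>S. cmod (f i x) powr p) \<le> C powr p"
    proof (intro allI impI)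
      fix i
      have "(\<Sum>x\<in>S. cmod (f i x) powr p) \<le> (\<Sum>\<^sub>\<infinity>x\<in>A. cmod (f i x) powr p)"
        using f[of i] S by (intro finite_sum_le_infsum) (auto simp: lp_def)
      also have "\<dots> \<le> C powr p"
        using C[of i] p lp_norm_nonneg[of p A "f i"] by (subst lp_norm_powr[symmetric]) (auto intro: powr_mono2)
      finally show "(\<Sum>x\<in>S. cmod (f i x) powr p) \<le> C powr p" .
    qed
  qed
  then have "(\<lambda>x. cmod (\<eta> x) powr p) summable_on A"
    by (intro nonneg_bdd_above_summable_on) (auto simp: bdd_above_def)
  moreover have "\<eta> x = 0" if "x \<notin> A" for x
    using lim[of x] lp_zero_outside[OF f that] by (simp add: LIMSEQ_const_iff)
  ultimately show ?thesis by (auto simp: lp_def)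
qed

context group
begin

lemma left_translate_lp:
  assumes "\<xi> \<in> lp p (carrier G)" "g \<in> carrier G"
  shows "left_translate G g \<xi> \<in> lp p (carrier G)"
    and "lp_norm p (carrier G) (left_translate G g \<xi>) = lp_norm p (carrier G) \<xi>"
proof -
  have s: "(\<lambda>x. cmod (\<xi> (inv g \<otimes> x)) powr p) summable_on carrier G"
    using assms summable_on_reindex_bij_betw[OF bij_inv_mult_left[OF assms(2)], of "\<lambda>z. cmod (\<xi> z) powr p"]
    by (auto simp: lp_def)
  then have "(\<lambda>x. cmod (left_translate G g \<xi> x) powr p) summable_on carrier G"
    by (rule summable_on_cong[THEN iffD1, rotated]) (auto simp: left_translate_def)
  then show "left_translate G g \<xi> \<in> lp p (carrier G)"
    by (auto simp: lp_def left_translate_def)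
  have "(\<Sum>\<^sub>\<infinity>x\<in>carrier G. cmod (left_translate G g \<xi> x) powr p)
      = (\<Sum>\<^sub>\<infinity>x\<in>carrier G. cmod (\<xi> (inv g \<otimes> x)) powr p)"
    by (rule infsum_cong) (auto simp: left_translate_def)
  then show "lp_norm p (carrier G) (left_translate G g \<xi>) = lp_norm p (carrier G) \<xi>"
    using infsum_reindex_bij_betw[OF bij_inv_mult_left[OF assms(2)], of "\<lambda>z. cmod (\<xi> z) powr p"]
    by (simp add: lp_norm_def)
qed

text \<open>Evaluation at a point, also after convolution with \<open>c\<close>, is continuous for
  the p-norm, so the equation survives limits. The value \<open>k = 0\<close> will give the
  exhaustion and \<open>k = 1\<close> the space \<open>F\<close>.\<close>

lemma closed_invariant_subspace_eigenspace:
  assumes p: "1 \<le> p" and c: "c \<in> lp 1 (carrier G)"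
  shows "closed_invariant_subspace G p {\<xi> \<in> lp p (carrier G). convol G \<xi> c = (\<lambda>x. k * \<xi> x)}"
    (is "closed_invariant_subspace G p ?S")
proof -
  note bd = lp_subset_bounded[OF p]
  interpret M: Metric_space "lp p (carrier G)" "lp_dist p (carrier G)"
    by (rule Metric_space_lp[OF p])
  have lin: "linear_subspace ?S"
    unfolding linear_subspace_def
  proof (intro conjI ballI allI)
    show "(\<lambda>_. 0) \<in> ?S" using lp_zero by (simp add: convol_def fun_eq_iff)
    show "(\<lambda>x. \<xi> x + \<eta> x) \<in> ?S" if "\<xi> \<in> ?S" "\<eta> \<in> ?S" for \<xi> \<eta>
    proof -
      have "\<xi> \<in> lp p (carrier G)" "\<eta> \<in> lp p (carrier G)" using that by auto
      then show ?thesis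
        using that lp_add[OF p] by (simp add: convol_add_left[OF bd bd c] distrib_left)
    qed
    show "(\<lambda>x. a * \<xi> x) \<in> ?S" if "\<xi> \<in> ?S" for a \<xi>
      using that lp_scale[of \<xi> p "carrier G" a] by (simp add: convol_scale_left mult.left_commute)
  qed
  have inv: "left_translate G g \<xi> \<in> ?S" if "g \<in> carrier G" "\<xi> \<in> ?S" for g \<xi>
  proof -
    have "convol G (left_translate G g \<xi>) c = left_translate G g (\<lambda>x. k * \<xi> x)"
      using that by (simp add: convol_left_translate)
    also have "\<dots> = (\<lambda>x. k * left_translate G g \<xi> x)"
      by (simp add: left_translate_def fun_eq_iff)
    finally show ?thesis using that left_translate_lp(1) by blast
  qed
  have "closedin M.mtopology ?S"
    unfolding M.metric_closedin_iff_sequentially_closed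
  proof (intro conjI allI impI)
    fix \<sigma> l assume A: "range \<sigma> \<subseteq> ?S \<and> limitin M.mtopology \<sigma> l sequentially"
    then have l: "l \<in> lp p (carrier G)" using M.limitin_mspace by blast
    let ?K = "lp_norm 1 (carrier G) c + cmod k"
    have K0: "?K \<ge> 0" by (simp add: lp_norm_nonneg)
    have "convol G l c x = k * l x" for x
    proof -
      have "cmod (convol G l c x - k * l x) \<le> e" if e: "e > 0" for e
      proof -
        have "e / (?K + 1) > 0" using K0 e by simp
        then obtain n where n: "lp_dist p (carrier G) (\<sigma> n) l < e / (?K + 1)"
          using A unfolding M.limit_metric_sequentially by blast
        define \<delta> where "\<delta> = (\<lambda>y. l y - \<sigma> n y)"
        have \<sigma>: "\<sigma> n \<in> ?S" using A by blast
        have \<delta>: "\<delta> \<in> lp p (carrier G)" unfolding \<delta>_def using \<sigma> lp_diff[OF p l] by blast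
        have D: "lp_norm p (carrier G) \<delta> < e / (?K + 1)"
          using n M.commute[of "\<sigma> n" l] by (simp add: lp_dist_def \<delta>_def)
        have "convol G l c x - k * l x = convol G \<delta> c x - k * \<delta> x"
        proof -
          have "convol G (\<sigma> n) c x = k * \<sigma> n x" using \<sigma> by simp
          moreover have "convol G \<delta> c x = convol G l c x - convol G (\<sigma> n) c x"
            unfolding \<delta>_def using \<sigma> by (subst convol_diff_left[OF bd[OF l] bd c]) simp_all
          ultimately show ?thesis by (simp add: \<delta>_def algebra_simps)
        qed
        also have "cmod \<dots> \<le> cmod (convol G \<delta> c x) + cmod k * cmod (\<delta> x)"
          by (metis norm_mult norm_triangle_ineq4)
        also have "\<dots> \<le> lp_norm p (carrier G) \<delta> * lp_norm 1 (carrier G) c + cmod k * lp_norm p (carrier G) \<delta>"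
          using norm_le_lp_norm[OF \<delta> p] by (intro add_mono mult_left_mono norm_convol_le bd \<delta> c) auto
        also have "\<dots> = lp_norm p (carrier G) \<delta> * ?K" by (simp add: algebra_simps)
        also have "\<dots> \<le> (e / (?K + 1)) * (?K + 1)"
          using D K0 by (intro mult_mono) (auto simp: lp_norm_nonneg intro: order_trans[OF lp_norm_nonneg less_imp_le])
        finally show ?thesis using K0 by simp
      qed
      then have "cmod (convol G l c x - k * l x) \<le> 0" by (rule field_le_epsilon[of _ 0, simplified])
      then show ?thesis by simp
    qed
    then show "l \<in> ?S" using l by auto
  qed blast+
  then show ?thesis
    using lin inv by (simp add: closed_invariant_subspace_def lp_topology_def)
qed

lemma closed_invariant_subspace_INT:
  assumes "I \<noteq> {}" "\<And>i. i \<in> I \<Longrightarrow> closed_invariant_subspace G p (S i)"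
  shows "closed_invariant_subspace G p (\<Inter>i\<in>I. S i)"
proof -
  have "closedin (lp_topology p (carrier G)) (\<Inter>i\<in>I. S i)"
    using assms by (intro closedin_INT) (auto simp: closed_invariant_subspace_def)
  moreover have "linear_subspace (\<Inter>i\<in>I. S i)"
    using assms(2) by (simp add: closed_invariant_subspace_def linear_subspace_def)
  moreover have "left_translate G g \<xi> \<in> (\<Inter>i\<in>I. S i)"
    if "g \<in> carrier G" "\<xi> \<in> (\<Inter>i\<in>I. S i)" for g \<xi>
    using that assms(2) by (simp add: closed_invariant_subspace_def)
  ultimately show ?thesis by (simp add: closed_invariant_subspace_def)
qed

text \<open>The convolution is a finite combination of left translates of \<open>d\<close>, which
  all have the same p-norm; the induction peels off one translate at a time.\<close>

lemma lp_norm_convol_finite_support: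
  assumes p: "1 \<le> p" and d: "d \<in> lp 1 (carrier G)" and "finite S" "S \<subseteq> carrier G"
    and "\<And>x. x \<notin> S \<Longrightarrow> \<xi> x = 0"
  shows "\<xi> \<in> lp 1 (carrier G)"
    and "lp_norm p (carrier G) (convol G \<xi> d) \<le> (\<Sum>x\<in>S. cmod (\<xi> x)) * lp_norm p (carrier G) d"
proof -
  have l1: "\<xi> \<in> lp 1 (carrier G)" if "finite S" "S \<subseteq> carrier G" "\<And>x. x \<notin> S \<Longrightarrow> \<xi> x = 0" for S \<xi>
  proof -
    have "(\<lambda>x. cmod (\<xi> x)) summable_on carrier G"
      by (rule finite_nonzero_values_imp_summable_on, rule finite_subset[of _ S]) (use that in auto)
    then show ?thesis using that by (auto simp: lp1_iff)
  qed
  then show "\<xi> \<in> lp 1 (carrier G)" using assms by blast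
  show "lp_norm p (carrier G) (convol G \<xi> d) \<le> (\<Sum>x\<in>S. cmod (\<xi> x)) * lp_norm p (carrier G) d"
    using assms(3-)
  proof (induction S arbitrary: \<xi> rule: finite_induct)
    case empty
    then have "\<xi> = (\<lambda>_. 0)" by auto
    then have "convol G \<xi> d = (\<lambda>_. 0)" by (simp add: convol_def fun_eq_iff)
    then show ?case by (simp add: lp_norm_def)
  next
    case (insert g S)
    have g: "g \<in> carrier G" using insert.prems by auto
    define \<xi>' where "\<xi>' = (\<lambda>x. if x = g then 0 else \<xi> x)"
    have \<xi>'_l1: "\<xi>' \<in> lp 1 (carrier G)"
      by (rule l1[OF insert.hyps(1)]) (use insert.prems in \<open>auto simp: \<xi>'_def\<close>)
    have IH: "lp_norm p (carrier G) (convol G \<xi>' d) \<le> (\<Sum>x\<in>S. cmod (\<xi>' x)) * lp_norm p (carrier G) d"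
      by (rule insert.IH) (use insert.prems in \<open>auto simp: \<xi>'_def\<close>)
    have sum': "(\<Sum>x\<in>S. cmod (\<xi>' x)) = (\<Sum>x\<in>S. cmod (\<xi> x))"
      using insert.hyps by (intro sum.cong) (auto simp: \<xi>'_def)
    have dd: "(\<lambda>x. if x \<in> carrier G then d x else 0) = d"
      using lp_zero_outside[OF d] by auto
    have dp: "d \<in> lp p (carrier G)" using lp1_subset_lp[OF d p] .
    have \<xi>_eq: "\<xi> = (\<lambda>x. \<xi> g * point_mass g x + \<xi>' x)"
      by (auto simp: \<xi>'_def point_mass_def)
    have "convol G \<xi> d = (\<lambda>x. convol G (\<lambda>x. \<xi> g * point_mass g x) d x + convol G \<xi>' d x)"
      by (subst \<xi>_eq, rule convol_add_left)
        (auto intro!: bounded_functions_scale lp_subset_bounded[of 1] point_mass_lp1 g \<xi>'_l1 d)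
    also have "\<dots> = (\<lambda>x. \<xi> g * left_translate G g d x + convol G \<xi>' d x)"
      by (simp add: convol_scale_left convol_point_mass_left[OF g] dd)
    finally have "lp_norm p (carrier G) (convol G \<xi> d)
        \<le> lp_norm p (carrier G) (\<lambda>x. \<xi> g * left_translate G g d x) + lp_norm p (carrier G) (convol G \<xi>' d)"
      using lp_norm_triangle[OF p lp_scale[OF left_translate_lp(1)[OF dp g], of "\<xi> g"]
          lp1_subset_lp[OF convol_lp1[OF \<xi>'_l1 d] p]] by simp
    also have "lp_norm p (carrier G) (\<lambda>x. \<xi> g * left_translate G g d x) = cmod (\<xi> g) * lp_norm p (carrier G) d"
      by (simp add: lp_norm_scale[OF p] left_translate_lp(2)[OF dp g])
    finally show ?case using IH insert.hyps by (simp add: sum' distrib_right)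
  qed
qed

text \<open>Only pointwise convergence of \<open>f\<close> and one nonzero coefficient of the limit
  are demanded, which is what infinite products of convolvers provide.\<close>

theorem exhaustion_of_convolvers:
  fixes c d e f :: "nat \<Rightarrow> 'a \<Rightarrow> complex"
  assumes p: "1 \<le> p"
    and c: "\<And>i. c i \<in> lp 1 (carrier G)" and d: "\<And>i. d i \<in> lp 1 (carrier G)"
    and e: "\<And>i. e i \<in> lp 1 (carrier G)"
    and step: "\<And>i. c (Suc i) = convol G (c i) (e i)"
    and dc: "\<And>i. convol G (d i) (c i) = c i"
    and d0: "(\<lambda>i. lp_norm p (carrier G) (d i)) \<longlonglongrightarrow> 0"
    and f: "\<And>i. f i \<in> lp p (carrier G)" and C: "\<And>i. lp_norm p (carrier G) (f i) \<le> C"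
    and lim: "\<And>x. (\<lambda>i. f i x) \<longlonglongrightarrow> \<eta> x"
    and fc: "\<And>i j. j \<le> i \<Longrightarrow> convol G (f i) (c j) = f i"
    and \<eta>: "\<eta> x0 \<noteq> 0"
  shows "\<exists>F E. closed_invariant_subspace G p F \<and> F \<noteq> {\<lambda>_. 0}
           \<and> invariant_exhaustion G p E \<and> (\<forall>i. E i \<inter> F = {\<lambda>_. 0})"
proof -
  note bd = lp_subset_bounded[OF p]
  note bd1 = lp_subset_bounded[of 1, simplified]
  interpret M: Metric_space "lp p (carrier G)" "lp_dist p (carrier G)"
    by (rule Metric_space_lp[OF p])
  define E where "E i = {\<xi> \<in> lp p (carrier G). convol G \<xi> (c i) = (\<lambda>x. 0 * \<xi> x)}" for i
  define F where "F = (\<Inter>j::nat. {\<xi> \<in> lp p (carrier G). convol G \<xi> (c j) = (\<lambda>x. 1 * \<xi> x)})"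
  have F: "closed_invariant_subspace G p F"
    unfolding F_def by (intro closed_invariant_subspace_INT closed_invariant_subspace_eigenspace p c) auto
  have E: "closed_invariant_subspace G p (E i)" for i
    unfolding E_def by (intro closed_invariant_subspace_eigenspace p c)
  have \<eta>_lp: "\<eta> \<in> lp p (carrier G)" by (rule lp_pointwise_limit[OF p f C lim])
  have "\<eta> \<in> F"
    unfolding F_def
  proof (intro INT_I CollectI conjI \<eta>_lp ext)
    fix j x
    show "convol G \<eta> (c j) x = 1 * \<eta> x"
    proof (cases "x \<in> carrier G")
      case x: True
      have s: "(\<lambda>y. cmod (c j (inv y \<otimes> x))) summable_on carrier G"
        using c[of j] summable_on_reindex_bij_betw[OF bij_inv_mult[OF x], of "\<lambda>z. cmod (c j z)"]
        by (simp add: lp1_iff)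
      \<comment> \<open>The values of all \<open>f i\<close> are bounded by \<open>C\<close>, which
        gives a summable majorant, so convolution with \<open>c j\<close> commutes with the
        pointwise limit.\<close>
      have "(\<lambda>i. convol G (f i) (c j) x) \<longlonglongrightarrow> convol G \<eta> (c j) x"
        using x unfolding convol_def if_P[OF x]
      proof (intro infsum_dominated_convergence)
        show "(\<lambda>y. C * cmod (c j (inv y \<otimes> x))) summable_on carrier G"
          by (rule summable_on_cmult_right[OF s])
        show "cmod (f i y * c j (inv y \<otimes> x)) \<le> C * cmod (c j (inv y \<otimes> x))" for i y
          using order_trans[OF norm_le_lp_norm[OF f p] C] by (auto simp: norm_mult intro: mult_right_mono)
      qed (auto intro!: tendsto_intros lim)
      moreover have "(\<lambda>i. convol G (f i) (c j) x) \<longlonglongrightarrow> \<eta> x"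
        by (rule Lim_transform_eventually[OF lim[of x]])
          (use fc in \<open>auto simp: eventually_sequentially intro!: exI[of _ j]\<close>)
      ultimately show ?thesis using LIMSEQ_unique by fastforce
    qed (use lp_zero_outside[OF \<eta>_lp] in \<open>simp add: convol_def\<close>)
  qed
  with \<eta> have "F \<noteq> {\<lambda>_. 0}" by (auto simp: fun_eq_iff)
  moreover have "E i \<inter> F = {\<lambda>_. 0}" for i
  proof
    show "E i \<inter> F \<subseteq> {\<lambda>_. 0}" by (auto simp: E_def F_def fun_eq_iff)
    show "{\<lambda>_. 0} \<subseteq> E i \<inter> F"
      using E[of i] F by (auto simp: closed_invariant_subspace_def linear_subspace_def)
  qed
  moreover have "invariant_exhaustion G p E"
    unfolding invariant_exhaustion_def
  proof (intro conjI allI E)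
    show "E i \<subseteq> E (Suc i)" for i
    proof
      fix \<xi> assume \<xi>: "\<xi> \<in> E i"
      then have "\<xi> \<in> lp p (carrier G)" by (simp add: E_def)
      then have "convol G \<xi> (c (Suc i)) = convol G (convol G \<xi> (c i)) (e i)"
        by (simp add: step convol_assoc[OF bd c e])
      also have "\<dots> = (\<lambda>_. 0)" using \<xi> by (auto simp: E_def convol_def)
      finally show "\<xi> \<in> E (Suc i)" using \<xi> by (simp add: E_def)
    qed
    show "lp_topology p (carrier G) closure_of (\<Union>i. E i) = lp p (carrier G)"
      unfolding lp_topology_def M.metric_closure_of
    proof (intro equalityI subsetI CollectI conjI allI impI)
      fix \<xi> :: "'a \<Rightarrow> complex" and r :: real
      assume \<xi>: "\<xi> \<in> lp p (carrier G)" and r: "r > 0"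
      have S: "(\<lambda>x. cmod (\<xi> x) powr p) summable_on carrier G" using \<xi> by (auto simp: lp_def)
      \<comment> \<open>The factor 1/2 makes the norm of the tail strictly less than
        \<open>r/2\<close>.\<close>
      obtain T where T: "finite T" "T \<subseteq> carrier G"
        "dist (\<Sum>x\<in>T. cmod (\<xi> x) powr p) (\<Sum>\<^sub>\<infinity>x\<in>carrier G. cmod (\<xi> x) powr p) \<le> (r/2) powr p / 2"
        using infsum_finite_approximation[OF S, of "(r/2) powr p / 2"] r by auto
      define \<xi>' where "\<xi>' = (\<lambda>x. if x \<in> T then \<xi> x else 0)"
      have \<xi>'_l1: "\<xi>' \<in> lp 1 (carrier G)"
        by (rule lp_norm_convol_finite_support(1)[OF p d T(1,2)]) (auto simp: \<xi>'_def)
      note \<xi>'_lp = lp1_subset_lp[OF \<xi>'_l1 p]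
      have "(\<Sum>\<^sub>\<infinity>x\<in>carrier G. cmod (\<xi> x - \<xi>' x) powr p) = (\<Sum>\<^sub>\<infinity>x\<in>carrier G - T. cmod (\<xi> x) powr p)"
        by (rule infsum_cong_neutral) (auto simp: \<xi>'_def)
      also have "\<dots> < (r/2) powr p"
      proof -
        have "(\<Sum>\<^sub>\<infinity>x\<in>carrier G. cmod (\<xi> x) powr p)
            = (\<Sum>x\<in>T. cmod (\<xi> x) powr p) + (\<Sum>\<^sub>\<infinity>x\<in>carrier G - T. cmod (\<xi> x) powr p)"
          using infsum_Un_disjoint[of "\<lambda>x. cmod (\<xi> x) powr p" T "carrier G - T"] T
            summable_on_subset_banach[OF S, of "carrier G - T"] by (simp add: Un_absorb1)
        moreover have "(r/2) powr p / 2 < (r/2) powr p" using r by simp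
        ultimately show ?thesis using T(3) unfolding dist_real_def abs_le_iff by linarith
      qed
      finally have "lp_norm p (carrier G) (\<lambda>x. \<xi> x - \<xi>' x) < ((r/2) powr p) powr (1/p)"
        unfolding lp_norm_def using p by (intro powr_less_mono2) (auto simp: infsum_nonneg)
      then have n1: "lp_norm p (carrier G) (\<lambda>x. \<xi> x - \<xi>' x) < r/2"
        using p r by (simp add: powr_powr)
      have "(\<lambda>i. (\<Sum>x\<in>T. cmod (\<xi>' x)) * lp_norm p (carrier G) (d i)) \<longlonglongrightarrow> (\<Sum>x\<in>T. cmod (\<xi>' x)) * 0"
        by (intro tendsto_intros d0)
      then have "\<forall>\<^sub>F i in sequentially. (\<Sum>x\<in>T. cmod (\<xi>' x)) * lp_norm p (carrier G) (d i) < r/2"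
        using r by (intro order_tendstoD) auto
      then obtain i where i: "(\<Sum>x\<in>T. cmod (\<xi>' x)) * lp_norm p (carrier G) (d i) < r/2"
        by (auto simp: eventually_sequentially)
      have n2: "lp_norm p (carrier G) (convol G \<xi>' (d i)) < r/2"
        using lp_norm_convol_finite_support(2)[OF p d[of i] T(1,2), of \<xi>'] i by (auto simp: \<xi>'_def)
      \<comment> \<open>\<open>d i\<close> is a left unit for \<open>c i\<close>, so
        \<open>\<zeta>\<close> is killed by \<open>c i\<close>; it differs from
        \<open>\<xi>'\<close> by a function of norm less than \<open>r/2\<close>.\<close>
      define \<zeta> where "\<zeta> = (\<lambda>x. \<xi>' x - convol G \<xi>' (d i) x)"
      have cl: "convol G \<xi>' (d i) \<in> lp 1 (carrier G)" by (rule convol_lp1[OF \<xi>'_l1 d])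
      have \<zeta>_lp: "\<zeta> \<in> lp p (carrier G)"
        unfolding \<zeta>_def by (rule lp_diff[OF p \<xi>'_lp lp1_subset_lp[OF cl p]])
      have "convol G \<zeta> (c i) = (\<lambda>x. convol G \<xi>' (c i) x - convol G (convol G \<xi>' (d i)) (c i) x)"
        unfolding \<zeta>_def by (intro convol_diff_left bd1 \<xi>'_l1 cl c)
      also have "\<dots> = (\<lambda>_. 0)"
        using convol_assoc[OF bd1[OF \<xi>'_l1] d c, of i i] dc by simp
      finally have "\<zeta> \<in> E i" using \<zeta>_lp by (simp add: E_def)
      moreover have "lp_dist p (carrier G) \<xi> \<zeta> < r"
      proof -
        have "(\<lambda>x. \<xi> x - \<zeta> x) = (\<lambda>x. (\<xi> x - \<xi>' x) + convol G \<xi>' (d i) x)"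
          by (auto simp: \<zeta>_def)
        then show ?thesis
          using lp_norm_triangle[OF p lp_diff[OF p \<xi> \<xi>'_lp] lp1_subset_lp[OF cl p]] n1 n2
          by (simp add: lp_dist_def)
      qed
      ultimately show "\<exists>y\<in>\<Union> (range E). y \<in> M.mball \<xi> r"
        using \<xi> \<zeta>_lp by (intro bexI[of _ \<zeta>] UN_I[of i]) (simp_all add: M.in_mball)
    qed blast+
  qed
  ultimately show ?thesis using F by (intro exI[of _ F] exI[of _ E] conjI allI) assumption+
qed

end

section \<open>Orthonormal lists, representing vectors and eigenvectors over a finite set\<close>

section \<open>Finite-dimensional spaces of functions\<close>

definition supported :: "'a set \<Rightarrow> ('a \<Rightarrow> complex) set" where
  "supported B = {a. \<forall>x. x \<notin> B \<longrightarrow> a x = 0}"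

definition ip :: "'a set \<Rightarrow> ('a \<Rightarrow> complex) \<Rightarrow> ('a \<Rightarrow> complex) \<Rightarrow> complex" where
  "ip B a b = (\<Sum>y\<in>B. a y * cnj (b y))"

lemma ip_diff_left: "ip B (\<lambda>x. a x - b x) c = ip B a c - ip B b c"
  by (simp add: ip_def sum_subtractf left_diff_distrib)

lemma ip_scale_left: "ip B (\<lambda>x. k * a x) c = k * ip B a c"
  by (simp add: ip_def sum_distrib_left mult.assoc)

lemma ip_sum_left: "ip B (\<lambda>x. \<Sum>i\<in>I. f i x) c = (\<Sum>i\<in>I. ip B (f i) c)"
  unfolding ip_def sum_distrib_right by (rule sum.swap)

lemma ip_commute: "ip B a b = cnj (ip B b a)"
  by (simp add: ip_def mult.commute)

lemma mult_cnj_self: "z * cnj z = of_real ((cmod z)\<^sup>2)"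
  by (rule complex_norm_square[symmetric])

lemma ip_self: "ip B a a = of_real (\<Sum>y\<in>B. (cmod (a y))\<^sup>2)"
  by (simp add: ip_def mult_cnj_self)

lemma ip_self_eq_0:
  assumes "finite B" "a \<in> supported B" "ip B a a = 0"
  shows "a = (\<lambda>_. 0)"
proof -
  have "(\<Sum>y\<in>B. (cmod (a y))\<^sup>2) = 0" using assms(3) unfolding ip_self of_real_eq_0_iff .
  then have "\<forall>y\<in>B. a y = 0" using assms(1) by (simp add: sum_nonneg_eq_0_iff)
  then show ?thesis using assms(2) by (auto simp: supported_def)
qed

definition orthonormal_list :: "'a set \<Rightarrow> ('a \<Rightarrow> complex) list \<Rightarrow> bool" where
  "orthonormal_list B es \<longleftrightarrow>
     (\<forall>i<length es. \<forall>j<length es. ip B (es ! i) (es ! j) = (if i = j then 1 else 0))"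

lemma ip_orthonormal_sum:
  assumes "orthonormal_list B es" "j < length es"
  shows "ip B (\<lambda>x. \<Sum>i<length es. k i * (es ! i) x) (es ! j) = k j"
proof -
  have "ip B (\<lambda>x. \<Sum>i<length es. k i * (es ! i) x) (es ! j)
      = (\<Sum>i<length es. k i * ip B (es ! i) (es ! j))"
    by (simp add: ip_sum_left ip_scale_left)
  also have "\<dots> = (\<Sum>i<length es. if i = j then k j else 0)"
    using assms by (intro sum.cong) (auto simp: orthonormal_list_def)
  finally show ?thesis using assms(2) by simp
qed

text \<open>Bessel's inequality for the point mass at \<open>b\<close>: \<open>w\<close> is its
  projection onto the span of \<open>es\<close>, and the remainder \<open>v\<close> has squared norm
  \<open>1 - s\<close>.\<close>

lemma bessel_coordinate:
  assumes B: "finite B" "b \<in> B" and es: "orthonormal_list B es"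
  shows "(\<Sum>i<length es. (cmod ((es ! i) b))\<^sup>2) \<le> 1"
proof -
  define w where "w = (\<lambda>x. \<Sum>i<length es. cnj ((es ! i) b) * (es ! i) x)"
  define v where "v = (\<lambda>x. point_mass b x - w x)"
  define s where "s = (\<Sum>i<length es. (cmod ((es ! i) b))\<^sup>2)"
  have pm: "ip B (point_mass b) c = cnj (c b)" for c
    using B by (simp add: ip_def point_mass_def if_distrib[of "\<lambda>z. z * _"] cong: if_cong)
  have wb: "w b = of_real s"
    by (simp add: w_def s_def mult_cnj_self mult.commute[of "cnj _"])
  have ww: "ip B w w = of_real s"
  proof -
    have "ip B w w = (\<Sum>i<length es. cnj ((es ! i) b) * ip B (es ! i) w)"
      by (subst (1) w_def) (simp add: ip_sum_left ip_scale_left)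
    also have "\<dots> = (\<Sum>i<length es. cnj ((es ! i) b) * (es ! i) b)"
    proof (rule sum.cong)
      fix i assume "i \<in> {..<length es}"
      then have "ip B w (es ! i) = cnj ((es ! i) b)"
        unfolding w_def by (intro ip_orthonormal_sum es) auto
      then show "cnj ((es ! i) b) * ip B (es ! i) w = cnj ((es ! i) b) * (es ! i) b"
        by (subst ip_commute) simp
    qed simp
    also have "\<dots> = of_real s" by (simp add: s_def mult_cnj_self mult.commute[of "cnj _"])
    finally show ?thesis .
  qed
  have "ip B v v = ip B (point_mass b) v - ip B w v"
    unfolding v_def by (rule ip_diff_left)
  also have "ip B (point_mass b) v = 1 - of_real s"
    unfolding pm by (simp add: v_def wb point_mass_def)
  also have "ip B w v = cnj (ip B v w)" by (rule ip_commute)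
  also have "ip B v w = 0"
    unfolding v_def ip_diff_left pm wb ww by simp
  finally have "ip B v v = of_real (1 - s)" by simp
  then have "1 - s = (\<Sum>y\<in>B. (cmod (v y))\<^sup>2)" unfolding ip_self of_real_eq_iff by simp
  then have "1 - s \<ge> 0" by (simp add: sum_nonneg)
  then show ?thesis by (simp add: s_def)
qed

text \<open>Sum the squared coordinates in both orders: each list entry contributes 1, each point at
  most 1. The bound guarantees a longest orthonormal list.\<close>

lemma length_orthonormal_le_card:
  assumes B: "finite B" and es: "orthonormal_list B es"
  shows "length es \<le> card B"
proof -
  have "real (length es) = (\<Sum>i<length es. \<Sum>b\<in>B. (cmod ((es ! i) b))\<^sup>2)"
  proof -
    have "(\<Sum>b\<in>B. (cmod ((es ! i) b))\<^sup>2) = 1" if "i < length es" for i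
    proof -
      have "ip B (es ! i) (es ! i) = 1" using es that by (auto simp: orthonormal_list_def)
      then show ?thesis unfolding ip_self of_real_eq_1_iff .
    qed
    then show ?thesis by simp
  qed
  also have "\<dots> = (\<Sum>b\<in>B. \<Sum>i<length es. (cmod ((es ! i) b))\<^sup>2)" by (rule sum.swap)
  also have "\<dots> \<le> (\<Sum>b\<in>B. 1)" using bessel_coordinate[OF B _ es] by (intro sum_mono)
  finally show ?thesis by simp
qed

lemma linear_subspace_sum:
  assumes "linear_subspace J" "\<And>i. i \<in> I \<Longrightarrow> f i \<in> J" "finite I"
  shows "(\<lambda>x. \<Sum>i\<in>I. k i * f i x) \<in> J"
  using assms(3,2)
proof (induction I rule: finite_induct)
  case empty
  then show ?case using assms(1) by (simp add: linear_subspace_def)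
next
  case (insert a I)
  then show ?case using assms(1) by (simp add: linear_subspace_def)
qed

lemma linear_subspace_diff:
  assumes "linear_subspace J" "a \<in> J" "b \<in> J"
  shows "(\<lambda>x. a x - b x) \<in> J"
proof -
  have "(\<lambda>x. (-1) * b x) \<in> J" using assms unfolding linear_subspace_def by blast
  moreover have "\<forall>\<xi>\<in>J. \<forall>\<eta>\<in>J. (\<lambda>x. \<xi> x + \<eta> x) \<in> J"
    using assms(1) unfolding linear_subspace_def by blast
  ultimately have "(\<lambda>x. a x + (-1) * b x) \<in> J" using assms(2) by (elim ballE) auto
  then show ?thesis by simp
qed

text \<open>Gram-Schmidt in extremal form: for a longest orthonormal list, a nonzero remainder could
  be normalised and appended.\<close>

lemma orthonormal_basis_exists:
  assumes B: "finite B" and J: "linear_subspace J" "J \<subseteq> supported B"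
  shows "\<exists>es. set es \<subseteq> J \<and> orthonormal_list B es
    \<and> (\<forall>x\<in>J. x = (\<lambda>y. \<Sum>i<length es. ip B x (es ! i) * (es ! i) y))"
proof -
  let ?P = "\<lambda>es. set es \<subseteq> J \<and> orthonormal_list B es"
  have "?P []" by (simp add: orthonormal_list_def)
  moreover have "\<forall>es. ?P es \<longrightarrow> length es < Suc (card B)"
    using length_orthonormal_le_card[OF B] by (simp add: less_Suc_eq_le)
  ultimately have "\<exists>es. ?P es \<and> (\<forall>es'. ?P es' \<longrightarrow> length es' \<le> length es)"
    by (rule ex_has_greatest_nat)
  then obtain es where es: "?P es" and mx: "\<And>es'. ?P es' \<Longrightarrow> length es' \<le> length es"
    by metis
  have "x = (\<lambda>y. \<Sum>i<length es. ip B x (es ! i) * (es ! i) y)" if x: "x \<in> J" for x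
  proof (rule ccontr)
    define w where "w = (\<lambda>y. \<Sum>i<length es. ip B x (es ! i) * (es ! i) y)"
    assume "x \<noteq> (\<lambda>y. \<Sum>i<length es. ip B x (es ! i) * (es ! i) y)"
    then have ne: "x \<noteq> w" by (simp add: w_def)
    have w: "w \<in> J" unfolding w_def using es by (intro linear_subspace_sum J) auto
    define v where "v = (\<lambda>y. x y - w y)"
    have v: "v \<in> J" unfolding v_def by (rule linear_subspace_diff[OF J(1) x w])
    have ort: "ip B v (es ! j) = 0" if "j < length es" for j
      unfolding v_def ip_diff_left w_def
      using ip_orthonormal_sum[OF _ that] es by simp
    define s where "s = (\<Sum>y\<in>B. (cmod (v y))\<^sup>2)"
    have s: "ip B v v = of_real s" by (simp add: ip_self s_def)
    have "s \<noteq> 0"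
    proof
      assume "s = 0"
      then have "v = (\<lambda>_. 0)" using ip_self_eq_0[OF B] v J(2) s by auto
      then show False using ne by (auto simp: v_def fun_eq_iff)
    qed
    then have s0: "s > 0" using sum_nonneg[of B "\<lambda>y. (cmod (v y))\<^sup>2"] by (simp add: s_def)
    define z where "z = (\<lambda>y. of_real (1 / sqrt s) * v y)"
    have z: "z \<in> J" using v J(1) unfolding z_def linear_subspace_def by blast
    have zv: "ip B z c = of_real (1 / sqrt s) * ip B v c" for c unfolding z_def by (rule ip_scale_left)
    have "ip B v z = of_real (1 / sqrt s) * of_real s"
      by (subst ip_commute) (simp add: zv s)
    then have "ip B z z = of_real (1 / sqrt s * (1 / sqrt s * s))"
      by (simp only: zv of_real_mult)
    also have "1 / sqrt s * (1 / sqrt s * s) = 1" using s0 by (simp add: field_simps)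
    finally have zz: "ip B z z = 1" by simp
    have zo: "ip B z (es ! j) = 0" "ip B (es ! j) z = 0" if "j < length es" for j
      using ort[OF that] zv ip_commute[of B "es ! j" z] by auto
    have "orthonormal_list B (es @ [z])"
      unfolding orthonormal_list_def
    proof (intro allI impI)
      fix i j assume "i < length (es @ [z])" "j < length (es @ [z])"
      then consider "i < length es" "j < length es" | "i = length es" "j < length es"
        | "i < length es" "j = length es" | "i = length es" "j = length es" by fastforce
      then show "ip B ((es @ [z]) ! i) ((es @ [z]) ! j) = (if i = j then 1 else 0)"
        using es zz zo by cases (simp_all add: nth_append orthonormal_list_def)
    qed
    then have "?P (es @ [z])" using es z by simp
    from mx[OF this] show False by simp
  qed
  with es show ?thesis by blast
qed

text \<open>The representing vector is the reproducing kernel at \<open>b\<close>, the combination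
  of the basis vectors \<open>e\<close> with coefficients \<open>cnj (e b)\<close>.\<close>

lemma riesz_representation:
  assumes B: "finite B" and J: "linear_subspace J" "J \<subseteq> supported B"
  shows "\<exists>u\<in>J. \<forall>x\<in>J. ip B x u = x b"
proof -
  obtain es where es: "set es \<subseteq> J" "orthonormal_list B es"
    and ex: "\<And>x. x \<in> J \<Longrightarrow> x = (\<lambda>y. \<Sum>i<length es. ip B x (es ! i) * (es ! i) y)"
    using orthonormal_basis_exists[OF assms] by blast
  define u where "u = (\<lambda>y. \<Sum>i<length es. cnj ((es ! i) b) * (es ! i) y)"
  have "u \<in> J" unfolding u_def using es by (intro linear_subspace_sum J) auto
  moreover have "ip B x u = x b" if x: "x \<in> J" for x
  proof -
    have "ip B u x = (\<Sum>i<length es. cnj ((es ! i) b) * ip B (es ! i) x)"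
      by (simp add: u_def ip_sum_left ip_scale_left)
    then have "ip B x u = (\<Sum>i<length es. (es ! i) b * ip B x (es ! i))"
      by (subst ip_commute) (simp add: ip_commute[of B _ x])
    also have "\<dots> = x b"
      by (subst (2) ex[OF x]) (simp add: mult.commute)
    finally show ?thesis .
  qed
  ultimately show ?thesis by blast
qed

text \<open>The complex matrix of \<open>L\<close> in an orthonormal basis has nonempty spectrum.
  Linearity is stated for finite combinations, the form in which \<open>convol_sum_right\<close>
  supplies it.\<close>

lemma eigenvector_exists:
  assumes B: "finite B" and J: "linear_subspace J" "J \<subseteq> supported B" and ne: "J \<noteq> {\<lambda>_. 0}"
    and L: "\<And>x. x \<in> J \<Longrightarrow> L x \<in> J"
    and lin: "\<And>I k f. finite I \<Longrightarrow> f ` I \<subseteq> J \<Longrightarrow>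
        L (\<lambda>y. \<Sum>i\<in>I. k i * f i y) = (\<lambda>y. \<Sum>i\<in>(I::nat set). k i * L (f i) y)"
  shows "\<exists>\<mu>. \<exists>z\<in>J. z \<noteq> (\<lambda>_. 0) \<and> L z = (\<lambda>y. \<mu> * z y)"
proof -
  obtain es where es: "set es \<subseteq> J" "orthonormal_list B es"
    and ex: "\<And>x. x \<in> J \<Longrightarrow> x = (\<lambda>y. \<Sum>i<length es. ip B x (es ! i) * (es ! i) y)"
    using orthonormal_basis_exists[OF B J] by blast
  define n where "n = length es"
  have "n > 0"
  proof (rule ccontr)
    assume "\<not> n > 0"
    then have "x = (\<lambda>_. 0)" if "x \<in> J" for x using ex[OF that] by (simp add: n_def)
    then show False using ne J(1) by (auto simp: linear_subspace_def)
  qed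
  define M where "M = mat n n (\<lambda>(i, j). ip B (L (es ! j)) (es ! i))"
  have M: "M \<in> carrier_mat n n" by (simp add: M_def)
  obtain \<mu> where "\<mu> \<in> spectrum M" using spectrum_non_empty[OF M \<open>n > 0\<close>] by blast
  then obtain v where v: "v \<in> carrier_vec n" "v \<noteq> 0\<^sub>v n" "M *\<^sub>v v = \<mu> \<cdot>\<^sub>v v"
    using M unfolding spectrum_def eigenvalue_def eigenvector_def by auto
  define z where "z = (\<lambda>y. \<Sum>i<n. v $ i * (es ! i) y)"
  have esJ: "es ! i \<in> J" if "i < n" for i using es(1) that by (auto simp: n_def)
  have z: "z \<in> J" unfolding z_def using esJ by (intro linear_subspace_sum J) auto
  have "L z = (\<lambda>y. \<Sum>j<n. v $ j * L (es ! j) y)"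
    unfolding z_def using esJ by (intro lin) auto
  also have "\<dots> = (\<lambda>y. \<Sum>j<n. v $ j * (\<Sum>i<n. ip B (L (es ! j)) (es ! i) * (es ! i) y))"
  proof (intro ext sum.cong refl)
    fix y j assume "j \<in> {..<n}"
    then have "L (es ! j) \<in> J" using L esJ by auto
    from ex[OF this] have "L (es ! j) y = (\<Sum>i<n. ip B (L (es ! j)) (es ! i) * (es ! i) y)"
      unfolding n_def by (rule fun_cong)
    then show "v $ j * L (es ! j) y = v $ j * (\<Sum>i<n. ip B (L (es ! j)) (es ! i) * (es ! i) y)"
      by simp
  qed
  also have "\<dots> = (\<lambda>y. \<Sum>i<n. (\<Sum>j<n. ip B (L (es ! j)) (es ! i) * v $ j) * (es ! i) y)"
    unfolding sum_distrib_left sum_distrib_right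
    by (subst sum.swap) (simp add: mult_ac)
  also have "\<dots> = (\<lambda>y. \<Sum>i<n. (\<mu> * v $ i) * (es ! i) y)"
  proof (intro ext sum.cong refl)
    fix y i assume "i \<in> {..<n}"
    then have i: "i < n" by simp
    have "(M *\<^sub>v v) $ i = (\<Sum>j<n. ip B (L (es ! j)) (es ! i) * v $ j)"
      using i v(1) by (simp add: M_def scalar_prod_def atLeast0LessThan)
    also have "(M *\<^sub>v v) $ i = \<mu> * v $ i" using i v(1,3) by simp
    finally show "(\<Sum>j<n. ip B (L (es ! j)) (es ! i) * v $ j) * (es ! i) y = \<mu> * v $ i * (es ! i) y"
      by simp
  qed
  also have "\<dots> = (\<lambda>y. \<mu> * z y)" by (simp add: z_def sum_distrib_left mult.assoc)
  finally have "L z = (\<lambda>y. \<mu> * z y)" .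
  moreover have "z \<noteq> (\<lambda>_. 0)"
  proof
    assume z0: "z = (\<lambda>_. 0)"
    have "v $ j = 0" if "j < n" for j
    proof -
      have "ip B z (es ! j) = v $ j"
        unfolding z_def n_def using that by (intro ip_orthonormal_sum es) (simp add: n_def)
      then show ?thesis by (simp add: z0 ip_def)
    qed
    then have "v = 0\<^sub>v n" using v(1) by (intro eq_vecI) auto
    with v(2) show False by simp
  qed
  ultimately show ?thesis using z by blast
qed

section \<open>The star-algebra of a finite subgroup: trace, order and right ideals\<close>

section \<open>Projections in the group algebra of a finite subgroup\<close>

text \<open>Convolution by this function is the Hilbert space adjoint of convolution by
  \<open>a\<close>.\<close>

definition adj :: "('a, 'm) monoid_scheme \<Rightarrow> ('a \<Rightarrow> complex) \<Rightarrow> 'a \<Rightarrow> complex" where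
  "adj G a = (\<lambda>x. if x \<in> carrier G then cnj (a (inv\<^bsub>G\<^esub> x)) else 0)"

text \<open>\<open>B\<close> only bounds the support, so a projection remains one for every larger
  set; this makes it possible to move along a chain of subgroups.\<close>

definition projection :: "('a, 'm) monoid_scheme \<Rightarrow> 'a set \<Rightarrow> ('a \<Rightarrow> complex) \<Rightarrow> bool" where
  "projection G B r \<longleftrightarrow> r \<in> supported B \<and> adj G r = r \<and> convol G r r = r"

lemma supportedD: "a \<in> supported B \<Longrightarrow> x \<notin> B \<Longrightarrow> a x = 0"
  by (simp add: supported_def)

lemma supported_mono: "B \<subseteq> B' \<Longrightarrow> supported B \<subseteq> supported B'"
  by (auto simp: supported_def)

lemma supported_ext: "a \<in> supported B \<Longrightarrow> b \<in> supported B \<Longrightarrow> (\<And>x. x \<in> B \<Longrightarrow> a x = b x) \<Longrightarrow> a = b"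
  by (force simp: supported_def)

lemma linear_subspace_supported: "linear_subspace (supported B)"
  by (auto simp: linear_subspace_def supported_def)

lemma adj_add: "adj G (\<lambda>x. a x + b x) = (\<lambda>x. adj G a x + adj G b x)"
  and adj_diff: "adj G (\<lambda>x. a x - b x) = (\<lambda>x. adj G a x - adj G b x)"
  and adj_zero: "adj G (\<lambda>_. 0) = (\<lambda>_. 0)"
  by (simp_all add: adj_def fun_eq_iff)

locale finite_subgroup = group G for G (structure) +
  fixes B assumes subgroup_B: "subgroup B G" and finite_B: "finite B"
begin

lemma B_carrier: "x \<in> B \<Longrightarrow> x \<in> carrier G"
  using subgroup.subset[OF subgroup_B] by blast

lemma B_closed [simp, intro]: "\<one> \<in> B" "x \<in> B \<Longrightarrow> y \<in> B \<Longrightarrow> x \<otimes> y \<in> B" "x \<in> B \<Longrightarrow> inv x \<in> B"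
  using subgroup_B by (auto simp: subgroup.one_closed subgroup.m_closed subgroup.m_inv_closed)

lemma supported_lp1: "a \<in> supported B \<Longrightarrow> a \<in> lp 1 (carrier G)"
proof -
  assume a: "a \<in> supported B"
  have "(\<lambda>x. cmod (a x)) summable_on carrier G"
    by (rule finite_nonzero_values_imp_summable_on, rule finite_subset[OF _ finite_B])
      (use a in \<open>auto simp: supported_def\<close>)
  then show ?thesis using a B_carrier by (auto simp: lp1_iff supported_def)
qed

lemma supported_bounded: "a \<in> supported B \<Longrightarrow> a \<in> bounded_functions (carrier G)"
  using lp_subset_bounded[of 1] supported_lp1 by auto

lemma convol_eq_sum:
  assumes "a \<in> supported B" "x \<in> carrier G"
  shows "convol G a b x = (\<Sum>y\<in>B. a y * b (inv y \<otimes> x))"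
proof -
  have "(\<Sum>\<^sub>\<infinity>y\<in>carrier G. a y * b (inv y \<otimes> x)) = (\<Sum>\<^sub>\<infinity>y\<in>B. a y * b (inv y \<otimes> x))"
    using assms B_carrier by (intro infsum_cong_neutral) (auto simp: supported_def)
  then show ?thesis using assms finite_B by (simp add: convol_def)
qed

lemma convol_supported:
  assumes "a \<in> supported B" "b \<in> supported B"
  shows "convol G a b \<in> supported B"
  unfolding supported_def
proof (intro CollectI allI impI)
  fix x assume x: "x \<notin> B"
  show "convol G a b x = 0"
  proof (cases "x \<in> carrier G")
    case True
    have "b (inv y \<otimes> x) = 0" if y: "y \<in> B" for y
    proof (rule supportedD[OF assms(2)])
      show "inv y \<otimes> x \<notin> B"
        using B_closed(2)[OF y, of "inv y \<otimes> x"] x True B_carrier[OF y] by (auto simp: mult_inv_cancel)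
    qed
    then show ?thesis using convol_eq_sum[OF assms(1) True] by simp
  qed (simp add: convol_def)
qed

lemma convol_assoc_supported:
  "a \<in> supported B \<Longrightarrow> b \<in> supported B \<Longrightarrow> c \<in> supported B
    \<Longrightarrow> convol G (convol G a b) c = convol G a (convol G b c)"
  by (rule convol_assoc) (auto intro: supported_bounded supported_lp1)

lemma convol_sum_right:
  assumes "a \<in> supported B"
  shows "convol G a (\<lambda>y. \<Sum>i\<in>I. k i * f i y) = (\<lambda>y. \<Sum>i\<in>I. k i * convol G a (f i) y)"
proof
  fix x
  show "convol G a (\<lambda>y. \<Sum>i\<in>I. k i * f i y) x = (\<Sum>i\<in>I. k i * convol G a (f i) x)"
  proof (cases "x \<in> carrier G")
    case True
    have "convol G a (\<lambda>y. \<Sum>i\<in>I. k i * f i y) x = (\<Sum>y\<in>B. \<Sum>i\<in>I. k i * (a y * f i (inv y \<otimes> x)))"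
      using convol_eq_sum[OF assms True] by (simp add: sum_distrib_left mult.left_commute)
    also have "\<dots> = (\<Sum>i\<in>I. \<Sum>y\<in>B. k i * (a y * f i (inv y \<otimes> x)))" by (rule sum.swap)
    also have "\<dots> = (\<Sum>i\<in>I. k i * convol G a (f i) x)"
      using convol_eq_sum[OF assms True] by (simp add: sum_distrib_left)
    finally show ?thesis .
  qed (simp add: convol_def)
qed

lemma convol_add_right:
  assumes "a \<in> supported B"
  shows "convol G a (\<lambda>y. b y + c y) = (\<lambda>y. convol G a b y + convol G a c y)"
proof
  show "convol G a (\<lambda>y. b y + c y) x = convol G a b x + convol G a c x" for x
    by (cases "x \<in> carrier G")
      (simp_all add: convol_eq_sum[OF assms] distrib_left sum.distrib, simp add: convol_def)
qed

lemma convol_diff_right: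
  assumes "a \<in> supported B"
  shows "convol G a (\<lambda>y. b y - c y) = (\<lambda>y. convol G a b y - convol G a c y)"
proof
  show "convol G a (\<lambda>y. b y - c y) x = convol G a b x - convol G a c x" for x
    by (cases "x \<in> carrier G")
      (simp_all add: convol_eq_sum[OF assms] right_diff_distrib sum_subtractf, simp add: convol_def)
qed

lemma convol_scale_right:
  assumes "a \<in> supported B"
  shows "convol G a (\<lambda>y. k * b y) = (\<lambda>y. k * convol G a b y)"
proof
  show "convol G a (\<lambda>y. k * b y) x = k * convol G a b x" for x
    by (cases "x \<in> carrier G")
      (simp_all add: convol_eq_sum[OF assms] mult.left_commute sum_distrib_left, simp add: convol_def)
qed

lemma sum_inv: "(\<Sum>y\<in>B. f (inv y)) = (\<Sum>y\<in>B. f y)"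
  by (rule sum.reindex_bij_witness[of _ "\<lambda>y. inv y" "\<lambda>y. inv y"]) (auto simp: B_carrier)

lemma sum_left_mult: "x \<in> B \<Longrightarrow> (\<Sum>y\<in>B. f (x \<otimes> y)) = (\<Sum>y\<in>B. f y)"
  by (rule sum.reindex_bij_witness[of _ "\<lambda>y. inv x \<otimes> y" "\<lambda>y. x \<otimes> y"])
    (auto simp: B_carrier mult_inv_cancel inv_mult_cancel)

lemma adj_supported: "a \<in> supported B \<Longrightarrow> adj G a \<in> supported B"
proof -
  assume a: "a \<in> supported B"
  have "a (inv x) = 0" if "x \<in> carrier G" "x \<notin> B" for x
  proof (rule supportedD[OF a])
    show "inv x \<notin> B" using B_closed(3)[of "inv x"] that by auto
  qed
  then show ?thesis by (simp add: supported_def adj_def)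
qed

lemma adj_adj: "a \<in> supported B \<Longrightarrow> adj G (adj G a) = a"
  using supportedD[of a B] B_carrier by (fastforce simp: adj_def fun_eq_iff)

lemma adj_convol:
  assumes a: "a \<in> supported B" and b: "b \<in> supported B"
  shows "adj G (convol G a b) = convol G (adj G b) (adj G a)"
proof (rule supported_ext)
  show "adj G (convol G a b) \<in> supported B" by (intro adj_supported convol_supported a b)
  show "convol G (adj G b) (adj G a) \<in> supported B" by (intro adj_supported convol_supported a b)
  fix x assume x: "x \<in> B"
  note c = B_carrier
  have "convol G (adj G b) (adj G a) x = (\<Sum>y\<in>B. cnj (b (inv y)) * cnj (a (inv (inv y \<otimes> x))))"
    using x by (simp add: convol_eq_sum adj_supported b c) (simp add: adj_def c)
  also have "\<dots> = (\<Sum>y\<in>B. cnj (b (inv (x \<otimes> y))) * cnj (a (inv (inv (x \<otimes> y) \<otimes> x))))"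
    by (rule sum_left_mult[OF x, symmetric])
  also have "\<dots> = (\<Sum>y\<in>B. cnj (a y) * cnj (b (inv y \<otimes> inv x)))"
  proof (rule sum.cong)
    fix y assume y: "y \<in> B"
    have "inv (inv (x \<otimes> y) \<otimes> x) = y"
      using x y by (simp add: inv_mult_group c mult_inv_cancel inv_mult_cancel m_assoc)
    then show "cnj (b (inv (x \<otimes> y))) * cnj (a (inv (inv (x \<otimes> y) \<otimes> x))) = cnj (a y) * cnj (b (inv y \<otimes> inv x))"
      using x y by (simp add: inv_mult_group c)
  qed simp
  also have "\<dots> = adj G (convol G a b) x"
    using x by (simp add: adj_def convol_eq_sum a c)
  finally show "adj G (convol G a b) x = convol G (adj G b) (adj G a) x" by simp
qed

lemma point_mass_supported: "g \<in> B \<Longrightarrow> point_mass g \<in> supported B"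
  by (auto simp: point_mass_def supported_def)

lemma convol_point_mass_right:
  assumes a: "a \<in> supported B" and g: "g \<in> B" and x: "x \<in> B"
  shows "convol G a (point_mass g) x = a (x \<otimes> inv g)"
proof -
  note c = B_carrier
  have "convol G a (point_mass g) x = (\<Sum>y\<in>B. if y = x \<otimes> inv g then a y else 0)"
    unfolding convol_eq_sum[OF a c[OF x]]
  proof (rule sum.cong)
    fix y assume y: "y \<in> B"
    have "inv y \<otimes> x = g \<longleftrightarrow> y = x \<otimes> inv g"
      using x y g c by (metis inv_solve_left' inv_solve_right)
    then show "a y * point_mass g (inv y \<otimes> x) = (if y = x \<otimes> inv g then a y else 0)"
      by (simp add: point_mass_def)
  qed simp
  then show ?thesis using x g finite_B by simp
qed

lemma projection_supported: "projection G B r \<Longrightarrow> r \<in> supported B"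
  and projection_adj: "projection G B r \<Longrightarrow> adj G r = r"
  and projection_idem: "projection G B r \<Longrightarrow> convol G r r = r"
  by (auto simp: projection_def)

lemma projection_inv:
  assumes "projection G B r" "x \<in> carrier G"
  shows "r (inv x) = cnj (r x)"
  using fun_cong[OF projection_adj[OF assms(1)], of "inv x"] assms(2) by (simp add: adj_def)

text \<open>The coefficient at the neutral element is the canonical trace: \<open>r\<close> is its
  own product with its adjoint, and that product evaluates there to the squared 2-norm.\<close>

lemma projection_at_one:
  assumes r: "projection G B r"
  shows "r \<one> = of_real (\<Sum>y\<in>B. (cmod (r y))\<^sup>2)"
proof -
  have "r \<one> = convol G r r \<one>" using projection_idem[OF r] by simp
  also have "\<dots> = (\<Sum>y\<in>B. r y * r (inv y))"
    using convol_eq_sum[OF projection_supported[OF r]] by (simp add: B_carrier)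
  also have "\<dots> = (\<Sum>y\<in>B. r y * cnj (r y))"
    using projection_inv[OF r] B_carrier by simp
  finally show ?thesis by (simp add: mult_cnj_self)
qed

lemma projection_trace:
  assumes r: "projection G B r"
  shows "(\<Sum>y\<in>B. (cmod (r y))\<^sup>2) = Re (r \<one>)" "r \<one> = of_real (Re (r \<one>))" "0 \<le> Re (r \<one>)"
  using projection_at_one[OF r] by (simp_all add: sum_nonneg)

text \<open>By idempotence a coefficient is a pairing of \<open>r\<close> with a rearrangement of
  \<open>r\<close>, and both have squared 2-norm equal to the trace.\<close>

lemma projection_norm_le:
  assumes r: "projection G B r"
  shows "cmod (r x) \<le> Re (r \<one>)"
proof (cases "x \<in> B")
  case x: True
  have "cmod (r x) = cmod (\<Sum>y\<in>B. r y * r (inv y \<otimes> x))"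
    using convol_eq_sum[OF projection_supported[OF r] B_carrier[OF x], of r] projection_idem[OF r] by simp
  also have "\<dots> \<le> (\<Sum>y\<in>B. ((cmod (r y))\<^sup>2 + (cmod (r (inv y \<otimes> x)))\<^sup>2) / 2)"
  proof (rule sum_norm_le)
    fix y
    show "cmod (r y * r (inv y \<otimes> x)) \<le> ((cmod (r y))\<^sup>2 + (cmod (r (inv y \<otimes> x)))\<^sup>2) / 2"
      using sum_squares_bound[of "cmod (r y)" "cmod (r (inv y \<otimes> x))"] by (simp add: norm_mult)
  qed
  also have "\<dots> = ((\<Sum>y\<in>B. (cmod (r y))\<^sup>2) + (\<Sum>y\<in>B. (cmod (r (inv y \<otimes> x)))\<^sup>2)) / 2"
    by (simp add: sum.distrib flip: sum_divide_distrib)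
  also have "(\<Sum>y\<in>B. (cmod (r (inv y \<otimes> x)))\<^sup>2) = (\<Sum>y\<in>B. (cmod (r y))\<^sup>2)"
  proof -
    have "(\<Sum>y\<in>B. (cmod (r (inv y \<otimes> x)))\<^sup>2) = (\<Sum>y\<in>B. (cmod (r (y \<otimes> x)))\<^sup>2)"
      by (rule sum_inv[of "\<lambda>y. (cmod (r (y \<otimes> x)))\<^sup>2"])
    also have "\<dots> = (\<Sum>y\<in>B. (cmod (r y))\<^sup>2)"
      using x by (intro sum.reindex_bij_witness[of _ "\<lambda>y. y \<otimes> inv x" "\<lambda>y. y \<otimes> x"])
        (auto simp: B_carrier m_assoc)
    finally show ?thesis .
  qed
  finally show ?thesis using projection_trace[OF r] by simp
next
  case False
  then show ?thesis using supportedD[OF projection_supported[OF r]] projection_trace(3)[OF r] by simp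
qed

text \<open>With \<open>t\<close> the trace, the square sum \<open>t\<close> is at most
  \<open>card B * t^2\<close>. A positive lower bound for traces is what makes descents among
  projections terminate.\<close>

lemma projection_trace_lower:
  assumes r: "projection G B r" and ne: "r \<noteq> (\<lambda>_. 0)"
  shows "1 \<le> card B * Re (r \<one>)"
proof -
  let ?t = "Re (r \<one>)"
  have "?t \<noteq> 0" using projection_norm_le[OF r] ne by (auto simp: fun_eq_iff)
  then have t: "?t > 0" using projection_trace(3)[OF r] by simp
  have "?t = (\<Sum>y\<in>B. (cmod (r y))\<^sup>2)" using projection_trace[OF r] by simp
  also have "\<dots> \<le> (\<Sum>y\<in>B. ?t\<^sup>2)"
    by (intro sum_mono power_mono projection_norm_le[OF r]) simp
  finally have "?t * 1 \<le> ?t * (card B * ?t)" by (simp add: power2_eq_square mult_ac)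
  then show ?thesis using t by (simp only: mult_le_cancel_left_pos)
qed

text \<open>Take adjoints in \<open>convol G r u = u\<close>.\<close>

lemma subprojection_right:
  assumes r: "projection G B r" and u: "projection G B u" and ru: "convol G r u = u"
  shows "convol G u r = u"
  using adj_convol[OF projection_supported[OF r] projection_supported[OF u]]
    projection_adj[OF r] projection_adj[OF u] ru by simp

lemma supported_diff: "a \<in> supported B \<Longrightarrow> b \<in> supported B \<Longrightarrow> (\<lambda>x. a x - b x) \<in> supported B"
  by (simp add: supported_def)

lemma supported_add: "a \<in> supported B \<Longrightarrow> b \<in> supported B \<Longrightarrow> (\<lambda>x. a x + b x) \<in> supported B"
  by (simp add: supported_def)

lemma convol_diff_left_supported:
  "a \<in> supported B \<Longrightarrow> b \<in> supported B \<Longrightarrow> c \<in> supported B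
    \<Longrightarrow> convol G (\<lambda>x. a x - b x) c = (\<lambda>x. convol G a c x - convol G b c x)"
  by (intro convol_diff_left supported_bounded supported_lp1)

lemma convol_add_left_supported:
  "a \<in> supported B \<Longrightarrow> b \<in> supported B \<Longrightarrow> c \<in> supported B
    \<Longrightarrow> convol G (\<lambda>x. a x + b x) c = (\<lambda>x. convol G a c x + convol G b c x)"
  by (intro convol_add_left supported_bounded supported_lp1)

lemma projection_diff:
  assumes r: "projection G B r" and u: "projection G B u" and ru: "convol G r u = u"
  shows "projection G B (\<lambda>x. r x - u x)" "convol G r (\<lambda>x. r x - u x) = (\<lambda>x. r x - u x)"
    "convol G u (\<lambda>x. r x - u x) = (\<lambda>_. 0)"
proof -
  note sr = projection_supported[OF r] and su = projection_supported[OF u]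
  note ur = subprojection_right[OF assms]
  note ir = projection_idem[OF r] and iu = projection_idem[OF u]
  show A: "convol G r (\<lambda>x. r x - u x) = (\<lambda>x. r x - u x)"
    by (simp add: convol_diff_right[OF sr] ir ru)
  show Z: "convol G u (\<lambda>x. r x - u x) = (\<lambda>_. 0)"
    by (simp add: convol_diff_right[OF su] iu ur)
  have "convol G (\<lambda>x. r x - u x) (\<lambda>x. r x - u x) = (\<lambda>x. r x - u x)"
    by (subst convol_diff_left_supported[OF sr su supported_diff[OF sr su]]) (simp add: A Z)
  moreover have "adj G (\<lambda>x. r x - u x) = (\<lambda>x. r x - u x)"
    by (simp add: adj_diff projection_adj[OF r] projection_adj[OF u])
  ultimately show "projection G B (\<lambda>x. r x - u x)"
    using supported_diff[OF sr su] by (simp add: projection_def)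
qed

lemma projection_add:
  assumes u: "projection G B u" and v: "projection G B v" and uv: "convol G u v = (\<lambda>_. 0)"
  shows "projection G B (\<lambda>x. u x + v x)"
proof -
  note su = projection_supported[OF u] and sv = projection_supported[OF v]
  have vu: "convol G v u = (\<lambda>_. 0)"
    using adj_convol[OF su sv] uv projection_adj[OF u] projection_adj[OF v]
    by (simp add: adj_zero)
  have "convol G (\<lambda>x. u x + v x) (\<lambda>x. u x + v x) = (\<lambda>x. u x + v x)"
    by (subst convol_add_left_supported[OF su sv supported_add[OF su sv]])
      (simp add: convol_add_right su sv uv vu projection_idem[OF u] projection_idem[OF v])
  moreover have "adj G (\<lambda>x. u x + v x) = (\<lambda>x. u x + v x)"
    by (simp add: adj_add projection_adj[OF u] projection_adj[OF v])
  ultimately show ?thesis using supported_add[OF su sv] by (simp add: projection_def)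
qed

text \<open>Let \<open>u\<close> represent evaluation at the neutral element on \<open>J\<close>. A
  right ideal contains the right translates of its elements, which turns the representing property
  into the statement that \<open>adj G u\<close> is a left unit on \<open>J\<close>.\<close>

lemma right_ideal_projection:
  assumes J: "linear_subspace J" "J \<subseteq> supported B"
    and ideal: "\<And>x a. x \<in> J \<Longrightarrow> a \<in> supported B \<Longrightarrow> convol G x a \<in> J"
  shows "\<exists>u\<in>J. projection G B u \<and> (\<forall>x\<in>J. convol G u x = x)"
proof -
  obtain u where u: "u \<in> J" and rep: "\<And>x. x \<in> J \<Longrightarrow> ip B x u = x \<one>"
    using riesz_representation[OF finite_B J] by blast
  have su: "u \<in> supported B" using u J by blast
  have L: "convol G (adj G u) x = x" if x: "x \<in> J" for x
  proof (rule supported_ext)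
    have sx: "x \<in> supported B" using x J by blast
    show "convol G (adj G u) x \<in> supported B" "x \<in> supported B"
      using sx by (auto intro: convol_supported adj_supported su)
    fix z assume z: "z \<in> B"
    \<comment> \<open>Right translation moves the value \<open>x z\<close> to the neutral element,
      where \<open>u\<close> computes it.\<close>
    let ?w = "convol G x (point_mass (inv z))"
    have w: "?w \<in> J" using z by (intro ideal x point_mass_supported) auto
    have "convol G (adj G u) x z = (\<Sum>y\<in>B. cnj (u (inv y)) * x (inv y \<otimes> z))"
      using z by (simp add: convol_eq_sum adj_supported su B_carrier) (simp add: adj_def B_carrier)
    also have "\<dots> = (\<Sum>y\<in>B. cnj (u y) * x (y \<otimes> z))"
      by (rule sum_inv)
    also have "\<dots> = ip B ?w u"
      using z by (simp add: ip_def convol_point_mass_right[OF sx] B_carrier mult.commute)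
    also have "\<dots> = x z"
      using rep[OF w] z by (simp add: convol_point_mass_right[OF sx] B_carrier)
    finally show "convol G (adj G u) x z = x z" .
  qed
  \<comment> \<open>\<open>adj G u\<close> is a left unit on \<open>u\<close> itself, so
    \<open>u\<close> equals the self-adjoint element \<open>convol G (adj G u) u\<close>.\<close>
  have "adj G (convol G (adj G u) u) = convol G (adj G u) u"
    using adj_convol[OF adj_supported[OF su] su] adj_adj[OF su] by simp
  then have "adj G u = u" using L[OF u] by simp
  then show ?thesis using L u su by (intro bexI[of _ u]) (auto simp: projection_def)
qed

end

section \<open>Minimal projections and subprojections close to a given proportion\<close>

definition minimal_projection :: "('a, 'm) monoid_scheme \<Rightarrow> 'a set \<Rightarrow> ('a \<Rightarrow> complex) \<Rightarrow> bool" where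
  "minimal_projection G B v \<longleftrightarrow> projection G B v \<and> v \<noteq> (\<lambda>_. 0)
     \<and> (\<forall>u. projection G B u \<longrightarrow> convol G v u = u \<longrightarrow> u = (\<lambda>_. 0) \<or> u = v)"

context finite_subgroup
begin

lemma convol_zero_right: "a \<in> supported B \<Longrightarrow> convol G a (\<lambda>_. 0) = (\<lambda>_. 0)"
  using convol_scale_right[of a 0 a] by simp

text \<open>Schur's lemma without representations. The element \<open>y\<close> of the corner acts
  from the left on the right ideal \<open>J\<close> generated by \<open>v\<close>; an eigenspace is
  a nonzero right ideal inside \<open>J\<close>, so by minimality its projection is
  \<open>v\<close>, and \<open>y\<close> acts on \<open>v\<close> as a scalar.\<close>

lemma minimal_projection_corner:
  assumes v: "minimal_projection G B v" and x: "x \<in> supported B"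
  shows "\<exists>\<mu>. convol G (convol G v x) v = (\<lambda>y. \<mu> * v y)"
proof -
  have pv: "projection G B v" and v0: "v \<noteq> (\<lambda>_. 0)"
    and vmin: "\<And>u. projection G B u \<Longrightarrow> convol G v u = u \<Longrightarrow> u = (\<lambda>_. 0) \<or> u = v"
    using v by (auto simp: minimal_projection_def)
  note sv = projection_supported[OF pv]
  define y where "y = convol G (convol G v x) v"
  have sy: "y \<in> supported B" unfolding y_def by (intro convol_supported sv x)
  have vy: "convol G v y = y" and yv: "convol G y v = y"
    by (simp_all add: y_def convol_assoc_supported convol_supported sv x projection_idem[OF pv]
        flip: convol_assoc_supported[of v v])
  define J where "J = {z \<in> supported B. convol G v z = z}"
  have J: "linear_subspace J" "J \<subseteq> supported B"
    using linear_subspace_supported[of B]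
    by (auto simp: J_def linear_subspace_def convol_add_right[OF sv] convol_scale_right[OF sv]
        convol_zero_right[OF sv])
  have "v \<in> J" by (simp add: J_def sv projection_idem[OF pv])
  have "\<exists>\<mu>. \<exists>z\<in>J. z \<noteq> (\<lambda>_. 0) \<and> convol G y z = (\<lambda>t. \<mu> * z t)"
  proof (rule eigenvector_exists[OF finite_B J])
    show "J \<noteq> {\<lambda>_. 0}" using \<open>v \<in> J\<close> v0 by blast
    show "convol G y z \<in> J" if "z \<in> J" for z
      using that by (simp add: J_def convol_supported sy vy sv flip: convol_assoc_supported)
    show "convol G y (\<lambda>t. \<Sum>i\<in>I. k i * f i t) = (\<lambda>t. \<Sum>i\<in>I. k i * convol G y (f i) t)"
      for I :: "nat set" and k f by (rule convol_sum_right[OF sy])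
  qed
  then obtain \<mu> z where z: "z \<in> J" "z \<noteq> (\<lambda>_. 0)" "convol G y z = (\<lambda>t. \<mu> * z t)" by blast
  \<comment> \<open>Multiplications from the left and from the right commute, so an eigenspace of
    the former is stable under the latter.\<close>
  define J' where "J' = {z \<in> J. convol G y z = (\<lambda>t. \<mu> * z t)}"
  have J'lin: "linear_subspace J'"
    using J(1) convol_zero_right[OF sy]
    by (auto simp: J'_def linear_subspace_def convol_add_right[OF sy] convol_scale_right[OF sy]
        distrib_left mult.left_commute)
  have J'sub: "J' \<subseteq> supported B" using J(2) by (auto simp: J'_def)
  have ideal: "convol G w a \<in> J'" if "w \<in> J'" "a \<in> supported B" for w a
  proof -
    have w: "w \<in> supported B" "convol G v w = w" "convol G y w = (\<lambda>t. \<mu> * w t)"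
      using that by (auto simp: J'_def J_def)
    have "convol G v (convol G w a) = convol G w a" "convol G y (convol G w a) = (\<lambda>t. \<mu> * convol G w a t)"
      using w that(2) by (simp_all add: sv sy convol_scale_left flip: convol_assoc_supported)
    then show ?thesis using w that(2) by (simp add: J'_def J_def convol_supported)
  qed
  obtain u where u: "u \<in> J'" "projection G B u" "\<forall>x\<in>J'. convol G u x = x"
    using right_ideal_projection[OF J'lin J'sub ideal] by blast
  have "z \<in> J'" using z by (simp add: J'_def)
  then have "convol G u z = z" using u by blast
  have "u \<noteq> (\<lambda>_. 0)"
  proof
    assume "u = (\<lambda>_. 0)"
    then have "convol G u z = (\<lambda>_. 0)" by (simp add: convol_def fun_eq_iff)
    then have "z = (\<lambda>_. 0)" using \<open>convol G u z = z\<close> by simp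
    then show False using z by simp
  qed
  then have "u = v" using vmin[OF u(2)] u(1) by (auto simp: J'_def J_def)
  then have "convol G y v = (\<lambda>t. \<mu> * v t)" using u(1) by (simp add: J'_def)
  then show ?thesis unfolding yv by (auto simp: y_def)
qed

text \<open>This is \<open>d\<^sup>2 \<le> |B|\<close> for an irreducible representation of dimension \<open>d\<close>, whose minimal projections
  have trace \<open>d / |B|\<close>.\<close>
lemma minimal_projection_trace:
  assumes v: "minimal_projection G B v"
  shows "card B * (Re (v \<one>))\<^sup>2 \<le> 1"
proof -
  have pv: "projection G B v" and v0: "v \<noteq> (\<lambda>_. 0)" using v by (auto simp: minimal_projection_def)
  note sv = projection_supported[OF pv] and c = B_carrier
  define t where "t = Re (v \<one>)"
  have t: "v \<one> = of_real t" using projection_trace(2)[OF pv] by (simp add: t_def)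
  have "t > 0" using projection_trace_lower[OF pv v0] projection_trace(3)[OF pv]
    by (cases "t = 0") (auto simp: t_def)
  \<comment> \<open>The corner of \<open>v\<close> applied to the point mass at \<open>g\<close>;
    evaluation at the neutral element identifies the scalar as \<open>v (inv g) / t\<close>. This is
    the functional equation of a spherical function.\<close>
  have spherical: "of_real t * (\<Sum>y\<in>B. v y * v (inv g \<otimes> (inv y \<otimes> x))) = v (inv g) * v x"
    if g: "g \<in> B" and x: "x \<in> B" for g x
  proof -
    have pg: "convol G (point_mass g) v z = v (inv g \<otimes> z)" if "z \<in> B" for z
    proof -
      have "v z' = (if z' \<in> carrier G then v z' else 0)" for z'
        using supportedD[OF sv, of z'] c by auto
      then show ?thesis
        using that convol_point_mass_left[OF c[OF g], of v] c g by (simp add: left_translate_def)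
    qed
    obtain \<mu> where "convol G (convol G v (point_mass g)) v = (\<lambda>y. \<mu> * v y)"
      using minimal_projection_corner[OF v point_mass_supported[OF g]] by blast
    then have "convol G v (convol G (point_mass g) v) = (\<lambda>y. \<mu> * v y)"
      by (simp add: convol_assoc_supported sv point_mass_supported g)
    moreover have "convol G v (convol G (point_mass g) v) z = (\<Sum>y\<in>B. v y * v (inv g \<otimes> (inv y \<otimes> z)))"
      if "z \<in> B" for z
      using that by (simp add: convol_eq_sum sv c pg)
    ultimately have E: "(\<Sum>y\<in>B. v y * v (inv g \<otimes> (inv y \<otimes> z))) = \<mu> * v z" if "z \<in> B" for z
      using that by simp
    have "\<mu> * of_real t = (\<Sum>y\<in>B. v y * v (inv g \<otimes> inv y))"
      using E[of \<one>] by (simp add: t c)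
    also have "\<dots> = (\<Sum>w\<in>B. v w * v (inv w \<otimes> inv g))"
      by (rule sum.reindex_bij_witness[of _ "\<lambda>w. inv w \<otimes> inv g" "\<lambda>y. inv g \<otimes> inv y"])
        (auto simp: c g inv_mult_group m_assoc inv_mult_cancel mult_inv_cancel mult.commute)
    also have "\<dots> = convol G v v (inv g)"
      using g by (simp add: convol_eq_sum sv c)
    finally have "\<mu> * of_real t = v (inv g)" by (simp add: projection_idem[OF pv])
    then show ?thesis using E[OF x] by (simp add: mult_ac)
  qed
  \<comment> \<open>The functional equation with \<open>x\<close> and \<open>g\<close> both equal to
    \<open>k\<close>, summed over \<open>k\<close>, gives \<open>t * T = t\<close>.\<close>
  define T where "T = (\<Sum>x\<in>B. \<Sum>k\<in>B. v x * v (inv k \<otimes> (inv x \<otimes> k)))"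
  have "of_real t * T = (\<Sum>k\<in>B. of_real t * (\<Sum>x\<in>B. v x * v (inv k \<otimes> (inv x \<otimes> k))))"
    unfolding T_def by (subst sum.swap) (simp add: sum_distrib_left)
  also have "\<dots> = (\<Sum>k\<in>B. v (inv k) * v k)" using spherical by simp
  also have "\<dots> = (\<Sum>k\<in>B. v k * cnj (v k))"
    using projection_inv[OF pv] c by (simp add: mult.commute)
  also have "\<dots> = of_real t"
    using projection_trace(1)[OF pv] by (simp add: mult_cnj_self t_def flip: of_real_sum of_real_power)
  finally have T: "T = 1" using \<open>t > 0\<close> by simp
  \<comment> \<open>Up to conjugation this is the irreducible character attached to
    \<open>v\<close>: its squared norm is computed to be \<open>card B\<close>, and its value at the
    neutral element, the degree, is \<open>card B * t\<close>.\<close>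
  define s where "s x = (\<Sum>g\<in>B. v (inv g \<otimes> (x \<otimes> g)))" for x
  have "(\<Sum>x\<in>B. s x * cnj (s x)) = (\<Sum>x\<in>B. \<Sum>g\<in>B. \<Sum>h\<in>B. v (inv g \<otimes> (x \<otimes> g)) * v (inv h \<otimes> (inv x \<otimes> h)))"
  proof (rule sum.cong)
    fix x assume x: "x \<in> B"
    have "cnj (v (inv h \<otimes> (x \<otimes> h))) = v (inv h \<otimes> (inv x \<otimes> h))" if "h \<in> B" for h
      using projection_inv[OF pv, of "inv h \<otimes> (x \<otimes> h)"] x that
      by (simp add: c inv_mult_group m_assoc)
    then have "cnj (s x) = (\<Sum>h\<in>B. v (inv h \<otimes> (inv x \<otimes> h)))"
      by (simp add: s_def)
    then show "s x * cnj (s x) = (\<Sum>g\<in>B. \<Sum>h\<in>B. v (inv g \<otimes> (x \<otimes> g)) * v (inv h \<otimes> (inv x \<otimes> h)))"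
      by (simp add: s_def sum_product)
  qed simp
  also have "\<dots> = (\<Sum>g\<in>B. \<Sum>x\<in>B. \<Sum>h\<in>B. v (inv g \<otimes> (x \<otimes> g)) * v (inv h \<otimes> (inv x \<otimes> h)))"
    by (rule sum.swap)
  also have "\<dots> = (\<Sum>g\<in>B. T)"
  proof (rule sum.cong)
    fix g assume g: "g \<in> B"
    have "(\<Sum>x\<in>B. \<Sum>h\<in>B. v (inv g \<otimes> (x \<otimes> g)) * v (inv h \<otimes> (inv x \<otimes> h)))
        = (\<Sum>x\<in>B. \<Sum>h\<in>B. v x * v (inv h \<otimes> (g \<otimes> (inv x \<otimes> (inv g \<otimes> h)))))"
      by (rule sum.reindex_bij_witness[of _ "\<lambda>x. g \<otimes> (x \<otimes> inv g)" "\<lambda>x. inv g \<otimes> (x \<otimes> g)"])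
        (auto simp: c g inv_mult_group m_assoc inv_mult_cancel mult_inv_cancel)
    also have "\<dots> = (\<Sum>x\<in>B. \<Sum>k\<in>B. v x * v (inv k \<otimes> (inv x \<otimes> k)))"
    proof (rule sum.cong)
      fix x assume x: "x \<in> B"
      show "(\<Sum>h\<in>B. v x * v (inv h \<otimes> (g \<otimes> (inv x \<otimes> (inv g \<otimes> h))))) = (\<Sum>k\<in>B. v x * v (inv k \<otimes> (inv x \<otimes> k)))"
        by (rule sum.reindex_bij_witness[of _ "\<lambda>k. g \<otimes> k" "\<lambda>h. inv g \<otimes> h"])
          (auto simp: c g x inv_mult_group m_assoc inv_mult_cancel mult_inv_cancel)
    qed simp
    finally show "(\<Sum>x\<in>B. \<Sum>h\<in>B. v (inv g \<otimes> (x \<otimes> g)) * v (inv h \<otimes> (inv x \<otimes> h))) = T"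
      by (simp add: T_def)
  qed simp
  also have "\<dots> = of_real (card B)" by (simp add: T)
  finally have "of_real (\<Sum>x\<in>B. (cmod (s x))\<^sup>2) = (of_real (card B) :: complex)"
    by (simp add: mult_cnj_self)
  then have S: "(\<Sum>x\<in>B. (cmod (s x))\<^sup>2) = card B" unfolding of_real_eq_iff .
  have "s \<one> = of_real (card B * t)" by (simp add: s_def c t)
  then have "(cmod (s \<one>))\<^sup>2 = (card B * t)\<^sup>2"
    using \<open>t > 0\<close> by (simp only: norm_of_real power2_abs)
  moreover have "(cmod (s \<one>))\<^sup>2 \<le> (\<Sum>x\<in>B. (cmod (s x))\<^sup>2)"
    using finite_B by (intro member_le_sum) auto
  ultimately have "real (card B) * (card B * t\<^sup>2) \<le> real (card B) * 1"
    using S by (simp add: power2_eq_square mult_ac)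
  moreover have "real (card B) > 0" using finite_B B_closed(1) by (auto simp: card_gt_0_iff)
  ultimately show ?thesis by (simp only: mult_le_cancel_left_pos t_def)
qed

text \<open>\<open>card B\<close> times the trace is the dimension of the right ideal of
  \<open>r\<close>; the floor gives a natural number without a proof that it is one.\<close>

definition level :: "('a \<Rightarrow> complex) \<Rightarrow> nat" where
  "level r = nat \<lfloor>card B * Re (r \<one>)\<rfloor>"

lemma level_diff_less:
  assumes r: "projection G B r" and u: "projection G B u" and "convol G r u = u" and "u \<noteq> (\<lambda>_. 0)"
  shows "level (\<lambda>x. r x - u x) < level r"
proof -
  have "1 \<le> card B * Re (u \<one>)" by (rule projection_trace_lower[OF u assms(4)])
  moreover have "0 \<le> card B * (Re (r \<one>) - Re (u \<one>))"
    using projection_trace(3)[OF projection_diff(1)[OF r u assms(3)]] by simp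
  ultimately show ?thesis unfolding level_def by (simp add: right_diff_distrib) linarith
qed

text \<open>Choose a nonzero projection below \<open>r\<close> of least level; subtracting a proper
  nonzero subprojection would lower the level.\<close>

lemma minimal_subprojection:
  assumes r: "projection G B r" and r0: "r \<noteq> (\<lambda>_. 0)"
  shows "\<exists>v. minimal_projection G B v \<and> convol G r v = v"
proof -
  let ?P = "\<lambda>v. projection G B v \<and> v \<noteq> (\<lambda>_. 0) \<and> convol G r v = v"
  have "?P r" using r r0 projection_idem[OF r] by blast
  then obtain v where v: "?P v" and least: "\<And>u. ?P u \<Longrightarrow> level v \<le> level u"
    using ex_has_least_nat[of ?P r level] by metis
  have "u = (\<lambda>_. 0) \<or> u = v" if u: "projection G B u" "convol G v u = u" for u
  proof (rule ccontr)
    assume ne: "\<not> (u = (\<lambda>_. 0) \<or> u = v)"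
    let ?w = "\<lambda>x. v x - u x"
    have w: "projection G B ?w" "convol G v ?w = ?w" using projection_diff[OF _ u] v by auto
    have "convol G (convol G r v) ?w = convol G r (convol G v ?w)"
      using v w by (intro convol_assoc_supported projection_supported r) auto
    then have "convol G r ?w = ?w" using v w by simp
    moreover have "?w \<noteq> (\<lambda>_. 0)"
    proof
      assume "?w = (\<lambda>_. 0)"
      then have "u x = v x" for x by (drule_tac x = x in fun_cong) simp
      then show False using ne by auto
    qed
    ultimately have "level v \<le> level ?w" using w by (intro least) auto
    moreover have "level ?w < level v" using level_diff_less[OF _ u] v ne by blast
    ultimately show False by simp
  qed
  then show ?thesis using v by (auto simp: minimal_projection_def)
qed

text \<open>Peel minimal projections off \<open>r\<close> one at a time and put each into \<open>u\<close> or not, choosing so that the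
  new error makes an obtuse angle with the old one; minimal projections are so small that the errors
  never add up to much.\<close>
lemma balanced_subprojection:
  fixes \<kappa> \<epsilon> :: real and r :: "'a \<Rightarrow> complex"
  assumes r: "projection G B r" and \<kappa>: "0 \<le> \<kappa>" "\<kappa> \<le> 1" and A: "finite A"
    and \<epsilon>: "1 \<le> real (card B) * \<epsilon>\<^sup>2" "0 \<le> \<epsilon>"
  shows "\<exists>u. projection G B u \<and> convol G r u = u
    \<and> (\<Sum>a\<in>A. (cmod (u a - of_real \<kappa> * r a))\<^sup>2) \<le> real (card A) * \<epsilon> * Re (r \<one>)"
  using r
proof (induction "level r" arbitrary: r rule: less_induct)
  case less
  note r = less.prems
  show ?case
  proof (cases "r = (\<lambda>_. 0)")
    case True
    then show ?thesis
      using r by (intro exI[of _ r]) (simp add: projection_idem)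
  next
    case False
    obtain v where v: "minimal_projection G B v" and rv: "convol G r v = v"
      using minimal_subprojection[OF r False] by blast
    have pv: "projection G B v" and v0: "v \<noteq> (\<lambda>_. 0)" using v by (auto simp: minimal_projection_def)
    define r' where "r' = (\<lambda>x. r x - v x)"
    have r': "projection G B r'" "convol G r r' = r'" "convol G v r' = (\<lambda>_. 0)"
      using projection_diff[OF r pv rv] by (auto simp: r'_def)
    have "level r' < level r" unfolding r'_def by (rule level_diff_less[OF r pv rv v0])
    then obtain u where u: "projection G B u" "convol G r' u = u"
      and ub: "(\<Sum>a\<in>A. (cmod (u a - of_real \<kappa> * r' a))\<^sup>2) \<le> real (card A) * \<epsilon> * Re (r' \<one>)"
      using less.hyps[OF _ r'(1)] by blast
    note s = projection_supported[OF r] projection_supported[OF pv] projection_supported[OF r'(1)]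
      projection_supported[OF u(1)]
    have ru: "convol G r u = u"
      using convol_assoc_supported[OF s(1) s(3) s(4)] r' u by simp
    have vu: "convol G v u = (\<lambda>_. 0)"
    proof -
      have "convol G v u = convol G (convol G v r') u"
        using convol_assoc_supported[OF s(2) s(3) s(4)] u by simp
      also have "\<dots> = (\<lambda>_. 0)" unfolding r'(3) by (simp add: convol_def fun_eq_iff)
      finally show ?thesis .
    qed
    define w where "w a = u a - of_real \<kappa> * r' a" for a
    define W2 where "W2 = (\<Sum>a\<in>A. (cmod (w a))\<^sup>2)"
    define V2 where "V2 = (\<Sum>a\<in>A. (cmod (v a))\<^sup>2)"
    define C where "C = (\<Sum>a\<in>A. Re (w a * cnj (v a)))"
    \<comment> \<open>Here the size of the group enters, through
      \<open>minimal_projection_trace\<close>.\<close>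
    have "Re (v \<one>) \<le> \<epsilon>"
    proof -
      have cB: "real (card B) > 0" using finite_B B_closed(1) by (auto simp: card_gt_0_iff)
      have "real (card B) * (Re (v \<one>))\<^sup>2 \<le> real (card B) * \<epsilon>\<^sup>2" using minimal_projection_trace[OF v] \<epsilon>(1) by linarith
      then have "(Re (v \<one>))\<^sup>2 \<le> \<epsilon>\<^sup>2" using cB by (simp only: mult_le_cancel_left_pos)
      then show ?thesis using \<epsilon> by (simp add: power2_le_iff_abs_le abs_le_iff)
    qed
    then have v2: "(cmod (v a))\<^sup>2 \<le> \<epsilon> * Re (v \<one>)" for a
      using projection_norm_le[OF pv, of a] projection_trace(3)[OF pv]
      by (simp add: power2_eq_square) (meson mult_mono norm_ge_zero order_trans)
    have Yb: "V2 \<le> real (card A) * \<epsilon> * Re (v \<one>)"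
      using sum_bounded_above[of A "\<lambda>a. (cmod (v a))\<^sup>2" "\<epsilon> * Re (v \<one>)"] v2
      by (simp add: V2_def mult.assoc)
    have V20: "V2 \<ge> 0" by (simp add: V2_def sum_nonneg)
    \<comment> \<open>Traces add, so the bound for \<open>r'\<close> and the cost of
      \<open>v\<close> together make up the bound for \<open>r\<close>.\<close>
    have tot: "W2 + V2 \<le> real (card A) * \<epsilon> * Re (r \<one>)"
      using ub Yb by (simp add: W2_def w_def r'_def algebra_simps)
    \<comment> \<open>Leaving \<open>v\<close> out of \<open>u\<close> is the case
      \<open>c = - \<kappa>\<close>, putting it in is \<open>c = 1 - \<kappa>\<close>. These have
      opposite signs, so one of them makes the cross term nonpositive.\<close>
    have expand: "(\<Sum>a\<in>A. (cmod (w a + of_real c * v a))\<^sup>2) = W2 + 2 * c * C + c\<^sup>2 * V2" for c :: real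
    proof -
      have "(cmod (w a + of_real c * v a))\<^sup>2 = (cmod (w a))\<^sup>2 + 2 * c * Re (w a * cnj (v a)) + c\<^sup>2 * (cmod (v a))\<^sup>2" for a
        unfolding cmod_power2 by (simp add: power2_eq_square algebra_simps)
      then show ?thesis by (simp only: W2_def V2_def C_def sum.distrib sum_distrib_left)
    qed
    have small: "W2 + 2 * c * C + c\<^sup>2 * V2 \<le> W2 + V2" if "c * C \<le> 0" "\<bar>c\<bar> \<le> 1" for c :: real
    proof -
      have "c\<^sup>2 \<le> 1" using that by (simp add: abs_square_le_1)
      then have "c\<^sup>2 * V2 \<le> 1 * V2" using V20 by (intro mult_right_mono)
      then show ?thesis using that by simp
    qed
    show ?thesis
    proof (cases "C \<ge> 0")
      case True
      have "u a - of_real \<kappa> * r a = w a + complex_of_real (- \<kappa>) * v a" for a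
        by (simp add: w_def r'_def algebra_simps)
      then have "(\<Sum>a\<in>A. (cmod (u a - of_real \<kappa> * r a))\<^sup>2) \<le> real (card A) * \<epsilon> * Re (r \<one>)"
        using expand[of "- \<kappa>"] small[of "- \<kappa>"] \<kappa> True tot by simp
      then show ?thesis using u ru by blast
    next
      case False
      let ?u = "\<lambda>x. u x + v x"
      have uv: "convol G u v = (\<lambda>_. 0)"
        using adj_convol[OF s(2) s(4)] vu projection_adj[OF pv] projection_adj[OF u(1)]
        by (simp add: adj_zero)
      have "projection G B ?u" by (rule projection_add[OF u(1) pv uv])
      moreover have "convol G r ?u = ?u" by (simp add: convol_add_right s ru rv)
      moreover have "?u a - of_real \<kappa> * r a = w a + complex_of_real (1 - \<kappa>) * v a" for a
        by (simp add: w_def r'_def algebra_simps)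
      then have "(\<Sum>a\<in>A. (cmod (?u a - of_real \<kappa> * r a))\<^sup>2) \<le> real (card A) * \<epsilon> * Re (r \<one>)"
        using expand[of "1 - \<kappa>"] small[of "1 - \<kappa>"] \<kappa> False tot
        by (simp add: mult_nonneg_nonpos)
      ultimately show ?thesis by blast
    qed
  qed
qed

end

section \<open>The case of arbitrarily large finite subgroups\<close>

section \<open>Increasing unions of finite subgroups\<close>

context finite_subgroup
begin

lemma projection_trace_le_1:
  assumes r: "projection G B r"
  shows "Re (r \<one>) \<le> 1"
proof -
  let ?t = "Re (r \<one>)"
  have "?t\<^sup>2 = (cmod (r \<one>))\<^sup>2" by (subst projection_trace(2)[OF r]) simp
  also have "\<dots> \<le> (\<Sum>y\<in>B. (cmod (r y))\<^sup>2)" using finite_B by (intro member_le_sum) auto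
  finally have "?t * ?t \<le> ?t * 1" using projection_trace(1)[OF r] by (simp add: power2_eq_square)
  then show ?thesis
    using projection_trace(3)[OF r] by (cases "?t = 0") (auto simp: mult_le_cancel_left)
qed

text \<open>Interpolation between the sup bound and the 2-norm: with \<open>t\<close> the trace,
  \<open>|u y|^p <= t^(p-2) * |u y|^2\<close>, and the squares sum to \<open>t\<close>.\<close>

lemma projection_powr_sum_le:
  assumes u: "projection G B u" and p: "2 < p" and S: "S \<subseteq> B"
  shows "(\<Sum>y\<in>S. cmod (u y) powr p) \<le> Re (u \<one>) powr (p - 1)"
proof -
  let ?t = "Re (u \<one>)"
  have "(\<Sum>y\<in>S. cmod (u y) powr p) \<le> (\<Sum>y\<in>B. cmod (u y) powr p)"
    using finite_B S by (intro sum_mono2) auto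
  also have "\<dots> \<le> (\<Sum>y\<in>B. ?t powr (p - 2) * (cmod (u y))\<^sup>2)"
  proof (rule sum_mono)
    fix y
    show "cmod (u y) powr p \<le> ?t powr (p - 2) * (cmod (u y))\<^sup>2"
    proof (cases "u y = 0")
      case False
      then have "cmod (u y) powr p = cmod (u y) powr (p - 2) * (cmod (u y))\<^sup>2"
        by (simp add: powr_diff flip: powr_numeral)
      also have "\<dots> \<le> ?t powr (p - 2) * (cmod (u y))\<^sup>2"
        using p projection_norm_le[OF u, of y] by (intro mult_right_mono powr_mono2) auto
      finally show ?thesis .
    qed simp
  qed
  also have "\<dots> = ?t powr (p - 2) * ?t" by (simp add: projection_trace(1)[OF u] flip: sum_distrib_left)
  also have "\<dots> = ?t powr (p - 1)"
    using projection_trace(3)[OF u] by (cases "?t = 0") (simp_all add: powr_diff power2_eq_square)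
  finally show ?thesis .
qed

lemma lp_norm_supported:
  assumes "a \<in> supported B"
  shows "lp_norm p (carrier G) a = (\<Sum>y\<in>B. cmod (a y) powr p) powr (1 / p)"
proof -
  have "(\<Sum>\<^sub>\<infinity>y\<in>carrier G. cmod (a y) powr p) = (\<Sum>\<^sub>\<infinity>y\<in>B. cmod (a y) powr p)"
    using assms B_carrier by (intro infsum_cong_neutral) (auto simp: supported_def)
  then show ?thesis using finite_B by (simp add: lp_norm_def)
qed

lemma point_mass_projection: "projection G B (point_mass \<one>)"
proof -
  have "convol G (point_mass \<one>) (point_mass \<one>) = (point_mass \<one> :: 'a \<Rightarrow> complex)"
    by (subst convol_point_mass_left) (auto simp: left_translate_def point_mass_def fun_eq_iff)
  moreover have "adj G (point_mass \<one>) = (point_mass \<one> :: 'a \<Rightarrow> complex)"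
    by (auto simp: adj_def point_mass_def fun_eq_iff)
  ultimately show ?thesis by (simp add: projection_def point_mass_supported)
qed

end

lemma projection_mono: "projection G B r \<Longrightarrow> B \<subseteq> B' \<Longrightarrow> projection G B' r"
  using supported_mono unfolding projection_def by blast

text \<open>The target for the trace of the \<open>i\<close>-th projection: it tends to 0 for
  \<open>q > 0\<close>, but only polynomially, so that one step removes a proportion of order
  \<open>1/i\<close>.\<close>

definition trace_rate :: "real \<Rightarrow> nat \<Rightarrow> real" where
  "trace_rate q i = (real i + 1) powr (- q)"

lemma trace_rate:
  assumes "0 < q" "q \<le> 1"
  shows "trace_rate q i > 0" "trace_rate q 0 = 1"
    "trace_rate q (Suc i) < trace_rate q i"
    "1 - trace_rate q (Suc i) / trace_rate q i \<le> 1 / (real i + 1)"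
    "trace_rate q i \<le> 2 * trace_rate q (Suc i)"
proof -
  show pos: "trace_rate q i > 0" for i by (simp add: trace_rate_def)
  show "trace_rate q 0 = 1" by (simp add: trace_rate_def)
  show lt: "trace_rate q (Suc i) < trace_rate q i"
    using assms by (auto simp: trace_rate_def intro: powr_less_mono2_neg)
  have "trace_rate q (Suc i) / trace_rate q i = ((real i + 1) / (real i + 2)) powr q"
    by (simp add: trace_rate_def powr_minus_divide powr_divide add_ac)
  \<comment> \<open>A number in the unit interval does not decrease when its exponent drops from 1
    to \<open>q\<close>.\<close>
  also have "\<dots> \<ge> ((real i + 1) / (real i + 2)) powr 1"
    using assms by (intro powr_mono') auto
  finally have R: "trace_rate q (Suc i) / trace_rate q i \<ge> (real i + 1) / (real i + 2)" by simp
  have "1 - (real i + 1) / (real i + 2) \<le> 1 / (real i + 1)" by (simp add: field_simps)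
  then show "1 - trace_rate q (Suc i) / trace_rate q i \<le> 1 / (real i + 1)" using R by linarith
  have "(real i + 1) / (real i + 2) \<ge> 1/2" by (simp add: field_simps)
  then have "1/2 \<le> trace_rate q (Suc i) / trace_rate q i" using R by linarith
  then show "trace_rate q i \<le> 2 * trace_rate q (Suc i)" using pos[of i] by (simp add: field_simps)
qed

context group
begin

text \<open>Subtract from \<open>r\<close> a balanced subprojection \<open>u\<close> of proportion
  \<open>\<kappa> = 1 - t'/t\<close>. On \<open>B m\<close> the difference is close to
  \<open>(t'/t) * r\<close>, so the normalised coefficients hardly move; off \<open>B m\<close> it
  is \<open>- u\<close>, whose p-power sum is of order \<open>(\<kappa> * t)^(p-1)\<close>, and
  division by \<open>t'^p\<close> produces the last term of the bound.\<close>

lemma projection_step: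
  fixes p q :: real and B :: "nat \<Rightarrow> 'a set" and r :: "'a \<Rightarrow> complex"
  assumes B: "\<And>n. subgroup (B n) G" "\<And>n. finite (B n)" "mono B" "\<And>N. \<exists>n. N \<le> card (B n)"
    and p: "2 < p" and q: "0 < q" "q \<le> 1"
    and r: "projection G (B m) r" and r1: "Re (r \<one>) \<le> 2 * trace_rate q i"
  defines "t \<equiv> trace_rate q i" and "t' \<equiv> trace_rate q (Suc i)"
  shows "\<exists>m' r'. m \<le> m' \<and> projection G (B m') r' \<and> convol G r r' = r'
    \<and> (\<forall>a\<in>B m. cmod (r' a / t' - r a / t) \<le> (1/2) ^ (i + 2))
    \<and> (\<Sum>a\<in>B m'. cmod (r' a / t') powr p) \<le> (\<Sum>a\<in>B m. cmod (r a / t) powr p) + (1/2) ^ i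
        + 3 powr (p - 1) * 2 powr p * (real i + 1) powr (q - (p - 1))"
proof -
  interpret A: finite_subgroup G "B m" by (intro finite_subgroup.intro finite_subgroup_axioms.intro group_axioms B)
  have t: "t > 0" "t' > 0" "t' < t" "t \<le> 2 * t'"
    using trace_rate[OF q] by (simp_all add: t_def t'_def)
  define \<kappa> where "\<kappa> = 1 - t' / t"
  have \<kappa>: "0 < \<kappa>" "\<kappa> \<le> 1" "\<kappa> \<le> 1 / (real i + 1)"
    using t trace_rate(4)[OF q, of i] by (auto simp: \<kappa>_def t_def t'_def)
  have tk: "t' = t * (1 - \<kappa>)" using t by (simp add: \<kappa>_def)
  \<comment> \<open>Continuity of a finite sum turns the permitted increase \<open>(1/2)^i\<close>
    into a tolerance for each coefficient.\<close>
  have "((\<lambda>d. \<Sum>a\<in>B m. (cmod (r a / t) + d) powr p) \<longlongrightarrow> (\<Sum>a\<in>B m. (cmod (r a / t) + 0) powr p)) (at_right 0)"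
    using p by (intro tendsto_intros tendsto_powr') (auto simp: eventually_at_filter)
  then have "\<forall>\<^sub>F d in at_right 0. (\<Sum>a\<in>B m. (cmod (r a / t) + d) powr p) < (\<Sum>a\<in>B m. cmod (r a / t) powr p) + (1/2) ^ i"
    by (intro order_tendstoD) auto
  then obtain b where b: "b > 0" and bd: "\<And>d. 0 < d \<Longrightarrow> d < b \<Longrightarrow>
      (\<Sum>a\<in>B m. (cmod (r a / t) + d) powr p) < (\<Sum>a\<in>B m. cmod (r a / t) powr p) + (1/2) ^ i"
    by (auto simp: eventually_at_right_field)
  \<comment> \<open>The three bounds serve, in this order, the p-power sum on \<open>B m\<close>,
    the coefficientwise estimate and the trace of \<open>u\<close>.\<close>
  define d where "d = min (b / 2) (min ((1/2) ^ (i + 2)) (\<kappa> * t / t'))"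
  have d: "0 < d" "d < b" "d \<le> (1/2) ^ (i + 2)" "d * t' \<le> \<kappa> * t"
  proof -
    have "0 < \<kappa> * t / t'" using t \<kappa> by simp
    then show "0 < d" "d < b" using b by (simp_all add: d_def)
    have "d \<le> min ((1/2) ^ (i + 2)) (\<kappa> * t / t')" by (simp only: d_def min.cobounded2)
    then show "d \<le> (1/2) ^ (i + 2)" by (rule order_trans) (rule min.cobounded1)
    have "d \<le> \<kappa> * t / t'" by (simp add: d_def)
    then show "d * t' \<le> \<kappa> * t" using t by (simp add: pos_le_divide_eq)
  qed
  define \<delta> where "\<delta> = d * t'"
  have \<delta>: "\<delta> > 0" using d t by (simp add: \<delta>_def)
  have cA: "real (card (B m)) > 0"
    using A.finite_B A.B_closed(1) by (auto simp: card_gt_0_iff)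
  \<comment> \<open>Then \<open>card (B m) * \<epsilon> = \<delta>^2\<close>, which turns the bound
    for the sum of squares into the bound \<open>\<delta>\<close> for each coefficient.\<close>
  define \<epsilon> where "\<epsilon> = \<delta>\<^sup>2 / card (B m)"
  have \<epsilon>: "\<epsilon> > 0" using \<delta> cA by (simp add: \<epsilon>_def)
  \<comment> \<open>So large that minimal projections of this subgroup and of larger finite ones
    have trace at most \<open>\<epsilon>\<close>.\<close>
  obtain n where n: "nat \<lceil>1 / \<epsilon>\<^sup>2\<rceil> \<le> card (B n)" using B(4) by blast
  define m' where "m' = max m n"
  have mm: "m \<le> m'" "B m \<subseteq> B m'" "B n \<subseteq> B m'"
    using B(3) by (auto simp: m'_def mono_def)
  interpret C: finite_subgroup G "B m'" by (intro finite_subgroup.intro finite_subgroup_axioms.intro group_axioms B)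
  have "1 / \<epsilon>\<^sup>2 \<le> card (B m')"
    using n card_mono[OF C.finite_B mm(3)] by linarith
  then have card': "1 \<le> real (card (B m')) * \<epsilon>\<^sup>2" using \<epsilon> by (simp add: field_simps)
  note r' = projection_mono[OF r mm(2)]
  obtain u where u: "projection G (B m') u" "convol G r u = u"
    and ub: "(\<Sum>a\<in>B m. (cmod (u a - of_real \<kappa> * r a))\<^sup>2) \<le> real (card (B m)) * \<epsilon> * Re (r \<one>)"
    using C.balanced_subprojection[OF r' less_imp_le[OF \<kappa>(1)] \<kappa>(2) A.finite_B card' less_imp_le[OF \<epsilon>]]
    by blast
  have u\<delta>: "cmod (u a - of_real \<kappa> * r a) \<le> \<delta>" if "a \<in> B m" for a
  proof -
    have "(cmod (u a - of_real \<kappa> * r a))\<^sup>2 \<le> (\<Sum>a\<in>B m. (cmod (u a - of_real \<kappa> * r a))\<^sup>2)"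
      using that A.finite_B by (intro member_le_sum) auto
    also have "\<dots> \<le> real (card (B m)) * \<epsilon> * 1"
      by (rule order_trans[OF ub], intro mult_left_mono A.projection_trace_le_1[OF r]) (use \<epsilon> in simp)
    also have "\<dots> = \<delta>\<^sup>2" using cA by (simp add: \<epsilon>_def)
    finally show ?thesis using \<delta> by (simp add: power2_le_iff_abs_le)
  qed
  define r2 where "r2 = (\<lambda>x. r x - u x)"
  have r2: "projection G (B m') r2" "convol G r r2 = r2"
    using C.projection_diff[OF r' u] by (auto simp: r2_def)
  have close: "cmod (r2 a / t' - r a / t) \<le> d" if "a \<in> B m" for a
  proof -
    have "complex_of_real (1 - \<kappa>) \<noteq> 0" using t tk by auto
    then have "r2 a / t' - r a / t = - (u a - of_real \<kappa> * r a) / t'"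
      using t by (simp add: r2_def tk field_simps)
    then have "cmod (r2 a / t' - r a / t) = cmod (u a - of_real \<kappa> * r a) / t'"
      using t by (simp add: norm_divide norm_minus_commute)
    also have "\<dots> \<le> \<delta> / t'" using u\<delta>[OF that] t by (simp add: divide_right_mono)
    finally show ?thesis using t by (simp add: \<delta>_def)
  qed
  have on: "(\<Sum>a\<in>B m. cmod (r2 a / t') powr p) \<le> (\<Sum>a\<in>B m. cmod (r a / t) powr p) + (1/2) ^ i"
  proof -
    have "(\<Sum>a\<in>B m. cmod (r2 a / t') powr p) \<le> (\<Sum>a\<in>B m. (cmod (r a / t) + d) powr p)"
    proof (rule sum_mono)
      fix a assume a: "a \<in> B m"
      have "cmod (r2 a / t') \<le> cmod (r a / t) + cmod (r2 a / t' - r a / t)"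
        by (rule norm_triangle_sub)
      then show "cmod (r2 a / t') powr p \<le> (cmod (r a / t) + d) powr p"
        using close[OF a] p by (intro powr_mono2) auto
    qed
    then show ?thesis using bd[OF d(1,2)] by linarith
  qed
  \<comment> \<open>The ideal value \<open>\<kappa> * r \<one>\<close> is at most
    \<open>2 * \<kappa> * t\<close>, and the deviation \<open>\<delta>\<close> at most another
    \<open>\<kappa> * t\<close>.\<close>
  have u1: "Re (u \<one>) \<le> 3 * (\<kappa> * t)"
  proof -
    have "Re (u \<one>) = \<kappa> * Re (r \<one>) + Re (u \<one> - of_real \<kappa> * r \<one>)" by simp
    also have "\<dots> \<le> \<kappa> * (2 * t) + \<delta>"
      using r1 \<kappa> u\<delta>[OF A.B_closed(1)] complex_Re_le_cmod[of "u \<one> - of_real \<kappa> * r \<one>"]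
      by (intro add_mono mult_left_mono) (auto simp: t_def)
    finally show ?thesis using d(4) by (simp add: \<delta>_def)
  qed
  have off: "(\<Sum>a\<in>B m' - B m. cmod (r2 a / t') powr p)
      \<le> 3 powr (p - 1) * 2 powr p * (real i + 1) powr (q - (p - 1))"
  proof -
    have "(\<Sum>a\<in>B m' - B m. cmod (r2 a / t') powr p) = (\<Sum>a\<in>B m' - B m. cmod (u a) powr p) / t' powr p"
      using t supportedD[OF A.projection_supported[OF r]]
      by (auto simp: r2_def norm_divide powr_divide sum_divide_distrib intro!: sum.cong)
    also have "\<dots> \<le> Re (u \<one>) powr (p - 1) / t' powr p"
      by (intro divide_right_mono C.projection_powr_sum_le[OF u(1) p]) auto
    also have "\<dots> \<le> (3 * (\<kappa> * t)) powr (p - 1) / (t / 2) powr p"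
      using u1 t p C.projection_trace(3)[OF u(1)]
      by (intro frac_le powr_mono2) auto
    also have "\<dots> = 3 powr (p - 1) * 2 powr p * (\<kappa> powr (p - 1) * (t powr (p - 1) / t powr p))"
      using t \<kappa> by (simp add: powr_mult powr_divide field_simps)
    also have "t powr (p - 1) / t powr p = (real i + 1) powr q"
    proof -
      have "t powr (p - 1) / t powr p = inverse t" using t by (simp add: powr_diff field_simps)
      then show ?thesis unfolding t_def trace_rate_def by (simp add: powr_minus)
    qed
    also have "\<kappa> powr (p - 1) * (real i + 1) powr q \<le> (1 / (real i + 1)) powr (p - 1) * (real i + 1) powr q"
      using \<kappa> p by (intro mult_right_mono powr_mono2) auto
    also have "\<dots> = (real i + 1) powr (q - (p - 1))"
      by (simp add: powr_divide powr_diff)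
    finally show ?thesis by (simp add: mult_left_mono)
  qed
  have "(\<Sum>a\<in>B m'. cmod (r2 a / t') powr p)
      = (\<Sum>a\<in>B m. cmod (r2 a / t') powr p) + (\<Sum>a\<in>B m' - B m. cmod (r2 a / t') powr p)"
    using sum.subset_diff[OF mm(2) C.finite_B] by (simp add: add.commute)
  then have "(\<Sum>a\<in>B m'. cmod (r2 a / t') powr p) \<le> (\<Sum>a\<in>B m. cmod (r a / t) powr p) + (1/2) ^ i
        + 3 powr (p - 1) * 2 powr p * (real i + 1) powr (q - (p - 1))"
    using on off by linarith
  moreover have "\<forall>a\<in>B m. cmod (r2 a / t' - r a / t) \<le> (1/2) ^ (i + 2)"
    using order_trans[OF close d(3)] by blast
  ultimately show ?thesis using mm(1) r2 by (intro exI[of _ m'] exI[of _ r2] conjI)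
qed

end

lemma convergent_of_summable_increments:
  fixes f :: "nat \<Rightarrow> complex"
  assumes "\<And>i. i \<ge> N \<Longrightarrow> cmod (f (Suc i) - f i) \<le> (1/2) ^ i"
  shows "convergent f"
proof -
  have "summable (\<lambda>i. f (Suc i) - f i)"
    by (rule summable_comparison_test'[of "\<lambda>i. (1/2::real) ^ i" N]) (use assms in \<open>auto intro: summable_geometric\<close>)
  then have "convergent (\<lambda>n. \<Sum>i<n. f (Suc i) - f i)" by (simp only: summable_iff_convergent)
  then have "convergent (\<lambda>n. f n - f 0)" by (simp only: sum_lessThan_telescope)
  then show ?thesis by (simp only: convergent_diff_const_right_iff)
qed

lemma bounded_of_summable_increments:
  fixes x b :: "nat \<Rightarrow> real"
  assumes "\<And>i. x (Suc i) \<le> x i + b i" "summable b" "\<And>i. b i \<ge> 0"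
  shows "x n \<le> x 0 + suminf b"
proof -
  have "x n \<le> x 0 + (\<Sum>i<n. b i)"
  proof (induction n)
    case (Suc n)
    then show ?case using assms(1)[of n] by simp
  qed simp
  also have "(\<Sum>i<n. b i) \<le> suminf b" using assms by (intro sum_le_suminf) auto
  finally show ?thesis by simp
qed

context group
begin

theorem exhaustion_of_finite_subgroups:
  fixes B :: "nat \<Rightarrow> 'a set"
  assumes B: "\<And>n. subgroup (B n) G" "\<And>n. finite (B n)" "mono B" "\<And>N. \<exists>n. N \<le> card (B n)"
    and p: "2 < p"
  shows "\<exists>F E. closed_invariant_subspace G p F \<and> F \<noteq> {\<lambda>_. 0}
           \<and> invariant_exhaustion G p E \<and> (\<forall>i. E i \<inter> F = {\<lambda>_. 0})"
proof -
  have half: "0 \<le> (1/2::real) ^ i" for i by simp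
  \<comment> \<open>The cap 1 is for \<open>trace_rate\<close>; half of \<open>p - 2\<close> makes
    the contributions from outside the old support summable.\<close>
  define q where "q = min 1 ((p - 2) / 2)"
  have q: "0 < q" "q \<le> 1" "q - (p - 1) < -1" using p by (auto simp: q_def min_def field_simps)
  define t where "t = trace_rate q"
  have t: "t i > 0" "t (Suc i) < t i" for i using trace_rate[OF q(1,2)] by (simp_all add: t_def)
  have t0: "t 0 = 1" using trace_rate(2)[OF q(1,2)] by (simp add: t_def)
  define \<beta> where "\<beta> i = (1/2) ^ i + 3 powr (p - 1) * 2 powr p * (real i + 1) powr (q - (p - 1))" for i :: nat
  \<comment> \<open>The normalised trace starts at 1 and moves by at most \<open>(1/2)^(i+2)\<close>
    in step \<open>i\<close>; the margins shrink accordingly, so that it never leaves the interval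
    from 1/2 to 2.\<close>
  define P where "P i s \<longleftrightarrow> projection G (B (fst s)) (snd s)
      \<and> Re (snd s \<one> / t i) \<le> 2 - (1/2) ^ i \<and> 1/2 + (1/2) ^ Suc i \<le> Re (snd s \<one> / t i)"
    for i and s :: "nat \<times> ('a \<Rightarrow> complex)"
  define Q where "Q i s s' \<longleftrightarrow> fst s \<le> fst s' \<and> convol G (snd s) (snd s') = snd s'
      \<and> (\<forall>a\<in>B (fst s). cmod (snd s' a / t (Suc i) - snd s a / t i) \<le> (1/2) ^ (i + 2))
      \<and> (\<Sum>a\<in>B (fst s'). cmod (snd s' a / t (Suc i)) powr p)
        \<le> (\<Sum>a\<in>B (fst s). cmod (snd s a / t i) powr p) + \<beta> i"
    for i and s s' :: "nat \<times> ('a \<Rightarrow> complex)"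
  note fs = finite_subgroup.intro[OF group_axioms finite_subgroup_axioms.intro[OF B(1,2)]]
  have one: "\<one> \<in> B n" for n by (rule subgroup.one_closed[OF B(1)])
  have "\<exists>s. \<forall>i. P i (s i) \<and> Q i (s i) (s (Suc i))"
  proof (rule dependent_nat_choice)
    show "\<exists>s. P 0 s"
      using finite_subgroup.point_mass_projection[OF fs[of 0]]
      by (intro exI[of _ "(0, point_mass \<one>)"]) (simp add: P_def t0 point_mass_def)
    fix s i assume s: "P i s"
    then have pr: "projection G (B (fst s)) (snd s)" by (simp add: P_def)
    have "Re (snd s \<one>) / t i \<le> 2 - (1/2) ^ i" using s by (simp add: P_def)
    then have "Re (snd s \<one>) / t i \<le> 2" using half[of i] by linarith
    then have le: "Re (snd s \<one>) \<le> 2 * trace_rate q i" using t by (simp add: t_def field_simps)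
    obtain m' r' where Qs: "Q i s (m', r')" and pr': "projection G (B m') r'"
      using projection_step[OF B p q(1,2) pr le] unfolding Q_def t_def \<beta>_def add.assoc by auto
    have "cmod (r' \<one> / t (Suc i) - snd s \<one> / t i) \<le> (1/2) ^ (i + 2)"
      using Qs one by (simp add: Q_def)
    then have "\<bar>Re (r' \<one> / t (Suc i) - snd s \<one> / t i)\<bar> \<le> (1/2) ^ (i + 2)"
      by (rule order_trans[OF abs_Re_le_cmod])
    then have "\<bar>Re (r' \<one> / t (Suc i)) - Re (snd s \<one> / t i)\<bar> \<le> (1/2) ^ i / 4"
      by (simp only: minus_complex.simps power_add) (simp add: power2_eq_square)
    moreover have "Re (snd s \<one> / t i) \<le> 2 - (1/2) ^ i \<and> 1/2 + (1/2) ^ i / 2 \<le> Re (snd s \<one> / t i)"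
      using s by (simp add: P_def)
    ultimately have "Re (r' \<one> / t (Suc i)) \<le> 2 - (1/2) ^ i / 2 \<and> 1/2 + (1/2) ^ i / 4 \<le> Re (r' \<one> / t (Suc i))"
      unfolding abs_le_iff using half[of i] by (intro conjI) linarith+
    then have "P (Suc i) (m', r')" using pr' by (simp add: P_def)
    then show "\<exists>s'. P (Suc i) s' \<and> Q i s s'" using Qs by blast
  qed
  then obtain s where Ps: "\<And>i. P i (s i)" and Qs: "\<And>i. Q i (s i) (s (Suc i))" by blast
  define n where "n i = fst (s i)" for i
  define r where "r i = snd (s i)" for i
  define f where "f i = (\<lambda>x. of_real (1 / t i) * r i x)" for i
  have pr: "projection G (B (n i)) (r i)" for i using Ps[of i] by (simp add: P_def n_def r_def)
  note F = fs[of "n _"]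
  have f_eq: "f i x = r i x / t i" for i x by (simp add: f_def)
  have mono_n: "mono n" using Qs by (auto simp: Q_def n_def intro: incseq_SucI)
  have Bn: "B (n i) \<subseteq> B (n j)" if "i \<le> j" for i j using monoD[OF B(3) monoD[OF mono_n that]] .
  have sr: "r i \<in> supported (B (n i))" for i by (rule finite_subgroup.projection_supported[OF F pr])
  have r1: "r i \<in> lp 1 (carrier G)" for i by (rule finite_subgroup.supported_lp1[OF F sr])
  have rb: "r i \<in> bounded_functions (carrier G)" for i by (rule finite_subgroup.supported_bounded[OF F sr])
  have rr: "convol G (r i) (r (Suc i)) = r (Suc i)" for i using Qs[of i] by (simp add: Q_def r_def)
  have idem: "convol G (r i) (r i) = r i" for i by (rule finite_subgroup.projection_idem[OF F pr])
  \<comment> \<open>The order between projections is transitive; \<open>rij\<close> is the mirror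
    image, obtained by adjoints.\<close>
  have rji: "convol G (r j) (r i) = r i" if "j \<le> i" for i j
    using that
  proof (induction i rule: dec_induct)
    case (step i)
    have "convol G (r j) (r (Suc i)) = convol G (convol G (r j) (r i)) (r (Suc i))"
      unfolding convol_assoc[OF rb r1 r1] rr ..
    then show ?case using step.IH rr by simp
  qed (rule idem)
  have rij: "convol G (r i) (r j) = r i" if "j \<le> i" for i j
    by (rule finite_subgroup.subprojection_right[OF F projection_mono[OF pr Bn[OF that]] pr rji[OF that]])
  have inc: "cmod (f (Suc i) x - f i x) \<le> (1/2) ^ (i + 2)" if "x \<in> B (n i)" for i x
    using Qs[of i] that by (simp add: Q_def n_def r_def f_eq)
  have conv: "convergent (\<lambda>i. f i x)" for x
  proof (cases "\<exists>j. x \<in> B (n j)")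
    case True
    then obtain j where j: "x \<in> B (n j)" by blast
    show ?thesis
    proof (rule convergent_of_summable_increments)
      fix i assume "j \<le> i"
      then have "cmod (f (Suc i) x - f i x) \<le> (1/2) ^ (i + 2)" using Bn j by (intro inc) auto
      also have "\<dots> \<le> (1/2) ^ i" by (intro power_decreasing) auto
      finally show "cmod (f (Suc i) x - f i x) \<le> (1/2) ^ i" .
    qed
  next
    case False
    then have "f i x = 0" for i using supportedD[OF sr] by (simp add: f_eq)
    then show ?thesis by (simp add: convergent_const)
  qed
  define \<eta> where "\<eta> x = lim (\<lambda>i. f i x)" for x
  have lim: "(\<lambda>i. f i x) \<longlonglongrightarrow> \<eta> x" for x
    using conv[of x] unfolding \<eta>_def convergent_LIMSEQ_iff .
  define \<Phi> where "\<Phi> i = (\<Sum>a\<in>B (n i). cmod (f i a) powr p)" for i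
  have \<Phi>: "\<Phi> (Suc i) \<le> \<Phi> i + \<beta> i" for i
    using Qs[of i] by (simp add: \<Phi>_def Q_def n_def r_def f_eq)
  have "summable (\<lambda>i. (real i + 1) powr (q - (p - 1)))"
  proof -
    have "summable (\<lambda>i. real i powr (q - (p - 1)))" using q by (simp add: summable_real_powr_iff)
    then have "summable (\<lambda>i. real (Suc i) powr (q - (p - 1)))" by (rule summable_Suc_iff[THEN iffD2])
    then show ?thesis by (simp add: add.commute)
  qed
  then have "summable \<beta>" unfolding \<beta>_def
    by (intro summable_add summable_mult summable_geometric) auto
  then have \<Phi>b: "\<Phi> i \<le> \<Phi> 0 + suminf \<beta>" for i
    by (intro bounded_of_summable_increments[where x = \<Phi>] \<Phi>) (auto simp: \<beta>_def)
  have sf: "f i \<in> supported (B (n i))" for i using sr[of i] by (auto simp: supported_def f_eq)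
  have p1: "1 \<le> p" using p by simp
  show ?thesis
  proof (rule exhaustion_of_convolvers[where c = r and d = r and e = "\<lambda>i. r (Suc i)" and f = f and \<eta> = \<eta>
        and C = "(\<Phi> 0 + suminf \<beta>) powr (1 / p)" and ?x0.0 = \<one>])
    \<comment> \<open>The p-power sum of \<open>r i\<close> is at most its trace to the power
      \<open>p - 1\<close>, and the trace is at most \<open>2 * t i\<close>.\<close>
    show "(\<lambda>i. lp_norm p (carrier G) (r i)) \<longlonglongrightarrow> 0"
    proof (rule tendsto_sandwich[where f = "\<lambda>_. 0" and h = "\<lambda>i. ((2 * t i) powr (p - 1)) powr (1/p)"])
      show "\<forall>\<^sub>F i in sequentially. lp_norm p (carrier G) (r i) \<le> ((2 * t i) powr (p - 1)) powr (1/p)"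
      proof (intro always_eventually allI)
        fix i
        have "Re (r i \<one>) / t i \<le> 2 - (1/2) ^ i" using Ps[of i] by (simp add: P_def r_def)
        then have "Re (r i \<one>) / t i \<le> 2" using half[of i] by linarith
        then have "Re (r i \<one>) \<le> 2 * t i" using t by (simp add: field_simps)
        then have "Re (r i \<one>) powr (p - 1) \<le> (2 * t i) powr (p - 1)"
          using finite_subgroup.projection_trace(3)[OF F pr[of i]] p by (intro powr_mono2) auto
        then have "(\<Sum>y\<in>B (n i). cmod (r i y) powr p) \<le> (2 * t i) powr (p - 1)"
          using finite_subgroup.projection_powr_sum_le[OF F pr p order_refl] order_trans by blast
        then show "lp_norm p (carrier G) (r i) \<le> ((2 * t i) powr (p - 1)) powr (1/p)"
          unfolding finite_subgroup.lp_norm_supported[OF F sr] using p by (intro powr_mono2) (auto simp: sum_nonneg)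
      qed
      have "filterlim (\<lambda>i. real i + 1) at_top sequentially"
        by (rule filterlim_at_top_mono[OF filterlim_real_sequentially]) simp
      then have "(\<lambda>i. (real i + 1) powr (-q)) \<longlonglongrightarrow> 0"
        using q by (intro tendsto_neg_powr) auto
      then have "t \<longlonglongrightarrow> 0" by (simp add: t_def trace_rate_def[abs_def])
      then have "(\<lambda>i. ((2 * t i) powr (p - 1)) powr (1/p)) \<longlonglongrightarrow> ((2 * 0) powr (p - 1)) powr (1/p)"
        using p t by (intro tendsto_intros tendsto_powr') (auto intro: always_eventually less_imp_le)
      then show "(\<lambda>i. ((2 * t i) powr (p - 1)) powr (1/p)) \<longlonglongrightarrow> 0" by simp
    qed (simp_all add: lp_norm_nonneg)
    show "f i \<in> lp p (carrier G)" for i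
      by (rule lp1_subset_lp[OF finite_subgroup.supported_lp1[OF F sf] p1])
    show "lp_norm p (carrier G) (f i) \<le> (\<Phi> 0 + suminf \<beta>) powr (1 / p)" for i
      unfolding finite_subgroup.lp_norm_supported[OF F sf] using p \<Phi>b[of i]
      by (intro powr_mono2) (auto simp: sum_nonneg \<Phi>_def)
    show "convol G (f i) (r j) = f i" if "j \<le> i" for i j
      unfolding f_def convol_scale_left rij[OF that] ..
    have "1/2 \<le> Re (\<eta> \<one>)"
    proof (rule tendsto_lowerbound)
      show "(\<lambda>i. Re (f i \<one>)) \<longlonglongrightarrow> Re (\<eta> \<one>)" by (intro tendsto_Re lim)
      have "1/2 \<le> Re (f i \<one>)" for i
        using Ps[of i] half[of "Suc i"] unfolding P_def f_eq r_def by linarith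
      then show "\<forall>\<^sub>F i in sequentially. 1/2 \<le> Re (f i \<one>)" by simp
    qed simp
    then show "\<eta> \<one> \<noteq> 0" by auto
  qed (fact p1 r1 idem lim rr[symmetric])+
qed

end

section \<open>Fourier series of trapezoids, by way of the second Bernoulli polynomial\<close>

section \<open>Fourier coefficients of trapezoids\<close>

lemma product_to_sum_mult:
  fixes c :: real
  assumes "c * k = (p + q) / 2"
  shows "d * (c ^ Suc n * k) = (1/2) * (d * (c ^ n * q)) + (1/2) * (d * (c ^ n * p))"
proof -
  have "d * (c ^ Suc n * k) = d * (c ^ n * (c * k))" by (simp add: mult_ac)
  also have "\<dots> = (1/2) * (d * (c ^ n * q)) + (1/2) * (d * (c ^ n * p))"
    unfolding assms by (simp add: algebra_simps)
  finally show ?thesis .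
qed

text \<open>Completeness of the cosines. Product-to-sum formulas turn vanishing cosine moments into
  orthogonality to all polynomials in \<open>cos (2 * pi * x)\<close>; these are uniformly dense by
  Stone-Weierstrass, since this cosine is injective on the interval.\<close>

lemma cosine_moments_zero:
  fixes D :: "real \<Rightarrow> real"
  assumes cont: "continuous_on {0..1/2} D"
    and mom: "\<And>k::nat. integral {0..1/2} (\<lambda>x. D x * cos (2 * pi * k * x)) = 0"
    and x: "x \<in> {0..1/2}"
  shows "D x = 0"
proof -
  note ci = integrable_continuous_real continuous_intros cont
  have powers: "integral {0..1/2} (\<lambda>x. D x * (cos (2 * pi * x) ^ n * cos (2 * pi * real k * x))) = 0" for n k
  proof (induction n arbitrary: k)
    case 0
    then show ?case using mom by simp
  next
    case (Suc n)
    show ?case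
    proof (cases k)
      case 0
      \<comment> \<open>For frequency 0 the extra factor is 1, and one more power of the cosine acts
        as frequency 1.\<close>
      then show ?thesis using Suc[of 1] by (simp add: mult_ac)
    next
      case (Suc l)
      have e: "D x * (cos (2 * pi * x) ^ Suc n * cos (2 * pi * real k * x))
          = (1/2) * (D x * (cos (2 * pi * x) ^ n * cos (2 * pi * real (Suc k) * x)))
          + (1/2) * (D x * (cos (2 * pi * x) ^ n * cos (2 * pi * real l * x)))" for x
      proof -
        have "cos (2 * pi * x) * cos (2 * pi * real k * x)
            = (cos (2 * pi * real k * x - 2 * pi * x) + cos (2 * pi * real k * x + 2 * pi * x)) / 2"
          by (subst cos_times_cos[symmetric]) simp
        also have "2 * pi * real k * x - 2 * pi * x = 2 * pi * real l * x"
          using Suc by (simp add: algebra_simps)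
        also have "2 * pi * real k * x + 2 * pi * x = 2 * pi * real (Suc k) * x"
          by (simp add: algebra_simps)
        finally show ?thesis by (rule product_to_sum_mult)
      qed
      have "integral {0..1/2} (\<lambda>x. (1/2) * (D x * (cos (2 * pi * x) ^ n * cos (2 * pi * real (Suc k) * x)))
          + (1/2) * (D x * (cos (2 * pi * x) ^ n * cos (2 * pi * real l * x))))
        = integral {0..1/2} (\<lambda>x. (1/2) * (D x * (cos (2 * pi * x) ^ n * cos (2 * pi * real (Suc k) * x))))
          + integral {0..1/2} (\<lambda>x. (1/2) * (D x * (cos (2 * pi * x) ^ n * cos (2 * pi * real l * x))))"
        by (intro integral_add ci)
      then show ?thesis unfolding e integral_mult_right Suc.IH by simp
    qed
  qed
  have poly: "integral {0..1/2} (\<lambda>x. D x * (\<Sum>i\<le>n. a i * cos (2 * pi * x) ^ i)) = 0" for a n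
  proof -
    have "integral {0..1/2} (\<lambda>x. D x * (\<Sum>i\<le>n. a i * cos (2 * pi * x) ^ i))
        = integral {0..1/2} (\<lambda>x. \<Sum>i\<le>n. a i * (D x * (cos (2 * pi * x) ^ i * cos (2 * pi * real 0 * x))))"
      by (simp add: sum_distrib_left mult.left_commute)
    also have "\<dots> = (\<Sum>i\<le>n. integral {0..1/2} (\<lambda>x. a i * (D x * (cos (2 * pi * x) ^ i * cos (2 * pi * real 0 * x)))))"
      by (intro integral_sum) (auto intro!: ci)
    also have "\<dots> = 0" unfolding integral_mult_right powers by simp
    finally show ?thesis .
  qed
  define I where "I = integral {0..1/2} (\<lambda>x. \<bar>D x\<bar>)"
  have I: "I \<ge> 0" unfolding I_def by (intro integral_nonneg ci) auto
  have small: "integral {0..1/2} (\<lambda>x. (D x)\<^sup>2) \<le> e * I" if e: "e > 0" for e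
  proof -
    \<comment> \<open>The substitution \<open>y = cos (2 * pi * x)\<close> moves the approximation
      problem to polynomials in \<open>y\<close>.\<close>
    have "continuous_on {-1..1} (\<lambda>y. D (arccos y / (2 * pi)))"
    proof (rule continuous_on_compose2[OF cont])
      show "continuous_on {-1..1} (\<lambda>y. arccos y / (2 * pi))" by (intro continuous_intros) auto
      show "(\<lambda>y. arccos y / (2 * pi)) ` {-1..1} \<subseteq> {0..1/2}"
        using arccos_lbound arccos_ubound by (auto simp: field_simps)
    qed
    then obtain g where g: "real_polynomial_function g"
      "\<And>y. y \<in> {-1..1} \<Longrightarrow> \<bar>D (arccos y / (2 * pi)) - g y\<bar> < e"
      using Stone_Weierstrass_real_polynomial_function[of "{-1..1}" _ e] e by blast
    obtain a n where an: "g = (\<lambda>y. \<Sum>i\<le>n. a i * y ^ i)"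
      using g(1) unfolding real_polynomial_function_iff_sum by blast
    have contg: "continuous_on {0..1/2} (\<lambda>x. g (cos (2 * pi * x)))"
      unfolding an by (intro continuous_intros)
    have close: "\<bar>D x - g (cos (2 * pi * x))\<bar> \<le> e" if "x \<in> {0..1/2}" for x
    proof -
      have "arccos (cos (2 * pi * x)) = 2 * pi * x"
        using that by (intro arccos_cos) (auto simp: field_simps)
      then show ?thesis using g(2)[of "cos (2 * pi * x)"] by simp
    qed
    \<comment> \<open>\<open>D\<close> is orthogonal to the approximating polynomial, which may
      therefore be subtracted from one of the two factors.\<close>
    have "integral {0..1/2} (\<lambda>x. (D x)\<^sup>2)
        = integral {0..1/2} (\<lambda>x. D x * (D x - g (cos (2 * pi * x))) + D x * g (cos (2 * pi * x)))"
      by (simp add: algebra_simps power2_eq_square)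
    also have "\<dots> = integral {0..1/2} (\<lambda>x. D x * (D x - g (cos (2 * pi * x))))
        + integral {0..1/2} (\<lambda>x. D x * g (cos (2 * pi * x)))"
      by (intro integral_add ci contg)
    also have "integral {0..1/2} (\<lambda>x. D x * g (cos (2 * pi * x))) = 0" unfolding an by (rule poly)
    also have "integral {0..1/2} (\<lambda>x. D x * (D x - g (cos (2 * pi * x)))) \<le> integral {0..1/2} (\<lambda>x. e * \<bar>D x\<bar>)"
    proof (intro integral_le ci contg)
      fix x :: real assume "x \<in> {0..1/2}"
      then have "\<bar>D x\<bar> * \<bar>D x - g (cos (2 * pi * x))\<bar> \<le> \<bar>D x\<bar> * e" by (intro mult_left_mono close) auto
      then show "D x * (D x - g (cos (2 * pi * x))) \<le> e * \<bar>D x\<bar>"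
        by (metis abs_le_D1 abs_mult mult.commute)
    qed
    also have "\<dots> = e * I" by (simp add: I_def)
    finally show ?thesis by simp
  qed
  have "integral {0..1/2} (\<lambda>x. (D x)\<^sup>2) \<le> 0"
  proof (rule field_le_epsilon)
    fix e :: real assume e: "e > 0"
    have "e / (I + 1) * I \<le> e" using I e by (simp add: field_simps)
    then show "integral {0..1/2} (\<lambda>x. (D x)\<^sup>2) \<le> 0 + e"
      using small[of "e / (I + 1)"] I e by simp
  qed
  moreover have "integral {0..1/2} (\<lambda>x. (D x)\<^sup>2) \<ge> 0" by (intro integral_nonneg ci) auto
  ultimately have "integral {0..1/2} (\<lambda>x. (D x)\<^sup>2) = 0" by simp
  then have "\<forall>x\<in>{0..1/2}. (D x)\<^sup>2 = 0"
    by (subst (asm) integral_eq_0_iff) (auto intro!: continuous_intros cont)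
  then show ?thesis using x by simp
qed

text \<open>On the unit interval this is \<open>pi^2\<close> times the second Bernoulli polynomial
  \<open>x^2 - x + 1/6\<close>.\<close>

definition cosine_series :: "real \<Rightarrow> real" where
  "cosine_series x = suminf (\<lambda>n. cos (2 * pi * real (Suc n) * x) / (real (Suc n))\<^sup>2)"

lemma summable_inverse_Suc_squares: "summable (\<lambda>n. 1 / (real (Suc n))\<^sup>2)"
  using sums_summable[OF inverse_squares_sums] by (simp add: add.commute)

lemma summable_cosine_series: "summable (\<lambda>n. cos (2 * pi * real (Suc n) * x) / (real (Suc n))\<^sup>2)"
  by (rule summable_comparison_test'[OF summable_inverse_Suc_squares, of 0])
    (simp add: divide_right_mono)

lemma cosine_half_integral:
  "((\<lambda>x. cos (2 * pi * real_of_int j * x)) has_integral (if j = 0 then 1/2 else 0)) {0..1/2}"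
proof (cases "j = 0")
  case True
  then show ?thesis using has_integral_const_real[of "1::real" 0 "1/2"] by simp
next
  case False
  have "((\<lambda>x. cos (2 * pi * real_of_int j * x)) has_integral
      (sin (2 * pi * real_of_int j * (1/2)) / (2 * pi * j) - sin (2 * pi * real_of_int j * 0) / (2 * pi * j))) {0..1/2}"
    using False
    by (intro fundamental_theorem_of_calculus)
      (auto intro!: derivative_eq_intros simp flip: has_real_derivative_iff_has_vector_derivative)
  moreover have "sin (2 * pi * real_of_int j * (1/2)) = 0"
    using sin_int_times_real[of j] by (simp add: mult.commute)
  ultimately show ?thesis using False by simp
qed

text \<open>Uniform convergence permits termwise integration, and orthogonality leaves at most one
  term.\<close>

lemma cosine_series_moment:
  fixes m :: nat
  shows "continuous_on {0..1/2} cosine_series"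
    and "((\<lambda>x. cosine_series x * cos (2 * pi * m * x)) has_integral (if m = 0 then 0 else 1 / (4 * (real m)\<^sup>2))) {0..1/2}"
proof -
  define f where "f N x = (\<Sum>n<N. cos (2 * pi * real (Suc n) * x) / (real (Suc n))\<^sup>2)" for N :: nat and x
  have cf: "continuous_on {0..1/2} (f N)" for N
    unfolding f_def by (intro continuous_intros) auto
  have u: "uniform_limit {0..1/2} f cosine_series sequentially"
    unfolding f_def cosine_series_def
    by (rule Weierstrass_m_test[OF _ summable_inverse_Suc_squares]) (simp add: divide_right_mono)
  show cs: "continuous_on {0..1/2} cosine_series"
    by (rule uniform_limit_theorem[OF _ u]) (simp_all add: cf)
  have u2: "uniform_limit {0..1/2} (\<lambda>N x. f N x * cos (2 * pi * m * x)) (\<lambda>x. cosine_series x * cos (2 * pi * m * x)) sequentially"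
  proof (rule uniform_lim_mult[OF u])
    show "uniform_limit {0..1/2} (\<lambda>N x. cos (2 * pi * m * x)) (\<lambda>x. cos (2 * pi * m * x)) sequentially"
      by (rule uniform_limit_const)
    show "bounded (cosine_series ` {0..1/2})" "bounded ((\<lambda>x. cos (2 * pi * real m * x)) ` {0..1/2})"
      by (intro compact_imp_bounded compact_continuous_image cs continuous_intros compact_Icc)+
  qed
  obtain I J where IJ: "\<And>N. ((\<lambda>x. f N x * cos (2 * pi * m * x)) has_integral I N) {0..1/2}"
    "((\<lambda>x. cosine_series x * cos (2 * pi * m * x)) has_integral J) {0..1/2}" "I \<longlonglongrightarrow> J"
    by (rule uniform_limit_integral[OF u2]) (auto intro!: continuous_intros cf)
  have pair: "((\<lambda>x. cos (2 * pi * real (Suc n) * x) / (real (Suc n))\<^sup>2 * cos (2 * pi * m * x))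
      has_integral (if Suc n = m then 1 / (4 * (real m)\<^sup>2) else 0)) {0..1/2}" for n
  proof -
    let ?c = "1 / (2 * (real (Suc n))\<^sup>2)"
    have "((\<lambda>x. ?c * (cos (2 * pi * real_of_int (int (Suc n) - int m) * x) + cos (2 * pi * real_of_int (int (Suc n) + int m) * x)))
        has_integral ?c * ((if int (Suc n) - int m = 0 then 1/2 else 0) + (if int (Suc n) + int m = 0 then 1/2 else 0))) {0..1/2}"
      by (intro has_integral_mult_right has_integral_add cosine_half_integral)
    moreover have "?c * (cos (2 * pi * real_of_int (int (Suc n) - int m) * x) + cos (2 * pi * real_of_int (int (Suc n) + int m) * x))
        = cos (2 * pi * real (Suc n) * x) / (real (Suc n))\<^sup>2 * cos (2 * pi * m * x)" for x
    proof -
      have "cos (2 * pi * real (Suc n) * x) * cos (2 * pi * m * x)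
          = (cos (2 * pi * real (Suc n) * x - 2 * pi * m * x) + cos (2 * pi * real (Suc n) * x + 2 * pi * m * x)) / 2"
        by (rule cos_times_cos)
      also have "2 * pi * real (Suc n) * x - 2 * pi * m * x = 2 * pi * real_of_int (int (Suc n) - int m) * x"
        by (simp add: algebra_simps)
      also have "2 * pi * real (Suc n) * x + 2 * pi * m * x = 2 * pi * real_of_int (int (Suc n) + int m) * x"
        by (simp add: algebra_simps)
      finally have H: "cos (2 * pi * real (Suc n) * x) * cos (2 * pi * m * x)
          = (cos (2 * pi * real_of_int (int (Suc n) - int m) * x) + cos (2 * pi * real_of_int (int (Suc n) + int m) * x)) / 2" .
      have "cos (2 * pi * real (Suc n) * x) / (real (Suc n))\<^sup>2 * cos (2 * pi * m * x)
          = (cos (2 * pi * real (Suc n) * x) * cos (2 * pi * m * x)) / (real (Suc n))\<^sup>2" by simp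
      then show ?thesis unfolding H by simp
    qed
    moreover have "?c * ((if int (Suc n) - int m = 0 then 1/2 else 0) + (if int (Suc n) + int m = 0 then 1/2 else 0))
        = (if Suc n = m then 1 / (4 * (real m)\<^sup>2) else 0)" by auto
    ultimately show ?thesis by (simp only:)
  qed
  have "((\<lambda>x. f N x * cos (2 * pi * m * x)) has_integral (\<Sum>n<N. if Suc n = m then 1 / (4 * (real m)\<^sup>2) else 0)) {0..1/2}" for N
    unfolding f_def sum_distrib_right by (intro has_integral_sum pair) simp
  then have I: "I N = (\<Sum>n<N. if Suc n = m then 1 / (4 * (real m)\<^sup>2) else 0)" for N
    using IJ(1) has_integral_unique by blast
  have "I N = (if m = 0 then 0 else 1 / (4 * (real m)\<^sup>2))" if "N \<ge> m" for N
  proof (cases m)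
    case (Suc k)
    have "(\<Sum>n<N. if Suc n = m then 1 / (4 * (real m)\<^sup>2) else 0) = (\<Sum>n<N. if n = k then 1 / (4 * (real m)\<^sup>2) else 0)"
      using Suc by (intro sum.cong) auto
    then show ?thesis using Suc that by (simp add: I)
  qed (simp add: I)
  then have "I \<longlonglongrightarrow> (if m = 0 then 0 else 1 / (4 * (real m)\<^sup>2))"
    by (intro tendsto_eventually eventually_sequentiallyI[of m])
  then have "J = (if m = 0 then 0 else 1 / (4 * (real m)\<^sup>2))" using IJ(3) LIMSEQ_unique by blast
  then show "((\<lambda>x. cosine_series x * cos (2 * pi * m * x)) has_integral (if m = 0 then 0 else 1 / (4 * (real m)\<^sup>2))) {0..1/2}"
    using IJ(2) by simp
qed

lemma parabola_moment:
  fixes m :: nat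
  shows "((\<lambda>x. pi\<^sup>2 * (x\<^sup>2 - x + 1/6) * cos (2 * pi * m * x)) has_integral (if m = 0 then 0 else 1 / (4 * (real m)\<^sup>2))) {0..1/2}"
proof (cases "m = 0")
  case True
  have "((\<lambda>x. pi\<^sup>2 * (x\<^sup>2 - x + 1/6)) has_integral
      (pi\<^sup>2 * ((1/2)^3/3 - (1/2)\<^sup>2/2 + (1/2)/6) - pi\<^sup>2 * (0^3/3 - 0\<^sup>2/2 + 0/6))) {0..1/2}"
    by (intro fundamental_theorem_of_calculus)
      (auto intro!: derivative_eq_intros simp: power2_eq_square simp flip: has_real_derivative_iff_has_vector_derivative)
  then show ?thesis using True by (simp add: power2_eq_square power3_eq_cube)
next
  case False
  define w where "w = 2 * pi * real m"
  have w: "w \<noteq> 0" using False by (simp add: w_def)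
  \<comment> \<open>The antiderivative found by integrating by parts twice.\<close>
  define F where "F x = pi\<^sup>2 * ((x\<^sup>2 - x + 1/6) * sin (w * x) / w + (2 * x - 1) * cos (w * x) / w\<^sup>2 - 2 * sin (w * x) / w^3)" for x
  have "(F has_real_derivative pi\<^sup>2 * (x\<^sup>2 - x + 1/6) * cos (w * x)) (at x within {0..1/2})" for x
    unfolding F_def
    by (rule derivative_eq_intros refl | use w in \<open>simp; fail\<close>)+
      (use w in \<open>simp add: field_simps power2_eq_square power3_eq_cube\<close>)
  then have "((\<lambda>x. pi\<^sup>2 * (x\<^sup>2 - x + 1/6) * cos (w * x)) has_integral (F (1/2) - F 0)) {0..1/2}"
    by (intro fundamental_theorem_of_calculus)
      (auto simp flip: has_real_derivative_iff_has_vector_derivative)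
  moreover have "sin (w * (1/2)) = 0" using sin_npi[of m] by (simp add: w_def mult.commute)
  then have "F (1/2) - F 0 = 1 / (4 * (real m)\<^sup>2)"
    using False by (simp add: F_def w_def power2_eq_square field_simps)
  ultimately show ?thesis using False by (simp add: w_def)
qed

text \<open>Both sides have the same cosine moments on \<open>[0, 1/2]\<close>; the symmetries
  \<open>x\<close> to \<open>- x\<close> and \<open>x\<close> to \<open>1 - x\<close> extend the
  identity to the range needed for the arguments in \<open>trapezoid_series\<close>.\<close>

theorem cosine_series_eq:
  assumes "\<bar>x\<bar> \<le> 1"
  shows "cosine_series x = pi\<^sup>2 * (x\<^sup>2 - \<bar>x\<bar> + 1/6)"
proof -
  have half: "cosine_series x = pi\<^sup>2 * (x\<^sup>2 - x + 1/6)" if "x \<in> {0..1/2}" for x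
  proof -
    have "cosine_series x - pi\<^sup>2 * (x\<^sup>2 - x + 1/6) = 0"
    proof (rule cosine_moments_zero[OF _ _ that])
      show "continuous_on {0..1/2} (\<lambda>x. cosine_series x - pi\<^sup>2 * (x\<^sup>2 - x + 1/6))"
        by (intro continuous_intros cosine_series_moment)
      fix k :: nat
      have "((\<lambda>x. cosine_series x * cos (2 * pi * k * x) - pi\<^sup>2 * (x\<^sup>2 - x + 1/6) * cos (2 * pi * k * x))
          has_integral 0) {0..1/2}"
        using has_integral_diff[OF cosine_series_moment(2)[of k] parabola_moment[of k]] by simp
      then show "integral {0..1/2} (\<lambda>x. (cosine_series x - pi\<^sup>2 * (x\<^sup>2 - x + 1/6)) * cos (2 * pi * k * x)) = 0"
        by (simp add: left_diff_distrib integral_unique)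
    qed
    then show ?thesis by simp
  qed
  have even: "cosine_series (- x) = cosine_series x" for x by (simp add: cosine_series_def)
  have refl: "cosine_series (1 - x) = cosine_series x" for x
  proof -
    have "cos (2 * pi * real (Suc n) * (1 - x)) = cos (2 * pi * real (Suc n) * x)" for n
    proof -
      have "2 * pi * real (Suc n) * (1 - x) = 2 * real (Suc n) * pi - 2 * pi * real (Suc n) * x"
        by (simp add: algebra_simps)
      then show ?thesis by (simp only: cos_diff cos_2npi sin_2npi)
    qed
    then show ?thesis by (simp add: cosine_series_def)
  qed
  have unit: "cosine_series y = pi\<^sup>2 * (y\<^sup>2 - y + 1/6)" if "0 \<le> y" "y \<le> 1" for y
  proof (cases "y \<le> 1/2")
    case False
    then have "cosine_series (1 - y) = pi\<^sup>2 * ((1 - y)\<^sup>2 - (1 - y) + 1/6)" using that by (intro half) auto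
    then show ?thesis by (simp add: refl power2_eq_square algebra_simps)
  qed (use half that in auto)
  show ?thesis
  proof (cases "x \<ge> 0")
    case False
    then have "cosine_series (- x) = pi\<^sup>2 * ((- x)\<^sup>2 - (- x) + 1/6)" using assms by (intro unit) auto
    then show ?thesis using False by (simp add: even)
  qed (use unit assms in auto)
qed

lemma has_sum_int_split:
  fixes f :: "int \<Rightarrow> 'b :: banach"
  assumes P: "summable (\<lambda>n. norm (f (int (Suc n))))" and N: "summable (\<lambda>n. norm (f (- int (Suc n))))"
    and S: "(\<lambda>n. f (int (Suc n)) + f (- int (Suc n))) sums S"
  shows "(f has_sum (f 0 + S)) UNIV"
proof -
  have p: "(\<lambda>n. f (int (Suc n))) sums (suminf (\<lambda>n. f (int (Suc n))))"
    and n: "(\<lambda>n. f (- int (Suc n))) sums (suminf (\<lambda>n. f (- int (Suc n))))"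
    using summable_norm_cancel[OF P] summable_norm_cancel[OF N] by (simp_all add: summable_sums)
  have S': "S = suminf (\<lambda>n. f (int (Suc n))) + suminf (\<lambda>n. f (- int (Suc n)))"
    using sums_unique2[OF S sums_add[OF p n]] .
  have hp: "(f has_sum suminf (\<lambda>n. f (int (Suc n)))) (range (\<lambda>n. int (Suc n)))"
  proof -
    have "((f \<circ> (\<lambda>n. int (Suc n))) has_sum suminf (\<lambda>n. f (int (Suc n)))) UNIV"
      unfolding comp_def by (rule norm_summable_imp_has_sum[OF P p])
    then show ?thesis by (subst has_sum_reindex) (auto simp: inj_on_def)
  qed
  have hn: "(f has_sum suminf (\<lambda>n. f (- int (Suc n)))) (range (\<lambda>n. - int (Suc n)))"
  proof -
    have "((f \<circ> (\<lambda>n. - int (Suc n))) has_sum suminf (\<lambda>n. f (- int (Suc n)))) UNIV"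
      unfolding comp_def by (rule norm_summable_imp_has_sum[OF N n])
    then show ?thesis by (subst has_sum_reindex) (auto simp: inj_on_def)
  qed
  have "(f has_sum f 0) {0}" by (rule has_sum_finiteI) auto
  then have "(f has_sum (f 0 + suminf (\<lambda>n. f (int (Suc n))) + suminf (\<lambda>n. f (- int (Suc n)))))
      ({0} \<union> range (\<lambda>n. int (Suc n)) \<union> range (\<lambda>n. - int (Suc n)))"
    by (intro has_sum_Un_disjoint hp hn) auto
  moreover have "{0} \<union> range (\<lambda>n. int (Suc n)) \<union> range (\<lambda>n. - int (Suc n)) = (UNIV :: int set)"
  proof -
    have "k \<in> {0} \<union> range (\<lambda>n. int (Suc n)) \<union> range (\<lambda>n. - int (Suc n))" for k :: int
    proof (cases k rule: int_cases3)
      case (pos n)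
      then have "k = int (Suc (n - 1))" by simp
      then show ?thesis by blast
    next
      case (neg n)
      then have "k = - int (Suc (n - 1))" by simp
      then show ?thesis by blast
    qed simp
    then show ?thesis by blast
  qed
  ultimately show ?thesis by (simp add: S' add.assoc)
qed

text \<open>The Fourier coefficients of the even trapezoid which is \<open>1\<close> on \<open>[0, (a - b) / 2]\<close> and
  vanishes on \<open>[(a + b) / 2, 1/2]\<close>.\<close>
definition trapezoid :: "real \<Rightarrow> real \<Rightarrow> int \<Rightarrow> real" where
  "trapezoid a b k = (if k = 0 then a else sin (pi * k * a) * sin (pi * k * b) / (pi\<^sup>2 * (of_int k)\<^sup>2 * b))"

text \<open>For \<open>v >= 0\<close> the sum \<open>|v - t| + |v + t|\<close> is twice the maximum
  of \<open>v\<close> and \<open>|t|\<close>, so this is a scaled difference of two such maxima. The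
  form with absolute values matches the four cosine series into which the coefficients
  split.\<close>

definition trapezoid_fun :: "real \<Rightarrow> real \<Rightarrow> real \<Rightarrow> real" where
  "trapezoid_fun a b t = (\<bar>(a + b) / 2 - t\<bar> + \<bar>(a + b) / 2 + t\<bar> - \<bar>(a - b) / 2 - t\<bar> - \<bar>(a - b) / 2 + t\<bar>) / (2 * b)"

lemma trapezoid_fun_eq_1: "0 < b \<Longrightarrow> \<bar>t\<bar> \<le> (a - b) / 2 \<Longrightarrow> trapezoid_fun a b t = 1"
proof -
  assume b: "0 < b" and t: "\<bar>t\<bar> \<le> (a - b) / 2"
  then have "0 \<le> (a - b) / 2 - t" "0 \<le> (a - b) / 2 + t" "0 \<le> (a + b) / 2 - t" "0 \<le> (a + b) / 2 + t"
    by (simp_all add: abs_le_iff field_simps)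
  then show ?thesis using b unfolding trapezoid_fun_def by (simp only: abs_of_nonneg) (simp add: field_simps)
qed

lemma trapezoid_fun_eq_0: "b \<le> a \<Longrightarrow> 0 < b \<Longrightarrow> (a + b) / 2 \<le> \<bar>t\<bar> \<Longrightarrow> trapezoid_fun a b t = 0"
proof -
  assume b: "b \<le> a" "0 < b" and t: "(a + b) / 2 \<le> \<bar>t\<bar>"
  have *: "\<bar>v - t\<bar> + \<bar>v + t\<bar> = 2 * \<bar>t\<bar>" if "0 \<le> v" "v \<le> \<bar>t\<bar>" for v
    using that by (simp add: abs_if split: if_splits)
  have "(a - b) / 2 \<le> (a + b) / 2" using b by (intro divide_right_mono) auto
  then have "\<bar>(a + b) / 2 - t\<bar> + \<bar>(a + b) / 2 + t\<bar> = 2 * \<bar>t\<bar>" "\<bar>(a - b) / 2 - t\<bar> + \<bar>(a - b) / 2 + t\<bar> = 2 * \<bar>t\<bar>"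
    using b t by (auto intro!: *)
  then show ?thesis by (simp add: trapezoid_fun_def)
qed

lemma trapezoid_minus: "trapezoid a b (- k) = trapezoid a b k"
  by (simp add: trapezoid_def)

lemma trapezoid_bound:
  assumes "0 < b" "k \<noteq> 0"
  shows "\<bar>trapezoid a b k\<bar> \<le> 1 / (pi\<^sup>2 * b) * (1 / (of_int k)\<^sup>2)"
proof -
  have "\<bar>sin (pi * k * a) * sin (pi * k * b)\<bar> \<le> 1 * 1"
    unfolding abs_mult by (intro mult_mono) auto
  then have "\<bar>sin (pi * k * a) * sin (pi * k * b)\<bar> / (pi\<^sup>2 * (of_int k)\<^sup>2 * b) \<le> 1 / (pi\<^sup>2 * (of_int k)\<^sup>2 * b)"
    using assms by (intro divide_right_mono) auto
  then show ?thesis using assms by (simp add: trapezoid_def abs_mult mult_ac)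
qed

lemma abs_trapezoid_Suc_summable:
  assumes "0 < b"
  shows "summable (\<lambda>n. \<bar>trapezoid a b (int (Suc n))\<bar>)"
  by (rule summable_comparison_test'[OF summable_mult[OF summable_inverse_Suc_squares, of "1 / (pi\<^sup>2 * b)"], of 0])
    (use trapezoid_bound[OF assms, of "int (Suc _)" a] in simp)

lemma trapezoid_abs_summable:
  assumes b: "0 < b"
  shows "(\<lambda>k. \<bar>trapezoid a b k\<bar>) summable_on UNIV"
proof -
  have "((\<lambda>k. \<bar>trapezoid a b k\<bar>) has_sum (\<bar>trapezoid a b 0\<bar>
      + suminf (\<lambda>n. \<bar>trapezoid a b (int (Suc n))\<bar> + \<bar>trapezoid a b (- int (Suc n))\<bar>))) UNIV"
    using abs_trapezoid_Suc_summable[OF b, of a]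
    by (intro has_sum_int_split) (simp_all only: trapezoid_minus real_norm_def abs_idempotent summable_sums summable_add)
  then show ?thesis by (rule has_sum_imp_summable)
qed

text \<open>A product \<open>sin x * sin y * cos z\<close> is a combination of four cosines, so
  pairing \<open>k\<close> with \<open>- k\<close> gives a combination of four cosine series with
  known sums.\<close>

lemma trapezoid_series:
  assumes b: "0 < b" "b \<le> a" "a + b \<le> 1" and t: "\<bar>t\<bar> \<le> 1/2"
  shows "((\<lambda>k. complex_of_real (trapezoid a b k) * cis (2 * pi * of_int k * t)) has_sum of_real (trapezoid_fun a b t)) UNIV"
proof -
  let ?f = "\<lambda>k. complex_of_real (trapezoid a b k) * cis (2 * pi * of_int k * t)"
  let ?u = "(a - b) / 2" and ?v = "(a + b) / 2"
  have tm: "?f (int (Suc n)) + ?f (- int (Suc n)) = complex_of_real (1 / (2 * pi\<^sup>2 * b) *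
      (cos (2 * pi * real (Suc n) * (?u - t)) / (real (Suc n))\<^sup>2 + cos (2 * pi * real (Suc n) * (?u + t)) / (real (Suc n))\<^sup>2
     - cos (2 * pi * real (Suc n) * (?v - t)) / (real (Suc n))\<^sup>2 - cos (2 * pi * real (Suc n) * (?v + t)) / (real (Suc n))\<^sup>2))" for n
  proof -
    define k where "k = real (Suc n)"
    have k: "k > 0" by (simp add: k_def)
    have 1: "?f (int (Suc n)) + ?f (- int (Suc n))
        = complex_of_real (trapezoid a b (int (Suc n)) * (2 * cos (2 * pi * k * t)))"
    proof -
      have "?f (- int (Suc n)) = of_real (trapezoid a b (int (Suc n))) * cis (- (2 * pi * k * t))"
      proof -
        have "2 * pi * real_of_int (- int (Suc n)) * t = - (2 * pi * k * t)" by (simp add: k_def algebra_simps)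
        then show ?thesis by (simp only: trapezoid_minus)
      qed
      moreover have "?f (int (Suc n)) = of_real (trapezoid a b (int (Suc n))) * cis (2 * pi * k * t)"
        by (simp add: k_def)
      ultimately have "?f (int (Suc n)) + ?f (- int (Suc n))
          = of_real (trapezoid a b (int (Suc n))) * (cis (2 * pi * k * t) + cis (- (2 * pi * k * t)))"
        by (simp only: distrib_left)
      also have "cis (2 * pi * k * t) + cis (- (2 * pi * k * t)) = complex_of_real (2 * cos (2 * pi * k * t))"
        by (simp add: complex_eq_iff)
      finally show ?thesis by (simp only: of_real_mult)
    qed
    define x y z where "x = pi * k * a" and "y = pi * k * b" and "z = 2 * pi * k * t"
    have args: "2 * pi * k * (?u - t) = (x - y) - z" "2 * pi * k * (?u + t) = (x - y) + z"
      "2 * pi * k * (?v - t) = (x + y) - z" "2 * pi * k * (?v + t) = (x + y) + z"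
      by (simp_all add: x_def y_def z_def field_simps)
    have "cos ((x - y) - z) + cos ((x - y) + z) - cos ((x + y) - z) - cos ((x + y) + z) = 4 * (sin x * sin y * cos z)"
    proof -
      have "cos (w - z) + cos (w + z) = 2 * cos w * cos z" for w by (simp add: cos_add cos_diff)
      then have "cos ((x - y) - z) + cos ((x - y) + z) - (cos ((x + y) - z) + cos ((x + y) + z)) = 2 * (cos (x - y) - cos (x + y)) * cos z"
        by (simp only: left_diff_distrib right_diff_distrib)
      also have "cos (x - y) - cos (x + y) = 2 * (sin x * sin y)" by (simp add: cos_add cos_diff)
      finally show ?thesis by simp
    qed
    then have "1 / (2 * pi\<^sup>2 * b) * (cos ((x - y) - z) / k\<^sup>2 + cos ((x - y) + z) / k\<^sup>2 - cos ((x + y) - z) / k\<^sup>2 - cos ((x + y) + z) / k\<^sup>2)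
        = 1 / (2 * pi\<^sup>2 * b) * (4 * (sin x * sin y * cos z) / k\<^sup>2)"
      by (simp flip: add_divide_distrib diff_divide_distrib)
    also have "\<dots> = sin x * sin y / (pi\<^sup>2 * k\<^sup>2 * b) * (2 * cos z)"
      using b k by (simp add: field_simps)
    also have "sin x * sin y / (pi\<^sup>2 * k\<^sup>2 * b) = trapezoid a b (int (Suc n))"
      by (simp add: trapezoid_def x_def y_def k_def)
    finally show ?thesis unfolding 1 k_def[symmetric] args z_def[symmetric] by (simp only:)
  qed
  have cs: "(\<lambda>n. cos (2 * pi * real (Suc n) * x) / (real (Suc n))\<^sup>2) sums cosine_series x" for x
    unfolding cosine_series_def by (rule summable_sums[OF summable_cosine_series])
  have "(\<lambda>n. ?f (int (Suc n)) + ?f (- int (Suc n))) sums complex_of_real (1 / (2 * pi\<^sup>2 * b) *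
      (cosine_series (?u - t) + cosine_series (?u + t) - cosine_series (?v - t) - cosine_series (?v + t)))"
    unfolding tm by (intro sums_of_real sums_mult sums_add sums_diff cs)
  then have "(?f has_sum (?f 0 + complex_of_real (1 / (2 * pi\<^sup>2 * b) *
      (cosine_series (?u - t) + cosine_series (?u + t) - cosine_series (?v - t) - cosine_series (?v + t))))) UNIV"
    using abs_trapezoid_Suc_summable[OF b(1), of a]
    by (intro has_sum_int_split) (simp_all only: norm_mult norm_of_real norm_cis mult_1_right trapezoid_minus)
  moreover have "1 / (2 * pi\<^sup>2 * b) *
      (cosine_series (?u - t) + cosine_series (?u + t) - cosine_series (?v - t) - cosine_series (?v + t))
    = trapezoid_fun a b t - a"
  proof -
    have "\<bar>?u - t\<bar> \<le> 1" "\<bar>?u + t\<bar> \<le> 1" "\<bar>?v - t\<bar> \<le> 1" "\<bar>?v + t\<bar> \<le> 1"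
      using b t by (auto simp: abs_le_iff field_simps)
    then have "cosine_series (?u - t) + cosine_series (?u + t) - cosine_series (?v - t) - cosine_series (?v + t)
      = pi\<^sup>2 * ((?u - t)\<^sup>2 + (?u + t)\<^sup>2 - (?v - t)\<^sup>2 - (?v + t)\<^sup>2 + (\<bar>?v - t\<bar> + \<bar>?v + t\<bar> - \<bar>?u - t\<bar> - \<bar>?u + t\<bar>))"
      by (simp only: cosine_series_eq) (simp add: algebra_simps)
    \<comment> \<open>The quadratic parts leave a constant, which becomes the \<open>- a\<close>
      that the coefficient at \<open>k = 0\<close> cancels.\<close>
    also have "(?u - t)\<^sup>2 + (?u + t)\<^sup>2 - (?v - t)\<^sup>2 - (?v + t)\<^sup>2 = - (2 * a * b)"
      by (simp add: power2_eq_square field_simps)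
    finally have H: "cosine_series (?u - t) + cosine_series (?u + t) - cosine_series (?v - t) - cosine_series (?v + t)
      = pi\<^sup>2 * (- (2 * a * b) + (\<bar>?v - t\<bar> + \<bar>?v + t\<bar> - \<bar>?u - t\<bar> - \<bar>?u + t\<bar>))" .
    have "1 / (2 * pi\<^sup>2 * b) * (pi\<^sup>2 * (- (2 * a * b) + w)) = w / (2 * b) - a" for w
      using b by (simp add: field_simps)
    then show ?thesis unfolding H trapezoid_fun_def .
  qed
  moreover have "?f 0 + complex_of_real (trapezoid_fun a b t - a) = of_real (trapezoid_fun a b t)"
    by (simp add: trapezoid_def)
  ultimately show ?thesis by (simp only:)
qed

text \<open>Reflects that a nonnegative function has no Fourier coefficient larger than its
  integral; here it follows from \<open>|sin x| <= |x|\<close>.\<close>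

lemma trapezoid_le:
  assumes "0 < b" "0 < a"
  shows "\<bar>trapezoid a b k\<bar> \<le> a"
proof (cases "k = 0")
  case False
  have "\<bar>sin (pi * k * a)\<bar> * \<bar>sin (pi * k * b)\<bar> \<le> \<bar>pi * k * a\<bar> * \<bar>pi * k * b\<bar>"
    by (intro mult_mono abs_sin_x_le_abs_x) auto
  also have "\<dots> = a * (pi\<^sup>2 * (of_int k)\<^sup>2 * b)" using assms by (simp add: abs_mult power2_eq_square)
  finally show ?thesis using False assms by (simp add: trapezoid_def abs_mult pos_divide_le_eq)
qed (use assms in \<open>simp add: trapezoid_def\<close>)

text \<open>Estimating \<open>sin (pi * k * b)\<close> by its argument leaves the Fourier
  coefficients of an arc of length \<open>a\<close>. The sum of their squares over
  \<open>k \<noteq> 0\<close> is \<open>a - a^2\<close>, as Parseval's identity predicts; it is read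
  off from \<open>cosine_series_eq\<close> at \<open>0\<close> and \<open>a\<close>.\<close>

lemma trapezoid_square_sum:
  assumes b: "0 < b" and a: "0 < a" "a \<le> 1"
  shows "(\<lambda>k. (trapezoid a b k)\<^sup>2) summable_on (UNIV - {0})"
    and "(\<Sum>\<^sub>\<infinity>k\<in>UNIV - {0}. (trapezoid a b k)\<^sup>2) \<le> a"
proof -
  define g where "g k = (1 - cos (2 * pi * of_int k * a)) / (2 * pi\<^sup>2 * (of_int k)\<^sup>2)" for k :: int
  have g0: "g k \<ge> 0" for k by (simp add: g_def)
  have le: "(trapezoid a b k)\<^sup>2 \<le> g k" if k: "k \<noteq> 0" for k
  proof -
    have "\<bar>sin (pi * k * a)\<bar> * \<bar>sin (pi * k * b)\<bar> \<le> \<bar>sin (pi * k * a)\<bar> * \<bar>pi * k * b\<bar>"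
      by (intro mult_left_mono abs_sin_x_le_abs_x) auto
    then have "\<bar>sin (pi * k * a)\<bar> * \<bar>sin (pi * k * b)\<bar> / (pi\<^sup>2 * (of_int k)\<^sup>2 * b)
        \<le> \<bar>sin (pi * k * a)\<bar> * \<bar>pi * k * b\<bar> / (pi\<^sup>2 * (of_int k)\<^sup>2 * b)"
      using b by (intro divide_right_mono) auto
    moreover have "\<bar>trapezoid a b k\<bar> = \<bar>sin (pi * k * a)\<bar> * \<bar>sin (pi * k * b)\<bar> / (pi\<^sup>2 * (of_int k)\<^sup>2 * b)"
      using k b by (simp add: trapezoid_def abs_mult)
    ultimately have "\<bar>trapezoid a b k\<bar> \<le> \<bar>sin (pi * k * a)\<bar> * \<bar>pi * k * b\<bar> / (pi\<^sup>2 * (of_int k)\<^sup>2 * b)"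
      by (simp only:)
    also have "\<dots> = \<bar>sin (pi * k * a) / (pi * k)\<bar>"
      using k b by (simp add: abs_mult power2_eq_square field_simps abs_divide)
    finally have "\<bar>trapezoid a b k\<bar>\<^sup>2 \<le> \<bar>sin (pi * k * a) / (pi * k)\<bar>\<^sup>2" by (intro power_mono) auto
    also have "\<dots> = (sin (pi * k * a))\<^sup>2 / (pi\<^sup>2 * (of_int k)\<^sup>2)" by (simp add: power_divide power_mult_distrib)
    also have "\<dots> = g k"
      using cos_double_sin[of "pi * k * a"] by (simp add: g_def mult.assoc)
    finally show ?thesis by simp
  qed
  have gn: "g (int (Suc n)) = 1 / (2 * pi\<^sup>2) * (cos (2 * pi * real (Suc n) * 0) / (real (Suc n))\<^sup>2 - cos (2 * pi * real (Suc n) * a) / (real (Suc n))\<^sup>2)" for n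
    by (simp add: g_def diff_divide_distrib mult_ac)
  have cs: "(\<lambda>n. cos (2 * pi * real (Suc n) * x) / (real (Suc n))\<^sup>2) sums cosine_series x" for x
    unfolding cosine_series_def by (rule summable_sums[OF summable_cosine_series])
  have gs: "(\<lambda>n. g (int (Suc n))) sums (1 / (2 * pi\<^sup>2) * (cosine_series 0 - cosine_series a))"
    unfolding gn by (intro sums_mult sums_diff cs)
  have even: "g (- k) = g k" for k by (simp add: g_def)
  have "(g has_sum (g 0 + (1 / (2 * pi\<^sup>2) * (cosine_series 0 - cosine_series a) + 1 / (2 * pi\<^sup>2) * (cosine_series 0 - cosine_series a)))) UNIV"
    by (intro has_sum_int_split)
      (simp_all only: even real_norm_def abs_of_nonneg[OF g0] sums_summable[OF gs] sums_add[OF gs gs])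
  moreover have H: "cosine_series 0 - cosine_series a = pi\<^sup>2 * (a - a\<^sup>2)"
    using a by (simp add: cosine_series_eq algebra_simps)
  have "g 0 + (1 / (2 * pi\<^sup>2) * (cosine_series 0 - cosine_series a) + 1 / (2 * pi\<^sup>2) * (cosine_series 0 - cosine_series a)) = a - a\<^sup>2"
    unfolding H by (simp add: g_def field_simps)
  ultimately have gsum: "(g has_sum (a - a\<^sup>2)) UNIV" by (simp only:)
  have g_on: "g summable_on (UNIV - {0})"
    using has_sum_imp_summable[OF gsum] by (rule summable_on_subset_banach) simp
  show s: "(\<lambda>k. (trapezoid a b k)\<^sup>2) summable_on (UNIV - {0})"
    by (rule summable_on_comparison_test[OF g_on]) (use le in auto)
  have "(\<Sum>\<^sub>\<infinity>k\<in>UNIV - {0}. (trapezoid a b k)\<^sup>2) \<le> (\<Sum>\<^sub>\<infinity>k\<in>UNIV - {0}. g k)"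
    by (intro infsum_mono s g_on le) simp
  also have "\<dots> \<le> infsum g UNIV"
    by (intro infsum_mono2 g_on has_sum_imp_summable[OF gsum]) (auto simp: g0)
  also have "\<dots> = a - a\<^sup>2" by (rule infsumI[OF gsum])
  finally show "(\<Sum>\<^sub>\<infinity>k\<in>UNIV - {0}. (trapezoid a b k)\<^sup>2) \<le> a" by (simp add: order_trans)
qed

text \<open>The interpolation of \<open>projection_powr_sum_le\<close>, with \<open>a\<close> in the
  place of the trace.\<close>

lemma trapezoid_powr_sum:
  assumes b: "0 < b" and a: "0 < a" "a \<le> 1" and p: "2 < p"
  shows "(\<lambda>k. \<bar>trapezoid a b k\<bar> powr p) summable_on (UNIV - {0})"
    and "(\<Sum>\<^sub>\<infinity>k\<in>UNIV - {0}. \<bar>trapezoid a b k\<bar> powr p) \<le> a powr (p - 1)"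
proof -
  have le: "\<bar>trapezoid a b k\<bar> powr p \<le> a powr (p - 2) * (trapezoid a b k)\<^sup>2" for k
  proof (cases "trapezoid a b k = 0")
    case False
    then have "\<bar>trapezoid a b k\<bar> powr 2 = (trapezoid a b k)\<^sup>2" by simp
    moreover have "\<bar>trapezoid a b k\<bar> powr p = \<bar>trapezoid a b k\<bar> powr (p - 2) * \<bar>trapezoid a b k\<bar> powr 2"
      by (simp only: powr_add[symmetric]) simp
    ultimately have "\<bar>trapezoid a b k\<bar> powr p = \<bar>trapezoid a b k\<bar> powr (p - 2) * (trapezoid a b k)\<^sup>2"
      by (simp only:)
    also have "\<dots> \<le> a powr (p - 2) * (trapezoid a b k)\<^sup>2"
      using p trapezoid_le[OF b a(1), of k] by (intro mult_right_mono powr_mono2) auto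
    finally show ?thesis .
  qed simp
  have m: "(\<lambda>k. a powr (p - 2) * (trapezoid a b k)\<^sup>2) summable_on (UNIV - {0})"
    by (intro summable_on_cmult_right trapezoid_square_sum b a)
  show s: "(\<lambda>k. \<bar>trapezoid a b k\<bar> powr p) summable_on (UNIV - {0})"
    by (rule summable_on_comparison_test[OF m]) (use le in auto)
  have "(\<Sum>\<^sub>\<infinity>k\<in>UNIV - {0}. \<bar>trapezoid a b k\<bar> powr p) \<le> (\<Sum>\<^sub>\<infinity>k\<in>UNIV - {0}. a powr (p - 2) * (trapezoid a b k)\<^sup>2)"
    by (intro infsum_mono s m le)
  also have "\<dots> = a powr (p - 2) * (\<Sum>\<^sub>\<infinity>k\<in>UNIV - {0}. (trapezoid a b k)\<^sup>2)"
    by (rule infsum_cmult_right')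
  also have "\<dots> \<le> a powr (p - 2) * a" by (intro mult_left_mono trapezoid_square_sum b a) simp
  also have "\<dots> = a powr (p - 1)" using a by (simp add: powr_diff power2_eq_square)
  finally show "(\<Sum>\<^sub>\<infinity>k\<in>UNIV - {0}. \<bar>trapezoid a b k\<bar> powr p) \<le> a powr (p - 1)" .
qed

section \<open>Absolutely convergent Fourier series and lacunary dilation\<close>

section \<open>Convolution on the integers\<close>

context group
begin

lemma lp_norm_1_convol_le:
  assumes a: "a \<in> lp 1 (carrier G)" and b: "b \<in> lp 1 (carrier G)"
  shows "lp_norm 1 (carrier G) (convol G a b) \<le> lp_norm 1 (carrier G) a * lp_norm 1 (carrier G) b"
proof -
  have s: "(\<lambda>(y, x). cmod (a y * b (inv y \<otimes> x))) summable_on carrier G \<times> carrier G"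
    by (rule convol_double_summable[OF assms])
  have s': "(\<lambda>(x, y). cmod (a y * b (inv y \<otimes> x))) summable_on carrier G \<times> carrier G"
    using s by (subst summable_on_swap) simp
  have sx: "(\<lambda>x. \<Sum>\<^sub>\<infinity>y\<in>carrier G. cmod (a y * b (inv y \<otimes> x))) summable_on carrier G"
    using summable_on_Sigma_banach[OF s'] by simp
  have "lp_norm 1 (carrier G) (convol G a b) = (\<Sum>\<^sub>\<infinity>x\<in>carrier G. cmod (convol G a b x))"
    by (rule lp_norm_1)
  also have "\<dots> \<le> (\<Sum>\<^sub>\<infinity>x\<in>carrier G. \<Sum>\<^sub>\<infinity>y\<in>carrier G. cmod (a y * b (inv y \<otimes> x)))"
  proof (rule infsum_mono[OF _ sx])
    show "(\<lambda>x. cmod (convol G a b x)) summable_on carrier G"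
      using convol_lp1[OF assms] by (simp add: lp1_iff)
    fix x assume x: "x \<in> carrier G"
    show "cmod (convol G a b x) \<le> (\<Sum>\<^sub>\<infinity>y\<in>carrier G. cmod (a y * b (inv y \<otimes> x)))"
      using x norm_infsum_bound[OF convol_abs_summable[OF lp_subset_bounded[OF _ a] b x]]
      by (simp add: convol_def)
  qed
  also have "\<dots> = (\<Sum>\<^sub>\<infinity>y\<in>carrier G. \<Sum>\<^sub>\<infinity>x\<in>carrier G. cmod (a y * b (inv y \<otimes> x)))"
    using infsum_swap_banach[OF s'] .
  also have "\<dots> = (\<Sum>\<^sub>\<infinity>y\<in>carrier G. cmod (a y) * lp_norm 1 (carrier G) b)"
  proof (rule infsum_cong)
    fix y assume y: "y \<in> carrier G"
    have "(\<Sum>\<^sub>\<infinity>x\<in>carrier G. cmod (b (inv y \<otimes> x))) = lp_norm 1 (carrier G) b"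
      using infsum_reindex_bij_betw[OF bij_inv_mult_left[OF y], of "\<lambda>z. cmod (b z)"] by (simp add: lp_norm_1)
    then show "(\<Sum>\<^sub>\<infinity>x\<in>carrier G. cmod (a y * b (inv y \<otimes> x))) = cmod (a y) * lp_norm 1 (carrier G) b"
      by (simp add: norm_mult infsum_cmult_right')
  qed
  also have "\<dots> = lp_norm 1 (carrier G) a * lp_norm 1 (carrier G) b"
    by (simp add: infsum_cmult_left' lp_norm_1)
  finally show ?thesis .
qed

end

interpretation int_group: group integer_group
  by (rule group_integer_group)

abbreviation int_convol :: "(int \<Rightarrow> complex) \<Rightarrow> (int \<Rightarrow> complex) \<Rightarrow> int \<Rightarrow> complex" (infixl "\<star>" 70) where
  "a \<star> b \<equiv> convol integer_group a b"

abbreviation int_l1 :: "(int \<Rightarrow> complex) set" where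
  "int_l1 \<equiv> lp 1 UNIV"

lemma int_convol_eq: "(a \<star> b) x = (\<Sum>\<^sub>\<infinity>y\<in>UNIV. a y * b (x - y))"
  by (simp add: convol_def)

lemmas int_convol_l1 = int_group.convol_lp1[simplified]
  and int_convol_assoc = int_group.convol_assoc[simplified]
  and int_l1_bounded = lp_subset_bounded[of 1 _ "UNIV :: int set", simplified]

definition fourier :: "(int \<Rightarrow> complex) \<Rightarrow> real \<Rightarrow> complex" where
  "fourier a t = (\<Sum>\<^sub>\<infinity>n\<in>UNIV. a n * cis (2 * pi * of_int n * t))"

lemma fourier_summable:
  assumes "a \<in> int_l1"
  shows "(\<lambda>n. a n * cis (2 * pi * of_int n * t)) summable_on UNIV"
  by (rule Infinite_Sum.abs_summable_summable) (use assms in \<open>simp add: norm_mult lp1_iff\<close>)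

text \<open>Convolving the character \<open>n \<mapsto> cis (- 2 \<pi> n t)\<close> with \<open>a\<close> multiplies it by \<open>fourier a t\<close>.\<close>
lemma fourier_convol:
  assumes a: "a \<in> int_l1" and b: "b \<in> int_l1"
  shows "fourier (a \<star> b) t = fourier a t * fourier b t"
proof -
  define e where "e n = cis (2 * pi * of_int n * (- t))" for n :: int
  have e: "e \<in> bounded_functions UNIV"
    by (auto simp: bounded_functions_def e_def intro: exI[of _ 1])
  have E: "(e \<star> c) x = fourier c t * e x" if c: "c \<in> int_l1" for c x
  proof -
    have "(e \<star> c) x = (\<Sum>\<^sub>\<infinity>y\<in>UNIV. e (x - y) * c (x - (x - y)))"
      unfolding int_convol_eq
      by (rule infsum_reindex_bij_witness[of UNIV "\<lambda>y. x - y" "\<lambda>y. x - y"]) auto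
    also have "\<dots> = (\<Sum>\<^sub>\<infinity>y\<in>UNIV. c y * cis (2 * pi * of_int y * t) * e x)"
      by (rule infsum_cong) (simp add: e_def cis_mult algebra_simps)
    finally show ?thesis by (simp add: infsum_cmult_left' fourier_def)
  qed
  have "e \<star> a = (\<lambda>x. fourier a t * e x)" using E[OF a] by auto
  \<comment> \<open>Associativity with the merely bounded left factor \<open>e\<close>, read at 0,
    is multiplicativity of \<open>fourier\<close>.\<close>
  then have "((e \<star> a) \<star> b) 0 = fourier a t * (e \<star> b) 0"
    using int_group.convol_scale_left[of "fourier a t" e b] by simp
  moreover have "((e \<star> a) \<star> b) 0 = (e \<star> (a \<star> b)) 0" using int_convol_assoc[OF e a b] by simp
  ultimately show ?thesis using E[OF b, of 0] E[OF int_convol_l1[OF a b], of 0] by (simp add: e_def)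
qed

lemma cis_period_integral:
  "((\<lambda>t. cis (2 * pi * of_int k * t)) has_integral (if k = 0 then 1 else 0)) {0..1}"
proof (cases "k = 0")
  case True
  then show ?thesis using has_integral_const_real[of "1::complex" 0 1] by simp
next
  case False
  define A where "A = \<i> * of_real (2 * pi * of_int k)"
  have A: "A \<noteq> 0" using False by (simp add: A_def)
  have "((\<lambda>t. exp (t *\<^sub>R A) * A) has_integral (exp (1 *\<^sub>R A) - exp (0 *\<^sub>R A))) {0..1}"
    by (intro fundamental_theorem_of_calculus exp_scaleR_has_vector_derivative_right) simp
  then have "((\<lambda>t. exp (t *\<^sub>R A) * A * (1 / A)) has_integral (exp (1 *\<^sub>R A) - exp (0 *\<^sub>R A)) * (1 / A)) {0..1}"
    by (rule has_integral_mult_left)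
  moreover have "exp (t *\<^sub>R A) * A * (1 / A) = cis (2 * pi * of_int k * t)" for t
    using A by (simp add: A_def cis_conv_exp scaleR_conv_of_real mult_ac)
  moreover have "exp A = 1"
    using cis_multiple_2pi[of "of_int k"] by (simp add: A_def cis_conv_exp mult_ac)
  ultimately show ?thesis using False by simp
qed

text \<open>The coefficient at \<open>m\<close> is recovered by multiplying with the conjugate
  character and integrating over a period, which may be done termwise because the series converges
  uniformly.\<close>

lemma fourier_inject:
  assumes a: "a \<in> int_l1" and b: "b \<in> int_l1" and eq: "\<And>t. fourier a t = fourier b t"
  shows "a = b"
proof
  fix m
  define c where "c n = a n - b n" for n
  have c: "c \<in> int_l1" unfolding c_def by (rule lp_diff[OF _ a b]) simp
  have c0: "fourier c t = 0" for t
    using infsum_add[OF fourier_summable[OF a, of t] summable_on_cmult_right[OF fourier_summable[OF b, of t], of "-1"]]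
      infsum_cmult_right'[of "-1" "\<lambda>n. b n * cis (2 * pi * of_int n * t)" UNIV] eq[of t]
    by (simp add: fourier_def c_def left_diff_distrib)
  have cs: "(\<lambda>n. cmod (c n)) summable_on UNIV" using c by (simp add: lp1_iff)
  let ?f = "\<lambda>n t. c n * cis (2 * pi * of_int (n - m) * t)"
  have "uniform_limit {0..1::real} (\<lambda>W t. \<Sum>n\<in>W. ?f n t) (\<lambda>t. \<Sum>\<^sub>\<infinity>n\<in>UNIV. ?f n t) (finite_subsets_at_top UNIV)"
    by (rule Weierstrass_m_test_general[OF _ cs]) (simp add: norm_mult)
  moreover have "(\<Sum>\<^sub>\<infinity>n\<in>UNIV. ?f n t) = 0" for t
  proof -
    have "(\<Sum>\<^sub>\<infinity>n\<in>UNIV. ?f n t) = (\<Sum>\<^sub>\<infinity>n\<in>UNIV. c n * cis (2 * pi * of_int n * t) * cis (- (2 * pi * of_int m * t)))"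
      by (rule infsum_cong) (simp add: cis_mult mult.assoc algebra_simps)
    also have "\<dots> = fourier c t * cis (- (2 * pi * of_int m * t))"
      by (simp add: infsum_cmult_left' fourier_def)
    finally show ?thesis by (simp add: c0)
  qed
  ultimately have u: "uniform_limit {0..1::real} (\<lambda>W t. \<Sum>n\<in>W. ?f n t) (\<lambda>t. 0) (finite_subsets_at_top UNIV)"
    by simp
  obtain I J where IJ: "\<And>W. ((\<lambda>t. \<Sum>n\<in>W. ?f n t) has_integral I W) {0..1}" "((\<lambda>t. 0::complex) has_integral J) {0..1::real}"
    "(I \<longlongrightarrow> J) (finite_subsets_at_top UNIV)"
    by (rule uniform_limit_integral[OF u]) (auto intro!: continuous_intros)
  have J: "J = 0" using has_integral_unique[OF IJ(2) has_integral_0] .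
  have "I W = c m" if "finite W" "m \<in> W" for W
  proof -
    have "((\<lambda>t. \<Sum>n\<in>W. ?f n t) has_integral (\<Sum>n\<in>W. c n * (if n - m = 0 then 1 else 0))) {0..1}"
      by (intro has_integral_sum has_integral_mult_right cis_period_integral that)
    then have "I W = (\<Sum>n\<in>W. c n * (if n - m = 0 then 1 else 0))" using IJ(1) has_integral_unique by blast
    also have "\<dots> = (\<Sum>n\<in>W. if n = m then c m else 0)" by (rule sum.cong) auto
    finally show ?thesis using that by simp
  qed
  then have "\<forall>\<^sub>F W in finite_subsets_at_top UNIV. I W = c m"
    unfolding eventually_finite_subsets_at_top by (intro exI[of _ "{m}"]) auto
  then have "(I \<longlongrightarrow> c m) (finite_subsets_at_top UNIV)" by (rule tendsto_eventually)
  then have "c m = J" using IJ(3) by (intro tendsto_unique[of "finite_subsets_at_top UNIV" I]) auto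
  then show "a m = b m" using J by (simp add: c_def)
qed

text \<open>For \<open>M > 0\<close> the Fourier side replaces \<open>t\<close> by
  \<open>M * t\<close>: a function on the circle is repeated \<open>M\<close> times.\<close>

definition dilate :: "nat \<Rightarrow> (int \<Rightarrow> complex) \<Rightarrow> int \<Rightarrow> complex" where
  "dilate M a n = (if int M dvd n then a (n div int M) else 0)"

lemma dilate_mult: "M > 0 \<Longrightarrow> dilate M a (int M * n) = a n"
  by (simp add: dilate_def)

lemma has_sum_dilate:
  assumes M: "M > 0" and z: "\<And>n. F n 0 = 0" and s: "((\<lambda>n. F (int M * n) (a n)) has_sum S) UNIV"
  shows "((\<lambda>n. F n (dilate M a n)) has_sum S) UNIV"
proof -
  have "((\<lambda>n. F n (dilate M a n)) has_sum S) (range (\<lambda>n. int M * n))"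
    using s M by (subst has_sum_reindex) (auto simp: inj_on_def comp_def dilate_mult)
  then show ?thesis
    by (rule has_sum_cong_neutral[THEN iffD1, rotated -1]) (auto simp: dilate_def z elim!: dvdE)
qed

lemma dilate_norm_powr:
  assumes "M > 0" "p > 0" "a \<in> lp p UNIV"
  shows "((\<lambda>n. cmod (dilate M a n) powr p) has_sum (\<Sum>\<^sub>\<infinity>n\<in>UNIV. cmod (a n) powr p)) UNIV"
  by (rule has_sum_dilate[where F = "\<lambda>n x. cmod x powr p"]) (use assms in \<open>auto simp: lp_def\<close>)

lemma dilate_l1:
  assumes "M > 0" "a \<in> int_l1"
  shows "dilate M a \<in> int_l1"
  using has_sum_imp_summable[OF dilate_norm_powr[OF assms(1) _ assms(2)]] by (simp add: lp_def)

lemma fourier_dilate: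
  assumes M: "M > 0" and a: "a \<in> int_l1"
  shows "fourier (dilate M a) t = fourier a (M * t)"
proof -
  have "((\<lambda>n. dilate M a n * cis (2 * pi * of_int n * t)) has_sum fourier a (M * t)) UNIV"
  proof (rule has_sum_dilate[OF M])
    have "((\<lambda>n. a n * cis (2 * pi * of_int n * (M * t))) has_sum fourier a (M * t)) UNIV"
      unfolding fourier_def by (rule has_sum_infsum[OF fourier_summable[OF a]])
    then show "((\<lambda>n. a n * cis (2 * pi * of_int (int M * n) * t)) has_sum fourier a (M * t)) UNIV"
      by (simp add: mult_ac)
  qed simp
  then show ?thesis by (simp add: fourier_def infsumI)
qed

lemma has_sum_finite_sum:
  fixes F :: "'i \<Rightarrow> 'a \<Rightarrow> 'b :: topological_comm_monoid_add"
  assumes "finite I" "\<And>i. i \<in> I \<Longrightarrow> (F i has_sum S i) A"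
  shows "((\<lambda>n. \<Sum>i\<in>I. F i n) has_sum (\<Sum>i\<in>I. S i)) A"
  using assms by (induction I rule: finite_induct) (auto intro: has_sum_add)

text \<open>Two points of \<open>{-N..N}\<close> differ by less than \<open>M\<close>, so the
  translates of the dilated sequence by them have disjoint supports, and the p-power sums of the
  translates add up.\<close>

lemma convol_dilate_finite_support:
  assumes p: "1 \<le> p" and \<phi>: "\<phi> \<in> int_l1" and f: "\<And>n. \<bar>n\<bar> > N \<Longrightarrow> f n = 0" and M: "int M > 2 * N" "M > 0"
  shows "(\<Sum>\<^sub>\<infinity>n\<in>UNIV. cmod ((f \<star> dilate M \<phi>) n) powr p)
    = (\<Sum>\<^sub>\<infinity>n\<in>UNIV. cmod (f n) powr p) * (\<Sum>\<^sub>\<infinity>n\<in>UNIV. cmod (\<phi> n) powr p)"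
proof -
  let ?\<phi> = "\<lambda>n. dilate M \<phi> n" and ?B = "{-N..N}"
  define S where "S = (\<Sum>\<^sub>\<infinity>n\<in>UNIV. cmod (\<phi> n) powr p)"
  have f0: "f y = 0" if "y \<notin> ?B" for y using f[of y] that by auto
  have e: "cmod ((f \<star> ?\<phi>) n) powr p = (\<Sum>y\<in>?B. cmod (f y) powr p * cmod (?\<phi> (n - y)) powr p)" for n
  proof -
    have c: "(f \<star> ?\<phi>) n = (\<Sum>y\<in>?B. f y * ?\<phi> (n - y))"
    proof -
      have "(\<Sum>\<^sub>\<infinity>y\<in>UNIV. f y * ?\<phi> (n - y)) = (\<Sum>\<^sub>\<infinity>y\<in>?B. f y * ?\<phi> (n - y))"
        using f0 by (intro infsum_cong_neutral) auto
      then show ?thesis by (simp add: int_convol_eq)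
    qed
    have unique: "y = y'" if "y \<in> ?B" "y' \<in> ?B" "int M dvd n - y" "int M dvd n - y'" for y y'
    proof (rule ccontr)
      assume "y \<noteq> y'"
      have "int M dvd (n - y') - (n - y)" by (rule dvd_diff[OF that(4,3)])
      then have "int M dvd y - y'" by simp
      then have "int M \<le> \<bar>y - y'\<bar>" using \<open>y \<noteq> y'\<close> by (simp add: zdvd_imp_le dvd_abs_iff)
      then show False using that M by auto
    qed
    show ?thesis
    proof (cases "\<exists>y\<in>?B. int M dvd n - y")
      case True
      then obtain y where y: "y \<in> ?B" "int M dvd n - y" by blast
      have other: "?\<phi> (n - y') = 0" if "y' \<in> ?B - {y}" for y'
        using unique[of y' y] y that by (auto simp: dilate_def)
      have "(\<Sum>y'\<in>?B. f y' * ?\<phi> (n - y')) = f y * ?\<phi> (n - y) + (\<Sum>y'\<in>?B - {y}. f y' * ?\<phi> (n - y'))"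
        by (rule sum.remove) (use y in auto)
      moreover have "(\<Sum>y'\<in>?B. cmod (f y') powr p * cmod (?\<phi> (n - y')) powr p)
          = cmod (f y) powr p * cmod (?\<phi> (n - y)) powr p + (\<Sum>y'\<in>?B - {y}. cmod (f y') powr p * cmod (?\<phi> (n - y')) powr p)"
        by (rule sum.remove) (use y in auto)
      ultimately show ?thesis unfolding c using other by (simp add: norm_mult powr_mult)
    next
      case False
      then show ?thesis unfolding c by (simp add: dilate_def)
    qed
  qed
  have "((\<lambda>n. \<Sum>y\<in>?B. cmod (f y) powr p * cmod (?\<phi> (n - y)) powr p) has_sum (\<Sum>y\<in>?B. cmod (f y) powr p * S)) UNIV"
  proof (rule has_sum_finite_sum)
    fix y
    have "((\<lambda>n. cmod (?\<phi> n) powr p) has_sum S) UNIV"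
      unfolding S_def using p lp1_subset_lp[OF \<phi> p] by (intro dilate_norm_powr M) auto
    then have "((\<lambda>n. cmod (?\<phi> (n - y)) powr p) has_sum S) UNIV"
      by (rule has_sum_reindex_bij_witness[of UNIV "\<lambda>n. n - y" "\<lambda>n. n + y", THEN iffD1, rotated -1]) auto
    then show "((\<lambda>n. cmod (f y) powr p * cmod (?\<phi> (n - y)) powr p) has_sum cmod (f y) powr p * S) UNIV"
      by (rule has_sum_cmult_right)
  qed simp
  then have "(\<Sum>\<^sub>\<infinity>n\<in>UNIV. cmod ((f \<star> ?\<phi>) n) powr p) = (\<Sum>y\<in>?B. cmod (f y) powr p) * S"
    unfolding e by (simp add: infsumI sum_distrib_right)
  also have "(\<Sum>y\<in>?B. cmod (f y) powr p) = (\<Sum>\<^sub>\<infinity>y\<in>?B. cmod (f y) powr p)" by simp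
  also have "\<dots> = (\<Sum>\<^sub>\<infinity>n\<in>UNIV. cmod (f n) powr p)"
    using f0 by (intro infsum_cong_neutral) auto
  finally show ?thesis by (simp add: S_def)
qed

text \<open>For large \<open>M\<close> the dilated sequence is spread out so far that its translates by the bulk of \<open>f\<close>
  have disjoint supports.\<close>
lemma lp_norm_convol_dilate:
  assumes p: "1 \<le> p" and f: "f \<in> int_l1" and \<phi>: "\<phi> \<in> int_l1" and e: "e > 0"
  shows "\<forall>\<^sub>F M in sequentially. lp_norm p UNIV (f \<star> dilate M \<phi>) \<le> lp_norm p UNIV f * lp_norm p UNIV \<phi> + e"
proof -
  define K where "K = lp_norm 1 UNIV \<phi>"
  have K: "K \<ge> 0" by (simp add: K_def lp_norm_nonneg)
  have fs: "(\<lambda>n. cmod (f n)) summable_on UNIV" using f by (simp add: lp1_iff)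
  obtain S where S: "finite S" "dist (\<Sum>n\<in>S. cmod (f n)) (\<Sum>\<^sub>\<infinity>n\<in>UNIV. cmod (f n)) \<le> e / (K + 1)"
    using infsum_finite_approximation[OF fs, of "e / (K + 1)"] e K by auto
  define N where "N = Max (insert 0 (abs ` S))"
  have N: "\<bar>n\<bar> \<le> N" if "n \<in> S" for n using that S(1) by (simp add: N_def)
  have N0: "N \<ge> 0" using S(1) by (simp add: N_def)
  \<comment> \<open>\<open>f1\<close> is the bulk of \<open>f\<close>. The rest has 1-norm at most
    \<open>e / (K + 1)\<close>, so after convolution its 1-norm, and with it the p-norm, is at most
    \<open>e\<close>.\<close>
  define f1 where "f1 = (\<lambda>n. if n \<in> {-N..N} then f n else 0)"
  define f2 where "f2 = (\<lambda>n. f n - f1 n)"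
  have f1: "f1 \<in> int_l1"
  proof -
    have "(\<lambda>n. cmod (f1 n)) summable_on UNIV"
      by (rule summable_on_comparison_test[OF fs]) (auto simp: f1_def)
    then show ?thesis by (simp add: lp1_iff)
  qed
  have f2: "f2 \<in> int_l1" unfolding f2_def by (rule lp_diff[OF _ f f1]) simp
  have n2: "lp_norm 1 UNIV f2 \<le> e / (K + 1)"
  proof -
    have "lp_norm 1 UNIV f2 = (\<Sum>\<^sub>\<infinity>n\<in>UNIV. cmod (f2 n))" by (rule lp_norm_1)
    also have "\<dots> \<le> (\<Sum>\<^sub>\<infinity>n\<in>UNIV - S. cmod (f n))"
    proof (rule infsum_mono_neutral)
      show "(\<lambda>n. cmod (f2 n)) summable_on UNIV" using f2 by (simp add: lp1_iff)
      show "(\<lambda>n. cmod (f n)) summable_on UNIV - S" by (rule summable_on_subset_banach[OF fs]) simp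
      show "cmod (f2 n) \<le> cmod (f n)" for n by (simp add: f2_def f1_def)
      show "cmod (f2 n) \<le> 0" if "n \<in> UNIV - (UNIV - S)" for n
        using N[of n] that by (simp add: f2_def f1_def abs_le_iff)
    qed auto
    also have "\<dots> \<le> e / (K + 1)"
    proof -
      have "(\<Sum>\<^sub>\<infinity>n\<in>S \<union> (UNIV - S). cmod (f n)) = (\<Sum>\<^sub>\<infinity>n\<in>S. cmod (f n)) + (\<Sum>\<^sub>\<infinity>n\<in>UNIV - S. cmod (f n))"
        using S(1) by (intro infsum_Un_disjoint summable_on_subset_banach[OF fs]) auto
      then have "(\<Sum>\<^sub>\<infinity>n\<in>UNIV. cmod (f n)) = (\<Sum>n\<in>S. cmod (f n)) + (\<Sum>\<^sub>\<infinity>n\<in>UNIV - S. cmod (f n))"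
        using S(1) by simp
      then show ?thesis using S(2) by (simp add: dist_real_def abs_le_iff)
    qed
    finally show ?thesis .
  qed
  have "lp_norm p UNIV (f \<star> dilate M \<phi>) \<le> lp_norm p UNIV f * lp_norm p UNIV \<phi> + e"
    if M: "M \<ge> nat (2 * N) + 1" for M
  proof -
    have M': "int M > 2 * N" "M > 0" using M by auto
    note d = dilate_l1[OF M'(2) \<phi>]
    have "f = (\<lambda>n. f1 n + f2 n)" by (simp add: f2_def)
    then have split: "f \<star> dilate M \<phi> = (\<lambda>n. (f1 \<star> dilate M \<phi>) n + (f2 \<star> dilate M \<phi>) n)"
      using int_group.convol_add_left[of f1 f2 "dilate M \<phi>"] int_l1_bounded f1 f2 d by auto
    have "lp_norm p UNIV (f1 \<star> dilate M \<phi>) = lp_norm p UNIV f1 * lp_norm p UNIV \<phi>"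
      unfolding lp_norm_def
      by (subst convol_dilate_finite_support[OF p \<phi> _ M']) (auto simp: f1_def powr_mult infsum_nonneg)
    also have "\<dots> \<le> lp_norm p UNIV f * lp_norm p UNIV \<phi>"
    proof (rule mult_right_mono[OF _ lp_norm_nonneg])
      show "lp_norm p UNIV f1 \<le> lp_norm p UNIV f"
        unfolding lp_norm_def using p lp1_subset_lp[OF f1 p] lp1_subset_lp[OF f p]
        by (intro powr_mono2 infsum_mono) (auto simp: lp_def infsum_nonneg f1_def)
    qed
    finally have b1: "lp_norm p UNIV (f1 \<star> dilate M \<phi>) \<le> lp_norm p UNIV f * lp_norm p UNIV \<phi>" .
    have "lp_norm 1 UNIV (dilate M \<phi>) = K"
      using infsumI[OF dilate_norm_powr[OF M'(2) _ \<phi>]] by (simp add: K_def lp_norm_def)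
    then have "lp_norm 1 UNIV (f2 \<star> dilate M \<phi>) \<le> lp_norm 1 UNIV f2 * K"
      using int_group.lp_norm_1_convol_le[of f2 "dilate M \<phi>"] f2 d by simp
    also have "\<dots> \<le> e / (K + 1) * K" using n2 K by (intro mult_right_mono)
    also have "\<dots> \<le> e" using K e by (simp add: field_simps)
    finally have b2: "lp_norm p UNIV (f2 \<star> dilate M \<phi>) \<le> e"
      using lp_norm_le_lp_norm_1[OF int_convol_l1[OF f2 d] p] by simp
    show ?thesis
      unfolding split using lp_norm_triangle[OF p lp1_subset_lp[OF int_convol_l1[OF f1 d] p] lp1_subset_lp[OF int_convol_l1[OF f2 d] p]] b1 b2
      by simp
  qed
  then show ?thesis by (auto simp: eventually_sequentially)
qed

text \<open>The dilates tend pointwise to the point mass at 0, since a nonzero integer is no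
  multiple of a large \<open>M\<close>; domination carries the limit through the
  convolution.\<close>

lemma convol_dilate_pointwise:
  assumes f: "f \<in> int_l1" and \<phi>: "\<phi> \<in> int_l1" and \<phi>0: "\<phi> 0 = 1"
  shows "(\<lambda>M. (f \<star> dilate M \<phi>) m) \<longlonglongrightarrow> f m"
proof -
  have fs: "(\<lambda>n. cmod (f n)) summable_on UNIV" using f by (simp add: lp1_iff)
  have "(\<lambda>M. \<Sum>\<^sub>\<infinity>y\<in>UNIV. f y * dilate M \<phi> (m - y)) \<longlonglongrightarrow> (\<Sum>\<^sub>\<infinity>y\<in>UNIV. f y * point_mass 0 (m - y))"
  proof (rule infsum_dominated_convergence)
    show "(\<lambda>y. cmod (f y) * lp_norm 1 UNIV \<phi>) summable_on UNIV" by (rule summable_on_cmult_left[OF fs])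
    show "cmod (f y * dilate M \<phi> (m - y)) \<le> cmod (f y) * lp_norm 1 UNIV \<phi>" for M y
      using norm_le_lp_norm[OF \<phi>] lp_norm_nonneg[of 1 UNIV \<phi>]
      by (auto simp: norm_mult dilate_def intro!: mult_left_mono)
    fix y
    have "\<forall>\<^sub>F M in sequentially. dilate M \<phi> (m - y) = point_mass 0 (m - y)"
    proof (cases "m = y")
      case True
      then show ?thesis by (simp add: dilate_def point_mass_def \<phi>0)
    next
      case False
      have "dilate M \<phi> (m - y) = 0" if "M \<ge> nat \<bar>m - y\<bar> + 1" for M
      proof -
        have "\<not> int M dvd m - y"
          using zdvd_imp_le[of "int M" "\<bar>m - y\<bar>"] False that by auto
        then show ?thesis by (simp add: dilate_def)
      qed
      then show ?thesis using False by (auto simp: eventually_sequentially point_mass_def)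
    qed
    then show "(\<lambda>M. f y * dilate M \<phi> (m - y)) \<longlonglongrightarrow> f y * point_mass 0 (m - y)"
      by (intro tendsto_mult tendsto_const tendsto_eventually)
  qed
  moreover have "(\<Sum>\<^sub>\<infinity>y\<in>UNIV. f y * point_mass 0 (m - y)) = (\<Sum>\<^sub>\<infinity>y\<in>{m}. f y * point_mass 0 (m - y))"
    by (rule infsum_cong_neutral) (auto simp: point_mass_def)
  ultimately show ?thesis by (simp add: int_convol_eq point_mass_def)
qed

section \<open>Infinite products of notches on the circle\<close>

section \<open>Elements of infinite order\<close>

text \<open>For the parameters of \<open>fourier_notch\<close>, these are the Fourier coefficients
  of a function that vanishes on an arc of length \<open>a - b\<close> around 0 and is 1 outside the
  arc of length \<open>a + b\<close>.\<close>

definition notch :: "real \<Rightarrow> real \<Rightarrow> int \<Rightarrow> complex" where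
  "notch a b n = point_mass 0 n - of_real (trapezoid a b n)"

lemma notch_l1:
  assumes "0 < b"
  shows "notch a b \<in> int_l1"
proof -
  have "(\<lambda>n. complex_of_real (trapezoid a b n)) \<in> int_l1"
    using trapezoid_abs_summable[OF assms] by (simp add: lp1_iff)
  then show ?thesis unfolding notch_def[abs_def] by (intro lp_diff point_mass_lp1) auto
qed

lemma fourier_point_mass: "fourier (point_mass 0) t = 1"
proof -
  have "fourier (point_mass 0) t = (\<Sum>\<^sub>\<infinity>n\<in>{0}. point_mass 0 n * cis (2 * pi * real_of_int n * t))"
    unfolding fourier_def by (rule infsum_cong_neutral) (auto simp: point_mass_def)
  then show ?thesis by (simp add: point_mass_def)
qed

lemma cis_round: "cis (2 * pi * of_int n * (t - of_int (round t))) = cis (2 * pi * of_int n * t)"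
proof -
  have "cis (2 * pi * of_int n * t) = cis (2 * pi * of_int n * (t - of_int (round t)) + 2 * pi * of_int (n * round t))"
    by (simp add: algebra_simps)
  also have "\<dots> = cis (2 * pi * of_int n * (t - of_int (round t))) * cis (2 * pi * of_int (n * round t))"
    by (rule cis_mult[symmetric])
  also have "cis (2 * pi * of_int (n * round t)) = 1" by (rule cis_multiple_2pi) (rule Ints_of_int)
  finally show ?thesis by simp
qed

text \<open>The trapezoid formula covers one period; subtracting \<open>round t\<close> brings the
  argument into it.\<close>

lemma fourier_notch:
  assumes "0 < b" "b \<le> a" "a + b \<le> 1"
  shows "fourier (notch a b) t = of_real (1 - trapezoid_fun a b (t - of_int (round t)))"
proof -
  let ?t = "t - of_int (round t)"
  have "\<bar>?t\<bar> \<le> 1/2" using of_int_round_abs_le[of t] by (simp add: abs_minus_commute)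
  from trapezoid_series[OF assms this]
  have T: "((\<lambda>n. complex_of_real (trapezoid a b n) * cis (2 * pi * of_int n * t)) has_sum of_real (trapezoid_fun a b ?t)) UNIV"
    unfolding cis_round .
  have "((\<lambda>n. point_mass 0 n * cis (2 * pi * of_int n * t)) has_sum 1) UNIV"
    using has_sum_infsum[OF fourier_summable[OF point_mass_lp1[of 0 UNIV]], of t] fourier_point_mass[of t]
    by (simp add: fourier_def)
  from has_sum_add[OF this has_sum_uminusI[OF T]]
  have "((\<lambda>n. notch a b n * cis (2 * pi * of_int n * t)) has_sum of_real (1 - trapezoid_fun a b ?t)) UNIV"
    by (simp add: notch_def left_diff_distrib)
  then show ?thesis by (simp add: fourier_def infsumI)
qed

text \<open>The narrow notch differs from 1 only within \<open>(b + s) / 2\<close> of an integer,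
  and there the wide one vanishes because \<open>(b + s) / 2 <= (a - s) / 2\<close>.\<close>

lemma fourier_notch_nested:
  assumes s: "0 < s" "s \<le> b" "b + 2 * s \<le> a" "a + s \<le> 1"
  shows "fourier (notch a s) t * fourier (notch b s) t = fourier (notch a s) t"
proof -
  let ?t = "t - of_int (round t)"
  have "trapezoid_fun b s ?t = 0 \<or> trapezoid_fun a s ?t = 1"
    using s trapezoid_fun_eq_0[of s b ?t] trapezoid_fun_eq_1[of s ?t a] by argo
  then show ?thesis using s by (auto simp: fourier_notch)
qed

text \<open>The first term is the coefficient at 0, the second bounds all others. To first order the
  loss is \<open>p * a\<close>, and the gain is of smaller order since
  \<open>p - 1 > 1\<close>.\<close>

lemma powr_sum_notch:
  assumes s: "0 < s" and a: "0 < a" "a < 1" and p: "2 < p"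
  shows "(\<Sum>\<^sub>\<infinity>n\<in>UNIV. cmod (notch a s n) powr p) \<le> (1 - a) powr p + a powr (p - 1)"
proof -
  have off: "cmod (notch a s n) = \<bar>trapezoid a s n\<bar>" if "n \<noteq> 0" for n
    using that by (simp add: notch_def point_mass_def)
  have on: "cmod (notch a s 0) = 1 - a"
  proof -
    have "notch a s 0 = of_real (1 - a)" by (simp add: notch_def point_mass_def trapezoid_def)
    then show ?thesis using a by (simp only: norm_of_real)
  qed
  have "(\<lambda>n. cmod (notch a s n) powr p) summable_on (UNIV - {0})"
    using trapezoid_powr_sum(1)[OF s a(1) _ p] a by (subst summable_on_cong[where g = "\<lambda>n. \<bar>trapezoid a s n\<bar> powr p"]) (auto simp: off)
  then have "(\<Sum>\<^sub>\<infinity>n\<in>{0} \<union> (UNIV - {0}). cmod (notch a s n) powr p)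
      = (\<Sum>\<^sub>\<infinity>n\<in>{0}. cmod (notch a s n) powr p) + (\<Sum>\<^sub>\<infinity>n\<in>UNIV - {0}. cmod (notch a s n) powr p)"
    by (intro infsum_Un_disjoint) auto
  moreover have "(\<Sum>\<^sub>\<infinity>n\<in>UNIV - {0}. cmod (notch a s n) powr p) = (\<Sum>\<^sub>\<infinity>n\<in>UNIV - {0}. \<bar>trapezoid a s n\<bar> powr p)"
    by (rule infsum_cong) (simp add: off)
  moreover have "\<dots> \<le> a powr (p - 1)" using trapezoid_powr_sum(2)[OF s a(1) _ p] a by simp
  ultimately show ?thesis by (simp add: on)
qed

text \<open>The bound \<open>s <= 1/9\<close> gives \<open>(1 - 3 * s)^2 <= 1 - 5 * s\<close>, and
  the last hypothesis makes the other term at most \<open>s\<close>.\<close>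

lemma lp_norm_notch_le:
  assumes p: "2 < p" and s: "0 < s" "s \<le> 1/9" "(3 * s) powr (p - 2) \<le> 1/3"
  shows "lp_norm p UNIV (notch (3 * s) s) \<le> exp (- (4 * s / p))"
proof -
  have "(1 - 3 * s) powr p \<le> (1 - 3 * s) powr 2" using p s by (intro powr_mono') auto
  also have "\<dots> = 1 - 6 * s + 9 * s * s" using s by (simp add: power2_eq_square algebra_simps)
  also have "9 * s * s \<le> s" using s by simp
  finally have 1: "(1 - 3 * s) powr p \<le> 1 - 5 * s" by simp
  have "(3 * s) powr (p - 1) = (3 * s) powr (p - 2) * (3 * s)" using s by (simp add: powr_diff power2_eq_square)
  also have "\<dots> \<le> 1/3 * (3 * s)" using s by (intro mult_right_mono) auto
  finally have 2: "(3 * s) powr (p - 1) \<le> s" by simp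
  have "(\<Sum>\<^sub>\<infinity>n\<in>UNIV. cmod (notch (3 * s) s n) powr p) \<le> 1 + (- (4 * s))"
    using powr_sum_notch[of s "3 * s" p] s p 1 2 by simp
  also have "\<dots> \<le> exp (- (4 * s))" by (rule exp_ge_add_one_self)
  finally have "lp_norm p UNIV (notch (3 * s) s) \<le> exp (- (4 * s)) powr (1 / p)"
    unfolding lp_norm_def using p by (intro powr_mono2) (auto simp: infsum_nonneg)
  then show ?thesis by (simp add: exp_powr_real)
qed

definition normalised_notch :: "real \<Rightarrow> int \<Rightarrow> complex" where
  "normalised_notch s n = of_real (1 / (1 - 7 * s)) * notch (7 * s) s n"

text \<open>Normalising the coefficient at 0 removes the first-order loss, so the norm exceeds 1 at
  most by a term of order \<open>s powr (p - 1)\<close>, summable for \<open>s\<close> of order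
  \<open>1/j\<close>. The bound \<open>s <= 1/14\<close> keeps \<open>1 - 7 * s\<close> above
  1/2.\<close>

lemma normalised_notch:
  assumes s: "0 < s" "s \<le> 1/14" and p: "2 < p"
  shows "normalised_notch s \<in> int_l1" "normalised_notch s 0 = 1"
    "fourier (normalised_notch s) t * fourier (notch (5 * s) s) t = fourier (normalised_notch s) t"
    "lp_norm p UNIV (normalised_notch s) \<le> exp (7 powr (p - 1) * 2 powr p * s powr (p - 1))"
proof -
  show "normalised_notch s \<in> int_l1"
    unfolding normalised_notch_def[abs_def] by (intro lp_scale notch_l1 s)
  have "notch (7 * s) s 0 = of_real (1 - 7 * s)" by (simp add: notch_def point_mass_def trapezoid_def)
  then show "normalised_notch s 0 = 1" using s by (simp add: normalised_notch_def flip: of_real_mult del: of_real_diff)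
  have F: "fourier (normalised_notch s) t = of_real (1 / (1 - 7 * s)) * fourier (notch (7 * s) s) t"
    by (simp only: fourier_def normalised_notch_def mult.assoc infsum_cmult_right')
  show "fourier (normalised_notch s) t * fourier (notch (5 * s) s) t = fourier (normalised_notch s) t"
    unfolding F mult.assoc using s by (subst fourier_notch_nested) auto
  have p1: "1 \<le> p" using p by simp
  have "(\<Sum>\<^sub>\<infinity>n\<in>UNIV. cmod (normalised_notch s n) powr p)
      = (1 / (1 - 7 * s)) powr p * (\<Sum>\<^sub>\<infinity>n\<in>UNIV. cmod (notch (7 * s) s n) powr p)"
  proof -
    have "cmod (normalised_notch s n) powr p = (1 / (1 - 7 * s)) powr p * cmod (notch (7 * s) s n) powr p" for n
    proof -
      have "cmod (normalised_notch s n) = (1 / (1 - 7 * s)) * cmod (notch (7 * s) s n)"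
        unfolding normalised_notch_def norm_mult norm_of_real using s by simp
      then show ?thesis using s by (simp only: powr_mult)
    qed
    then show ?thesis by (simp add: infsum_cmult_right')
  qed
  also have "\<dots> \<le> (1 / (1 - 7 * s)) powr p * ((1 - 7 * s) powr p + (7 * s) powr (p - 1))"
    using powr_sum_notch[of s "7 * s" p] s p by (intro mult_left_mono) auto
  also have "\<dots> = 1 + (1 / (1 - 7 * s)) powr p * (7 * s) powr (p - 1)"
    using s by (simp add: distrib_left powr_divide)
  also have "\<dots> \<le> 1 + 2 powr p * (7 * s) powr (p - 1)"
    using s p by (intro add_left_mono mult_right_mono powr_mono2) (auto simp: field_simps)
  also have "\<dots> = 1 + 7 powr (p - 1) * 2 powr p * s powr (p - 1)"
    using s by (simp add: powr_mult)
  finally have le: "(\<Sum>\<^sub>\<infinity>n\<in>UNIV. cmod (normalised_notch s n) powr p) \<le> 1 + 7 powr (p - 1) * 2 powr p * s powr (p - 1)" .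
  have "lp_norm p UNIV (normalised_notch s) \<le> (1 + 7 powr (p - 1) * 2 powr p * s powr (p - 1)) powr (1 / p)"
    unfolding lp_norm_def using p le by (intro powr_mono2) (auto simp: infsum_nonneg)
  also have "\<dots> \<le> (1 + 7 powr (p - 1) * 2 powr p * s powr (p - 1)) powr 1"
    using p by (intro powr_mono) auto
  also have "\<dots> \<le> exp (7 powr (p - 1) * 2 powr p * s powr (p - 1))" by (simp add: exp_ge_add_one_self)
  finally show "lp_norm p UNIV (normalised_notch s) \<le> exp (7 powr (p - 1) * 2 powr p * s powr (p - 1))" .
qed

text \<open>With 2 in place of 4 the exponential is already at most
  \<open>(1 + 1/n) powr (- (2 / p))\<close>; the 4 makes the inequality strict and leaves room for
  an additive error.\<close>

lemma decay_step:
  fixes n p :: real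
  assumes "0 < n" "2 < p"
  shows "exp (- (4 * (1 / n) / p)) * n powr (- (2 / p)) < (n + 1) powr (- (2 / p))"
proof -
  have "(n + 1) / n \<le> exp (1 / n)" using exp_ge_add_one_self[of "1 / n"] assms by (simp add: field_simps)
  then have "exp (1 / n) powr (- (2 / p)) \<le> ((n + 1) / n) powr (- (2 / p))"
    using assms by (intro powr_mono2') auto
  moreover have "exp (- (4 * (1 / n) / p)) < exp (1 / n) powr (- (2 / p))"
    using assms by (simp add: exp_powr_real field_simps)
  ultimately have "exp (- (4 * (1 / n) / p)) < ((n + 1) / n) powr (- (2 / p))" by simp
  then have "exp (- (4 * (1 / n) / p)) * n powr (- (2 / p)) < ((n + 1) / n) powr (- (2 / p)) * n powr (- (2 / p))"
    using assms by (intro mult_strict_right_mono) auto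
  also have "\<dots> = (n + 1) powr (- (2 / p))" using assms by (simp add: powr_divide)
  finally show ?thesis .
qed

lemma lp_norm_point_mass: "p > 0 \<Longrightarrow> g \<in> A \<Longrightarrow> lp_norm p A (point_mass g) = 1"
proof -
  assume "p > 0" "g \<in> A"
  have "(\<Sum>\<^sub>\<infinity>x\<in>A. cmod (point_mass g x) powr p) = (\<Sum>\<^sub>\<infinity>x\<in>{g}. cmod (point_mass g x) powr p)"
    using \<open>g \<in> A\<close> by (intro infsum_cong_neutral) (auto simp: point_mass_def)
  then show ?thesis by (simp add: lp_norm_def point_mass_def)
qed

text \<open>The notch widths \<open>3 * s\<close>, \<open>5 * s\<close>, \<open>7 * s\<close>
  increase by \<open>2 * s\<close>, as \<open>fourier_notch_nested\<close> demands, so the widest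
  absorbs the middle one and the middle one the narrowest. All three are dilated by the same
  \<open>M\<close>, which preserves these relations in the products.\<close>

theorem int_exhaustion_sequences:
  assumes p: "2 < p"
  obtains f c d e :: "nat \<Rightarrow> int \<Rightarrow> complex" and C :: real
  where "\<And>j. f j \<in> int_l1" "\<And>j. c j \<in> int_l1" "\<And>j. d j \<in> int_l1" "\<And>j. e j \<in> int_l1"
    "\<And>j. c (Suc j) = c j \<star> e j" "\<And>j. d j \<star> c j = c j" "\<And>i j. j \<le> i \<Longrightarrow> f i \<star> c j = f i"
    "(\<lambda>j. lp_norm p UNIV (d j)) \<longlonglongrightarrow> 0" "\<And>j. lp_norm p UNIV (f j) \<le> C"
    "f 0 0 = 1" "\<And>j m. \<bar>m\<bar> \<le> int j \<Longrightarrow> cmod (f (Suc j) m - f j m) \<le> (1/2) ^ (j + 2)"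
proof -
  have p1: "1 \<le> p" using p by simp
  \<comment> \<open>The first bound is the one of \<open>normalised_notch\<close>; the second gives
    \<open>(3 * s) powr (p - 2) <= 1/3\<close>.\<close>
  define s0 where "s0 = min (1/14) ((1/3) powr (1 / (p - 2)) / 3)"
  have s0: "s0 > 0" by (simp add: s0_def)
  obtain J :: nat where J: "1 / s0 < J" using reals_Archimedean2 by blast
  \<comment> \<open>The shift by \<open>J\<close> makes already the first width parameter at most
    \<open>s0\<close>.\<close>
  define s where "s j = 1 / (real j + J)" for j :: nat
  have J0: "real J > 0" 
  proof -
    have "0 < 1 / s0" using s0 by simp
    then show ?thesis using J by linarith
  qed
  have s: "0 < s j" "s j \<le> s0" for j
  proof -
    show "0 < s j" using J0 by (simp add: s_def)
    have "1 / s0 \<le> real j + J" using J by simp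
    then show "s j \<le> s0" using s0 J0 by (simp add: s_def field_simps)
  qed
  have s14: "s j \<le> 1/14" for j using s(2)[of j] by (simp add: s0_def)
  have s3: "(3 * s j) powr (p - 2) \<le> 1/3" for j
  proof -
    have "3 * s j \<le> (1/3) powr (1 / (p - 2))" using s(2)[of j] by (simp add: s0_def)
    then have "(3 * s j) powr (p - 2) \<le> ((1/3) powr (1 / (p - 2))) powr (p - 2)"
      using p s(1)[of j] by (intro powr_mono2) auto
    then show ?thesis using p by (simp add: powr_powr)
  qed
  define \<phi> where "\<phi> j = normalised_notch (s j)" for j
  define \<beta> where "\<beta> j = notch (5 * s j) (s j)" for j
  define \<gamma> where "\<gamma> j = notch (3 * s j) (s j)" for j
  have \<phi>: "\<phi> j \<in> int_l1" "\<phi> j 0 = 1" and \<beta>: "\<beta> j \<in> int_l1" and \<gamma>: "\<gamma> j \<in> int_l1" for j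
    unfolding \<phi>_def \<beta>_def \<gamma>_def using s(1)[of j] s14[of j] by (auto intro: normalised_notch notch_l1 p)
  have \<phi>\<beta>: "fourier (\<phi> j) t * fourier (\<beta> j) t = fourier (\<phi> j) t" for j t
    unfolding \<phi>_def \<beta>_def by (rule normalised_notch[OF s(1) s14 p])
  have \<beta>\<gamma>: "fourier (\<gamma> j) t * fourier (\<beta> j) t = fourier (\<beta> j) t" for j t
    unfolding \<gamma>_def \<beta>_def using s(1)[of j] s14[of j]
    by (subst mult.commute, intro fourier_notch_nested) auto
  define w where "w j = 7 powr (p - 1) * 2 powr p * s j powr (p - 1)" for j
  have w0: "w j \<ge> 0" for j by (simp add: w_def)
  have n\<phi>: "lp_norm p UNIV (\<phi> j) \<le> exp (w j)" for j
    unfolding \<phi>_def w_def by (rule normalised_notch[OF s(1) s14 p])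
  have n\<gamma>: "lp_norm p UNIV (\<gamma> j) \<le> exp (- (4 * s j / p))" for j
    unfolding \<gamma>_def using s14[of j] by (intro lp_norm_notch_le p s s3) simp
  define \<sigma> where "\<sigma> j = (\<Sum>i<j. w i)" for j
  \<comment> \<open>The target for the norms of \<open>d\<close>: it is 1 at \<open>j = 0\<close>,
    tends to 0, and by \<open>decay_step\<close> decreases more slowly than the norms of the
    \<open>\<gamma> j\<close> permit.\<close>
  define T where "T j = J powr (2 / p) * (real j + J) powr (- (2 / p))" for j :: nat
  have Tpos: "exp (- (4 * s j / p)) * T j < T (Suc j)" for j
  proof -
    have "exp (- (4 * s j / p)) * (real j + J) powr (- (2 / p)) < (real j + J + 1) powr (- (2 / p))"
      unfolding s_def using J0 p by (intro decay_step) auto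
    then have "J powr (2 / p) * (exp (- (4 * s j / p)) * (real j + J) powr (- (2 / p)))
        < J powr (2 / p) * (real j + J + 1) powr (- (2 / p))"
      using J0 by (intro mult_strict_left_mono) auto
    then show ?thesis by (simp add: T_def mult_ac add_ac)
  qed
  \<comment> \<open>\<open>exp (\<sigma> j)\<close> accounts for the norms of the factors
    \<open>\<phi>\<close>, and \<open>2 - (1/2)^j\<close> for the additive errors of
    \<open>lp_norm_convol_dilate\<close>.\<close>
  define P where "P j x \<longleftrightarrow> (case x of (f, c, d) \<Rightarrow> f \<in> int_l1 \<and> c \<in> int_l1 \<and> d \<in> int_l1
      \<and> lp_norm p UNIV f \<le> exp (\<sigma> j) * (2 - (1/2) ^ j) \<and> lp_norm p UNIV d \<le> T j)"
    for j and x :: "(int \<Rightarrow> complex) \<times> (int \<Rightarrow> complex) \<times> (int \<Rightarrow> complex)"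
  define Q where "Q j x y \<longleftrightarrow> (case x of (f, c, d) \<Rightarrow> \<exists>M>0. y = (f \<star> dilate M (\<phi> j), c \<star> dilate M (\<beta> j), d \<star> dilate M (\<gamma> j))
      \<and> (\<forall>m\<in>{- int j..int j}. cmod ((f \<star> dilate M (\<phi> j)) m - f m) \<le> (1/2) ^ (j + 2)))"
    for j and x y :: "(int \<Rightarrow> complex) \<times> (int \<Rightarrow> complex) \<times> (int \<Rightarrow> complex)"
  have "\<exists>X0. (\<forall>j. P j (X0 j) \<and> Q j (X0 j) (X0 (Suc j))) \<and> X0 0 = (point_mass 0, point_mass 0, point_mass 0)"
  proof -
    have P0: "P 0 (point_mass 0, point_mass 0, point_mass 0)"
      using p J0 by (simp add: P_def point_mass_lp1 lp_norm_point_mass \<sigma>_def T_def flip: powr_add)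
    have step: "\<exists>y. P (Suc j) y \<and> Q j x y" if Px: "P j x" for x j
    proof -
      obtain f c d where x: "x = (f, c, d)" by (cases x)
      have l: "f \<in> int_l1" "c \<in> int_l1" "d \<in> int_l1"
        and nf: "lp_norm p UNIV f \<le> exp (\<sigma> j) * (2 - (1/2) ^ j)" and nd: "lp_norm p UNIV d \<le> T j"
        using Px by (auto simp: P_def x)
      have "\<forall>\<^sub>F M in sequentially. lp_norm p UNIV (f \<star> dilate M (\<phi> j)) \<le> lp_norm p UNIV f * lp_norm p UNIV (\<phi> j) + (1/2) ^ Suc j"
        by (rule lp_norm_convol_dilate[OF p1 l(1) \<phi>(1)]) simp
      \<comment> \<open>The admissible error is the strict gap provided by
        \<open>Tpos\<close>.\<close>
      moreover have "\<forall>\<^sub>F M in sequentially. lp_norm p UNIV (d \<star> dilate M (\<gamma> j))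
          \<le> lp_norm p UNIV d * lp_norm p UNIV (\<gamma> j) + (T (Suc j) - exp (- (4 * s j / p)) * T j)"
        by (rule lp_norm_convol_dilate[OF p1 l(3) \<gamma>]) (use Tpos in simp)
      moreover have "\<forall>\<^sub>F M in sequentially. \<forall>m\<in>{- int j..int j}. cmod ((f \<star> dilate M (\<phi> j)) m - f m) \<le> (1/2) ^ (j + 2)"
      proof (rule eventually_ball_finite)
        show "\<forall>m\<in>{- int j..int j}. \<forall>\<^sub>F M in sequentially. cmod ((f \<star> dilate M (\<phi> j)) m - f m) \<le> (1/2) ^ (j + 2)"
        proof
          fix m
          have "\<forall>\<^sub>F M in sequentially. dist ((f \<star> dilate M (\<phi> j)) m) (f m) < (1/2) ^ (j + 2)"
            by (rule tendstoD[OF convol_dilate_pointwise[OF l(1) \<phi>]]) simp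
          then show "\<forall>\<^sub>F M in sequentially. cmod ((f \<star> dilate M (\<phi> j)) m - f m) \<le> (1/2) ^ (j + 2)"
            by eventually_elim (simp add: dist_norm)
        qed
      qed simp
      moreover have "\<forall>\<^sub>F M in sequentially. M > (0::nat)" by (rule eventually_gt_at_top)
      ultimately have "\<forall>\<^sub>F M in sequentially. M > 0
          \<and> lp_norm p UNIV (f \<star> dilate M (\<phi> j)) \<le> lp_norm p UNIV f * lp_norm p UNIV (\<phi> j) + (1/2) ^ Suc j
          \<and> lp_norm p UNIV (d \<star> dilate M (\<gamma> j)) \<le> lp_norm p UNIV d * lp_norm p UNIV (\<gamma> j) + (T (Suc j) - exp (- (4 * s j / p)) * T j)
          \<and> (\<forall>m\<in>{- int j..int j}. cmod ((f \<star> dilate M (\<phi> j)) m - f m) \<le> (1/2) ^ (j + 2))"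
        by eventually_elim blast
      then obtain M where M: "M > 0"
        "lp_norm p UNIV (f \<star> dilate M (\<phi> j)) \<le> lp_norm p UNIV f * lp_norm p UNIV (\<phi> j) + (1/2) ^ Suc j"
        "lp_norm p UNIV (d \<star> dilate M (\<gamma> j)) \<le> lp_norm p UNIV d * lp_norm p UNIV (\<gamma> j) + (T (Suc j) - exp (- (4 * s j / p)) * T j)"
        "\<forall>m\<in>{- int j..int j}. cmod ((f \<star> dilate M (\<phi> j)) m - f m) \<le> (1/2) ^ (j + 2)"
        by (metis (mono_tags, lifting) eventually_sequentially order_refl)
      have \<sigma>0: "\<sigma> (Suc j) \<ge> 0" by (simp add: \<sigma>_def sum_nonneg w0)
      have h1: "(1/2::real) ^ j \<le> 1" by (rule power_le_one) auto
      have "lp_norm p UNIV f * lp_norm p UNIV (\<phi> j) \<le> (exp (\<sigma> j) * (2 - (1/2) ^ j)) * exp (w j)"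
        using nf n\<phi>[of j] h1 by (intro mult_mono) (auto simp: lp_norm_nonneg)
      also have "\<dots> = exp (\<sigma> (Suc j)) * (2 - (1/2) ^ j)" by (simp add: \<sigma>_def exp_add)
      finally have "lp_norm p UNIV (f \<star> dilate M (\<phi> j)) \<le> exp (\<sigma> (Suc j)) * (2 - (1/2) ^ j) + 1 * (1/2) ^ Suc j"
        using M(2) by simp
      \<comment> \<open>The exponential is at least 1 and so absorbs the additive error.\<close>
      also have "\<dots> \<le> exp (\<sigma> (Suc j)) * (2 - (1/2) ^ j) + exp (\<sigma> (Suc j)) * (1/2) ^ Suc j"
        using \<sigma>0 by (intro add_left_mono mult_right_mono) auto
      also have "\<dots> = exp (\<sigma> (Suc j)) * (2 - (1/2) ^ Suc j)" by (simp add: algebra_simps)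
      finally have f': "lp_norm p UNIV (f \<star> dilate M (\<phi> j)) \<le> exp (\<sigma> (Suc j)) * (2 - (1/2) ^ Suc j)" .
      have "lp_norm p UNIV d * lp_norm p UNIV (\<gamma> j) \<le> T j * exp (- (4 * s j / p))"
        using nd n\<gamma>[of j] order_trans[OF lp_norm_nonneg nd] by (intro mult_mono) (auto simp: lp_norm_nonneg)
      then have d': "lp_norm p UNIV (d \<star> dilate M (\<gamma> j)) \<le> T (Suc j)" using M(3) by (simp add: mult.commute)
      note dl = dilate_l1[OF M(1)]
      have "P (Suc j) (f \<star> dilate M (\<phi> j), c \<star> dilate M (\<beta> j), d \<star> dilate M (\<gamma> j))"
        unfolding P_def prod.case by (intro conjI int_convol_l1 l dl \<phi> \<beta> \<gamma> f' d')
      moreover have "Q j x (f \<star> dilate M (\<phi> j), c \<star> dilate M (\<beta> j), d \<star> dilate M (\<gamma> j))"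
        unfolding Q_def x prod.case using M(1,4) by blast
      ultimately show ?thesis by blast
    qed
    have "\<exists>y. (P j x \<longrightarrow> P (Suc j) y \<and> Q j x y)" for j x using step by blast
    then obtain nxt where nxt: "\<And>j x. P j x \<Longrightarrow> P (Suc j) (nxt j x) \<and> Q j x (nxt j x)" by metis
    \<comment> \<open>Recursion along a chosen step function fixes the initial value, on which
      \<open>F0\<close> and the value of \<open>f 0\<close> at 0 depend.\<close>
    define X0 where "X0 = rec_nat (point_mass 0, point_mass 0, point_mass 0) nxt"
    have "P j (X0 j)" for j by (induction j) (use P0 nxt in \<open>auto simp: X0_def\<close>)
    then show ?thesis using nxt by (intro exI[of _ X0]) (auto simp: X0_def)
  qed
  then obtain X0 where PX: "\<And>j. P j (X0 j)" and QX: "\<And>j. Q j (X0 j) (X0 (Suc j))"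
    and X00: "X0 0 = (point_mass 0, point_mass 0, point_mass 0)" by blast
  define f where "f j = fst (X0 j)" for j
  define c where "c j = fst (snd (X0 j))" for j
  define d where "d j = snd (snd (X0 j))" for j
  have X0: "X0 j = (f j, c j, d j)" for j by (simp add: f_def c_def d_def)
  have l: "f j \<in> int_l1" "c j \<in> int_l1" "d j \<in> int_l1" "lp_norm p UNIV (f j) \<le> exp (\<sigma> j) * (2 - (1/2) ^ j)"
    "lp_norm p UNIV (d j) \<le> T j" for j
    using PX[of j] by (simp_all add: P_def X0)
  have "\<forall>j. \<exists>M>0. f (Suc j) = f j \<star> dilate M (\<phi> j) \<and> c (Suc j) = c j \<star> dilate M (\<beta> j) \<and> d (Suc j) = d j \<star> dilate M (\<gamma> j)
      \<and> (\<forall>m\<in>{- int j..int j}. cmod (f (Suc j) m - f j m) \<le> (1/2) ^ (j + 2))"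
    using QX unfolding Q_def X0 prod.case prod.inject by metis
  then obtain M where M: "\<And>j. M j > 0" "\<And>j. f (Suc j) = f j \<star> dilate (M j) (\<phi> j)"
    "\<And>j. c (Suc j) = c j \<star> dilate (M j) (\<beta> j)" "\<And>j. d (Suc j) = d j \<star> dilate (M j) (\<gamma> j)"
    "\<And>j m. m \<in> {- int j..int j} \<Longrightarrow> cmod (f (Suc j) m - f j m) \<le> (1/2) ^ (j + 2)"
    by metis
  note dl = dilate_l1[OF M(1)]
  have Ff: "fourier (f (Suc j)) t = fourier (f j) t * fourier (\<phi> j) (M j * t)"
    and Fc: "fourier (c (Suc j)) t = fourier (c j) t * fourier (\<beta> j) (M j * t)"
    and Fd: "fourier (d (Suc j)) t = fourier (d j) t * fourier (\<gamma> j) (M j * t)" for j and t :: real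
    unfolding M(2-4) by (simp_all add: fourier_convol l dl \<phi> \<beta> \<gamma> fourier_dilate M(1))
  have F0: "fourier (f 0) t = 1" "fourier (c 0) t = 1" "fourier (d 0) t = 1" for t
    using X00 by (simp_all add: f_def c_def d_def fourier_point_mass)
  \<comment> \<open>The convolution identities are verified for each \<open>t\<close> on the Fourier
    side and brought back by \<open>fourier_inject\<close>.\<close>
  have Fdc: "fourier (d j) t * fourier (c j) t = fourier (c j) t" for j t
  proof (induction j)
    case (Suc j)
    have "fourier (d (Suc j)) t * fourier (c (Suc j)) t
        = (fourier (d j) t * fourier (c j) t) * (fourier (\<gamma> j) (M j * t) * fourier (\<beta> j) (M j * t))"
      by (simp add: Fd Fc mult_ac)
    then show ?case unfolding Suc \<beta>\<gamma> by (simp add: Fc)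
  qed (simp add: F0)
  have Ffc: "fourier (f i) t * fourier (c j) t = fourier (f i) t" if "j \<le> i" for i j t
    using that
  proof (induction i arbitrary: j)
    case (Suc i)
    show ?case
    proof (cases "j = Suc i")
      case True
      have "fourier (f (Suc i)) t * fourier (c (Suc i)) t
          = (fourier (f i) t * fourier (c i) t) * (fourier (\<phi> i) (M i * t) * fourier (\<beta> i) (M i * t))"
        by (simp add: Ff Fc mult_ac)
      then show ?thesis using Suc.IH[of i] by (simp add: True \<phi>\<beta> Ff)
    next
      case False
      then have IH: "fourier (f i) t * fourier (c j) t = fourier (f i) t" using Suc by simp
      have "fourier (f (Suc i)) t * fourier (c j) t = (fourier (f i) t * fourier (c j) t) * fourier (\<phi> i) (M i * t)"
        by (simp add: Ff)
      then show ?thesis unfolding IH Ff .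
    qed
  qed (simp add: F0)
  show thesis
  proof (rule that[of f c d "\<lambda>j. dilate (M j) (\<beta> j)" "exp (suminf w) * 2"])
    show "d j \<star> c j = c j" for j
      by (rule fourier_inject) (simp_all add: int_convol_l1 l fourier_convol Fdc)
    show "f i \<star> c j = f i" if "j \<le> i" for i j
      by (rule fourier_inject) (simp_all add: int_convol_l1 l fourier_convol Ffc[OF that])
    show "(\<lambda>j. lp_norm p UNIV (d j)) \<longlonglongrightarrow> 0"
    proof (rule tendsto_sandwich[where f = "\<lambda>_. 0" and h = T])
      have "filterlim (\<lambda>j. real j + J) at_top sequentially"
        by (rule filterlim_at_top_mono[OF filterlim_real_sequentially]) simp
      then have "(\<lambda>j. (real j + J) powr (- (2 / p))) \<longlonglongrightarrow> 0"
        using p by (intro tendsto_neg_powr) auto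
      then have "(\<lambda>j. J powr (2 / p) * (real j + J) powr (- (2 / p))) \<longlonglongrightarrow> J powr (2 / p) * 0"
        by (intro tendsto_mult tendsto_const)
      then show "T \<longlonglongrightarrow> 0" by (simp add: T_def[abs_def])
    qed (use l in \<open>auto simp: lp_norm_nonneg\<close>)
    have "summable (\<lambda>j. real (j + J) powr (- (p - 1)))"
      using p by (intro summable_ignore_initial_segment) (simp add: summable_real_powr_iff)
    then have "summable (\<lambda>j. 7 powr (p - 1) * 2 powr p * (real (j + J) powr (- (p - 1))))" by (rule summable_mult)
    moreover have "7 powr (p - 1) * 2 powr p * (real (j + J) powr (- (p - 1))) = w j" for j
    proof -
      have "s j powr (p - 1) = 1 / real (j + J) powr (p - 1)" by (simp add: s_def powr_divide)
      then show ?thesis by (simp only: w_def powr_minus_divide)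
    qed
    ultimately have sw: "summable w" by (simp only:)
    show "lp_norm p UNIV (f j) \<le> exp (suminf w) * 2" for j
    proof -
      have "\<sigma> j \<le> suminf w" unfolding \<sigma>_def using sw w0 by (intro sum_le_suminf) auto
      then have "exp (\<sigma> j) * (2 - (1/2) ^ j) \<le> exp (suminf w) * 2"
        using power_le_one[of "1/2::real" j] by (intro mult_mono) auto
      then show ?thesis using l(4)[of j] by simp
    qed
    show "f 0 0 = 1" using X00 by (simp add: f_def point_mass_def)
    show "cmod (f (Suc j) m - f j m) \<le> (1/2) ^ (j + 2)" if "\<bar>m\<bar> \<le> int j" for j m
      using that by (intro M(5)) auto
  qed (use l M dl \<beta> in auto)
qed

section \<open>Transfer from the integers to an infinite cyclic subgroup\<close>

definition pushforward :: "('i \<Rightarrow> 'a) \<Rightarrow> ('i \<Rightarrow> complex) \<Rightarrow> 'a \<Rightarrow> complex" where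
  "pushforward h a g = (if g \<in> range h then a (inv_into UNIV h g) else 0)"

lemma pushforward_apply: "inj h \<Longrightarrow> pushforward h a (h n) = a n"
  by (simp add: pushforward_def)

lemma has_sum_pushforward:
  assumes h: "inj h" "range h \<subseteq> A" and z: "\<And>g. g \<in> A - range h \<Longrightarrow> F g = 0"
  shows "(F has_sum S) A \<longleftrightarrow> ((\<lambda>n. F (h n)) has_sum S) UNIV"
proof -
  have "(F has_sum S) A \<longleftrightarrow> (F has_sum S) (range h)"
    by (rule has_sum_cong_neutral) (use h z in auto)
  then show ?thesis using has_sum_reindex[OF h(1), of F S] by (simp add: comp_def)
qed

lemma infsum_pushforward:
  assumes "inj h" "range h \<subseteq> A" "\<And>g. g \<in> A - range h \<Longrightarrow> F g = 0"
  shows "infsum F A = (\<Sum>\<^sub>\<infinity>n\<in>UNIV. F (h n))"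
proof -
  have "infsum F A = infsum F (range h)" using assms by (intro infsum_cong_neutral) auto
  then show ?thesis using infsum_reindex[OF assms(1), of F] by (simp add: comp_def)
qed

lemma pushforward_lp:
  assumes h: "inj h" "range h \<subseteq> A"
  shows "a \<in> lp p UNIV \<Longrightarrow> pushforward h a \<in> lp p A"
    and "lp_norm p A (pushforward h a) = lp_norm p UNIV a"
proof -
  have e: "((\<lambda>g. cmod (pushforward h a g) powr p) has_sum S) A \<longleftrightarrow> ((\<lambda>n. cmod (a n) powr p) has_sum S) UNIV" for S
    using has_sum_pushforward[OF h, of "\<lambda>g. cmod (pushforward h a g) powr p" S]
    by (simp add: pushforward_apply[OF h(1)]) (simp add: pushforward_def)
  show "pushforward h a \<in> lp p A" if "a \<in> lp p UNIV"
    using that e h(2) by (auto simp: lp_def summable_on_def pushforward_def)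
  show "lp_norm p A (pushforward h a) = lp_norm p UNIV a"
    using infsum_pushforward[OF h, of "\<lambda>g. cmod (pushforward h a g) powr p"]
    by (simp add: lp_norm_def pushforward_apply[OF h(1)]) (simp add: pushforward_def)
qed

context group
begin

lemma int_pow_inj:
  assumes x: "x \<in> carrier G" and ord: "\<And>n::nat. 0 < n \<Longrightarrow> x [^] n \<noteq> \<one>"
  shows "inj (\<lambda>n::int. x [^] n)"
proof (rule injI)
  have aux: "\<not> x [^] m = x [^] n" if "m < n" for m n :: int
  proof
    assume "x [^] m = x [^] n"
    then have "x [^] (n - m) = \<one>" using x by (simp add: int_pow_diff)
    then have "x [^] nat (n - m) = \<one>" using that by (simp flip: int_pow_int)
    then show False using ord[of "nat (n - m)"] that by simp
  qed
  show "m = n" if "x [^] m = x [^] n" for m n :: int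
    using aux[of m n] aux[of n m] that by force
qed

text \<open>Functions carried by the cyclic subgroup convolve as on the integers; off the subgroup
  the result is 0, because \<open>inv (h n) \<otimes> g\<close> stays outside together with
  \<open>g\<close>.\<close>

lemma convol_pushforward:
  assumes x: "x \<in> carrier G" and inj: "inj (\<lambda>n::int. x [^] n)"
  defines "h \<equiv> \<lambda>n::int. x [^] n"
  shows "convol G (pushforward h a) (pushforward h b) = pushforward h (a \<star> b)"
proof
  fix g
  have h: "inj h" "range h \<subseteq> carrier G" using inj x by (auto simp: h_def)
  have diff: "inv (h n) \<otimes> h m = h (m - n)" for m n
    using x by (simp add: h_def flip: int_pow_neg int_pow_mult)
  have mult: "h n \<otimes> h m = h (n + m)" for m n
    using x by (simp add: h_def int_pow_mult)
  show "convol G (pushforward h a) (pushforward h b) g = pushforward h (a \<star> b) g"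
  proof (cases "g \<in> carrier G")
    case g: True
    have "convol G (pushforward h a) (pushforward h b) g
        = (\<Sum>\<^sub>\<infinity>n\<in>UNIV. pushforward h a (h n) * pushforward h b (inv (h n) \<otimes> g))"
      using g by (subst infsum_pushforward[OF h, symmetric]) (auto simp: convol_def pushforward_def)
    also have "\<dots> = (\<Sum>\<^sub>\<infinity>n\<in>UNIV. a n * pushforward h b (inv (h n) \<otimes> g))"
      by (simp add: pushforward_apply[OF h(1)])
    also have "\<dots> = pushforward h (a \<star> b) g"
    proof (cases "g \<in> range h")
      case True
      then obtain m where "g = h m" by blast
      then show ?thesis by (simp add: diff pushforward_apply[OF h(1)] int_convol_eq)
    next
      case False
      have "pushforward h b (inv (h n) \<otimes> g) = 0" for n
      proof -
        have "inv (h n) \<otimes> g \<notin> range h"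
        proof
          assume "inv (h n) \<otimes> g \<in> range h"
          then obtain m where m: "inv (h n) \<otimes> g = h m" by blast
          have "g = h n \<otimes> (inv (h n) \<otimes> g)" using g h(2) by (intro mult_inv_cancel[symmetric]) auto
          then have "g = h (n + m)" by (simp add: m mult)
          then show False using False by blast
        qed
        then show ?thesis by (simp add: pushforward_def)
      qed
      then show ?thesis using False by (simp add: pushforward_def)
    qed
    finally show ?thesis .
  next
    case False
    then show ?thesis using h(2) by (auto simp: convol_def pushforward_def)
  qed
qed

theorem exhaustion_of_infinite_order:
  assumes x: "x \<in> carrier G" and ord: "\<And>n::nat. 0 < n \<Longrightarrow> x [^] n \<noteq> \<one>" and p: "2 < p"
  shows "\<exists>F E. closed_invariant_subspace G p F \<and> F \<noteq> {\<lambda>_. 0}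
           \<and> invariant_exhaustion G p E \<and> (\<forall>i. E i \<inter> F = {\<lambda>_. 0})"
proof -
  have p1: "1 \<le> p" using p by simp
  define h where "h = (\<lambda>n::int. x [^] n)"
  have inj: "inj h" unfolding h_def by (rule int_pow_inj[OF x ord])
  have h: "inj h" "range h \<subseteq> carrier G" using inj x by (auto simp: h_def)
  have conv: "convol G (pushforward h a) (pushforward h b) = pushforward h (a \<star> b)" for a b
    using convol_pushforward[OF x] inj unfolding h_def .
  show ?thesis
  proof (rule int_exhaustion_sequences[OF p])
    fix f c d e :: "nat \<Rightarrow> int \<Rightarrow> complex" and C :: real
    assume fcd: "\<And>j. f j \<in> int_l1" "\<And>j. c j \<in> int_l1" "\<And>j. d j \<in> int_l1" "\<And>j. e j \<in> int_l1"
      and step: "\<And>j. c (Suc j) = c j \<star> e j" and dc: "\<And>j. d j \<star> c j = c j" and fc: "\<And>i j. j \<le> i \<Longrightarrow> f i \<star> c j = f i"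
      and d0: "(\<lambda>j. lp_norm p UNIV (d j)) \<longlonglongrightarrow> 0" and C: "\<And>j. lp_norm p UNIV (f j) \<le> C"
      and f00: "f 0 0 = 1" and inc: "\<And>j m. \<bar>m\<bar> \<le> int j \<Longrightarrow> cmod (f (Suc j) m - f j m) \<le> (1/2) ^ (j + 2)"
    have "convergent (\<lambda>j. f j m)" for m
    proof (rule convergent_of_summable_increments)
      fix j assume "nat \<bar>m\<bar> \<le> j"
      then have "cmod (f (Suc j) m - f j m) \<le> (1/2) ^ (j + 2)" by (intro inc) simp
      also have "\<dots> \<le> (1/2) ^ j" by (intro power_decreasing) auto
      finally show "cmod (f (Suc j) m - f j m) \<le> (1/2) ^ j" .
    qed
    then have lim: "(\<lambda>j. f j m) \<longlonglongrightarrow> lim (\<lambda>j. f j m)" for m by (simp add: convergent_LIMSEQ_iff)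
    define \<eta> where "\<eta> m = lim (\<lambda>j. f j m)" for m
    \<comment> \<open>The increments at 0 sum to at most 1/2, so the limit cannot reach 0 from the
      starting value 1.\<close>
    have close: "cmod (f j 0 - 1) \<le> 1/2 - (1/2) ^ Suc j" for j
    proof (induction j)
      case (Suc j)
      have "cmod (f (Suc j) 0 - 1) \<le> cmod (f (Suc j) 0 - f j 0) + cmod (f j 0 - 1)"
        using norm_triangle_ineq[of "f (Suc j) 0 - f j 0" "f j 0 - 1"] by simp
      then show ?case using Suc inc[of 0 j] by simp
    qed (simp add: f00)
    have "cmod (\<eta> 0 - 1) \<le> 1/2"
    proof (rule Lim_bounded)
      show "(\<lambda>j. cmod (f j 0 - 1)) \<longlonglongrightarrow> cmod (\<eta> 0 - 1)"
        unfolding \<eta>_def by (intro tendsto_intros lim)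
      show "\<forall>j\<ge>0. cmod (f j 0 - 1) \<le> 1/2"
      proof (intro allI impI)
        show "cmod (f j 0 - 1) \<le> 1/2" for j using close[of j] zero_le_power[of "1/2::real" "Suc j"] by linarith
      qed
    qed
    then have \<eta>0: "\<eta> 0 \<noteq> 0" by auto
    let ?P = "pushforward h"
    note lp1 = pushforward_lp(1)[OF h]
    show ?thesis
    proof (rule exhaustion_of_convolvers[OF p1, where c = "\<lambda>j. ?P (c j)" and d = "\<lambda>j. ?P (d j)"
          and e = "\<lambda>j. ?P (e j)" and f = "\<lambda>j. ?P (f j)" and \<eta> = "?P \<eta>" and C = C and ?x0.0 = "h 0"])
      show "?P (c (Suc j)) = convol G (?P (c j)) (?P (e j))" for j by (simp only: conv step)
      show "convol G (?P (d j)) (?P (c j)) = ?P (c j)" for j by (simp only: conv dc)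
      show "convol G (?P (f i)) (?P (c j)) = ?P (f i)" if "j \<le> i" for i j by (simp only: conv fc[OF that])
      show "(\<lambda>j. ?P (f j) g) \<longlonglongrightarrow> ?P \<eta> g" for g
        by (simp add: pushforward_def \<eta>_def lim)
      show "?P \<eta> (h 0) \<noteq> 0" by (simp add: pushforward_apply[OF inj] \<eta>0)
      show "?P (f j) \<in> lp p (carrier G)" for j by (rule lp1[OF lp1_subset_lp[OF fcd(1) p1]])
    qed (simp_all add: lp1 fcd pushforward_lp(2)[OF h] d0 C)
  qed
qed

end

section \<open>The alternative for infinite elementary amenable groups\<close>

section \<open>Infinite elementary amenable groups\<close>

text \<open>The pair stands for \<open>H / K\<close>; in this way all subquotients are handled
  inside one group.\<close>

definition subquotient :: "('a, 'm) monoid_scheme \<Rightarrow> 'a set \<Rightarrow> 'a set \<Rightarrow> bool" where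
  "subquotient G H K \<longleftrightarrow> subgroup H G \<and> subgroup K G \<and> K \<subseteq> H
     \<and> (\<forall>h\<in>H. \<forall>k\<in>K. h \<otimes>\<^bsub>G\<^esub> k \<otimes>\<^bsub>G\<^esub> inv\<^bsub>G\<^esub> h \<in> K)"

text \<open>Finiteness of the image of \<open>M\<close> among the cosets of \<open>K\<close>;
  \<open>M\<close> may be any set, since it will also be applied to the sets \<open>L\<close>
  below.\<close>

definition finitely_many_cosets :: "('a, 'm) monoid_scheme \<Rightarrow> 'a set \<Rightarrow> 'a set \<Rightarrow> bool" where
  "finitely_many_cosets G K M \<longleftrightarrow>
     (\<exists>T. finite T \<and> T \<subseteq> M \<and> (\<forall>x\<in>M. \<exists>t\<in>T. x \<otimes>\<^bsub>G\<^esub> inv\<^bsub>G\<^esub> t \<in> K))"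

definition locally_finite_over :: "('a, 'm) monoid_scheme \<Rightarrow> 'a set \<Rightarrow> 'a set \<Rightarrow> 'a set \<Rightarrow> bool" where
  "locally_finite_over G H K L \<longleftrightarrow> (\<forall>S. finite S \<longrightarrow> S \<subseteq> L \<longrightarrow>
     (\<exists>M. subgroup M G \<and> S \<subseteq> M \<and> K \<subseteq> M \<and> M \<subseteq> H \<and> finitely_many_cosets G K M))"

text \<open>The trichotomy for \<open>H / K\<close>. The third alternative concerns a subset
  \<open>L\<close> rather than a subgroup, which is easier to carry along homomorphisms.\<close>

definition tame :: "('a, 'm) monoid_scheme \<Rightarrow> 'a set \<Rightarrow> 'a set \<Rightarrow> bool" where
  "tame G H K \<longleftrightarrow> finitely_many_cosets G K H
     \<or> (\<exists>x\<in>H. \<forall>n::nat. 0 < n \<longrightarrow> x [^]\<^bsub>G\<^esub> n \<notin> K)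
     \<or> (\<exists>L\<subseteq>H. \<not> finitely_many_cosets G K L \<and> locally_finite_over G H K L)"

text \<open>An element of infinite order in a group says nothing about its subgroups and quotients;
  quantifying over all subquotients makes the class closed under both.\<close>

definition tame_group :: "('a, 'm) monoid_scheme \<Rightarrow> bool" where
  "tame_group G \<longleftrightarrow> group G \<and> (\<forall>H K. subquotient G H K \<longrightarrow> tame G H K)"

lemma tame_finite: "finitely_many_cosets G K H \<Longrightarrow> tame G H K"
  by (simp add: tame_def)

lemma tame_order: "x \<in> H \<Longrightarrow> (\<And>n::nat. 0 < n \<Longrightarrow> x [^]\<^bsub>G\<^esub> n \<notin> K) \<Longrightarrow> tame G H K"
  by (auto simp: tame_def)

lemma tame_locally_finite:
  "L \<subseteq> H \<Longrightarrow> \<not> finitely_many_cosets G K L \<Longrightarrow> locally_finite_over G H K L \<Longrightarrow> tame G H K"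
  by (auto simp: tame_def)

lemma finitely_many_cosetsE:
  assumes "finitely_many_cosets G K M"
  obtains T where "finite T" "T \<subseteq> M" "\<And>x. x \<in> M \<Longrightarrow> \<exists>t\<in>T. x \<otimes>\<^bsub>G\<^esub> inv\<^bsub>G\<^esub> t \<in> K"
  using assms unfolding finitely_many_cosets_def by blast

lemma locally_finite_overE:
  assumes "locally_finite_over G H K L" "finite S" "S \<subseteq> L"
  obtains M where "subgroup M G" "S \<subseteq> M" "K \<subseteq> M" "M \<subseteq> H" "finitely_many_cosets G K M"
  using assms(1)[unfolded locally_finite_over_def, rule_format, OF assms(2,3)]
  by (elim exE conjE) (rule that)

lemma finitely_many_cosets_change:
  assumes "finitely_many_cosets G K M"
    and "\<And>x y. x \<in> M \<Longrightarrow> y \<in> M \<Longrightarrow> x \<otimes>\<^bsub>G\<^esub> inv\<^bsub>G\<^esub> y \<in> K \<Longrightarrow> x \<otimes>\<^bsub>G'\<^esub> inv\<^bsub>G'\<^esub> y \<in> K'"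
  shows "finitely_many_cosets G' K' M"
proof -
  obtain T where T: "finite T" "T \<subseteq> M" "\<And>x. x \<in> M \<Longrightarrow> \<exists>t\<in>T. x \<otimes>\<^bsub>G\<^esub> inv\<^bsub>G\<^esub> t \<in> K"
    using assms(1) unfolding finitely_many_cosets_def by blast
  have "\<exists>t\<in>T. x \<otimes>\<^bsub>G'\<^esub> inv\<^bsub>G'\<^esub> t \<in> K'" if "x \<in> M" for x
    using T(2) T(3)[OF that] assms(2)[OF that] by blast
  then show ?thesis using T(1,2) unfolding finitely_many_cosets_def by blast
qed

context group
begin

text \<open>Representatives may be sought anywhere in the group: each useful one is exchanged for an
  element of \<open>M\<close> in the same coset.\<close>

lemma finitely_many_cosetsI:
  assumes K: "subgroup K G" and M: "M \<subseteq> carrier G" and T: "finite T" "T \<subseteq> carrier G"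
    and cov: "\<And>x. x \<in> M \<Longrightarrow> \<exists>t\<in>T. x \<otimes> inv t \<in> K"
  shows "finitely_many_cosets G K M"
proof -
  define c where "c t = (SOME x. x \<in> M \<and> x \<otimes> inv t \<in> K)" for t
  define T' where "T' = c ` {t \<in> T. \<exists>x\<in>M. x \<otimes> inv t \<in> K}"
  have c: "c t \<in> M \<and> c t \<otimes> inv t \<in> K" if "\<exists>x\<in>M. x \<otimes> inv t \<in> K" for t
    using that unfolding c_def Bex_def by (rule someI_ex)
  have "\<exists>t\<in>T'. x \<otimes> inv t \<in> K" if x: "x \<in> M" for x
  proof -
    obtain t where t: "t \<in> T" "x \<otimes> inv t \<in> K" using cov[OF x] by (elim bexE)
    have ex: "\<exists>x\<in>M. x \<otimes> inv t \<in> K" using t(2) x by (intro bexI[of _ x])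
    have ct: "c t \<in> M" "c t \<otimes> inv t \<in> K" using c[OF ex] by auto
    have car: "x \<in> carrier G" "t \<in> carrier G" "c t \<in> carrier G"
      using subsetD[OF M x] subsetD[OF T(2) t(1)] subsetD[OF M ct(1)] .
    have "(x \<otimes> inv t) \<otimes> inv (c t \<otimes> inv t) \<in> K"
      by (intro subgroup.m_closed[OF K t(2)] subgroup.m_inv_closed[OF K] ct(2))
    moreover have "(x \<otimes> inv t) \<otimes> inv (c t \<otimes> inv t) = x \<otimes> inv (c t)"
      using car by (simp add: inv_mult_group m_assoc inv_mult_cancel)
    ultimately have "x \<otimes> inv (c t) \<in> K" by simp
    moreover have "c t \<in> T'" using t(1) ex by (simp add: T'_def)
    ultimately show ?thesis by (rule bexI)
  qed
  moreover have "T' \<subseteq> M"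
    unfolding T'_def by (intro image_subsetI) (use c in simp)
  moreover have "finite T'" using T by (simp add: T'_def)
  ultimately show ?thesis unfolding finitely_many_cosets_def by (intro exI[of _ T'] conjI ballI) simp_all
qed

text \<open>\<open>M / (K \<inter> M)\<close> is isomorphic to \<open>M K / K\<close>; the product
  set is a subgroup because \<open>H\<close> normalises \<open>K\<close>.\<close>

lemma subquotient_product:
  assumes HK: "subquotient G H K" and M: "subgroup M G" "M \<subseteq> H"
    and fin: "finitely_many_cosets G (K \<inter> M) M"
  shows "\<exists>P. subgroup P G \<and> M \<subseteq> P \<and> K \<subseteq> P \<and> P \<subseteq> H \<and> finitely_many_cosets G K P"
proof -
  have H: "subgroup H G" and K: "subgroup K G" and KH: "K \<subseteq> H"
    and conj: "\<And>h k. h \<in> H \<Longrightarrow> k \<in> K \<Longrightarrow> h \<otimes> k \<otimes> inv h \<in> K"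
    using HK by (auto simp: subquotient_def)
  note Hc = subgroup.mem_carrier[OF H] and Kc = subgroup.mem_carrier[OF K]
    and Mc = subgroup.mem_carrier[OF M(1)]
  let ?P = "{m \<otimes> k |m k. m \<in> M \<and> k \<in> K}"
  have Pc: "?P \<subseteq> carrier G" using Mc Kc by auto
  have "subgroup ?P G"
  proof (rule subgroupI[OF Pc])
    show "?P \<noteq> {}" using subgroup.one_closed[OF K] subgroup.one_closed[OF M(1)] by blast
    fix a assume "a \<in> ?P"
    then obtain m k where a: "a = m \<otimes> k" "m \<in> M" "k \<in> K" by blast
    have "inv a = inv m \<otimes> (m \<otimes> inv k \<otimes> inv m)"
      using a Mc Kc by (simp add: inv_mult_group m_assoc inv_mult_cancel)
    moreover have "m \<otimes> inv k \<otimes> inv m \<in> K"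
      using a M by (intro conj subgroup.m_inv_closed[OF K]) auto
    ultimately show "inv a \<in> ?P" using subgroup.m_inv_closed[OF M(1) a(2)] by blast
    fix b assume "b \<in> ?P"
    then obtain m' k' where b: "b = m' \<otimes> k'" "m' \<in> M" "k' \<in> K" by blast
    have im: "inv m' \<in> M" using b subgroup.m_inv_closed[OF M(1)] by blast
    have "a \<otimes> b = (m \<otimes> m') \<otimes> ((inv m' \<otimes> k \<otimes> inv (inv m')) \<otimes> k')"
      using a b Mc Kc by (simp add: m_assoc mult_inv_cancel)
    moreover have "(inv m' \<otimes> k \<otimes> inv (inv m')) \<otimes> k' \<in> K"
      using a b im M by (intro subgroup.m_closed[OF K] conj) auto
    ultimately show "a \<otimes> b \<in> ?P" using subgroup.m_closed[OF M(1) a(2) b(2)] by blast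
  qed
  moreover have "M \<subseteq> ?P"
  proof
    fix m assume "m \<in> M"
    then show "m \<in> ?P" using subgroup.one_closed[OF K] Mc by (intro CollectI exI[of _ m] exI[of _ \<one>]) auto
  qed
  moreover have "K \<subseteq> ?P"
  proof
    fix k assume "k \<in> K"
    then show "k \<in> ?P" using subgroup.one_closed[OF M(1)] Kc by (intro CollectI exI[of _ \<one>] exI[of _ k]) auto
  qed
  moreover have "?P \<subseteq> H" using subgroup.m_closed[OF H] M(2) KH by blast
  moreover have "finitely_many_cosets G K ?P"
  proof -
    obtain T where T: "finite T" "T \<subseteq> M" "\<And>x. x \<in> M \<Longrightarrow> \<exists>t\<in>T. x \<otimes> inv t \<in> K \<inter> M"
      using fin unfolding finitely_many_cosets_def by blast
    show ?thesis
    proof (rule finitely_many_cosetsI[OF K Pc T(1)])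
      show "T \<subseteq> carrier G" using T Mc by blast
      fix x assume "x \<in> ?P"
      then obtain m k where x: "x = m \<otimes> k" "m \<in> M" "k \<in> K" by blast
      obtain t where t: "t \<in> T" "m \<otimes> inv t \<in> K" using T(3)[OF x(2)] by blast
      have tc: "t \<in> carrier G" using t T Mc by blast
      have "x \<otimes> inv t = (m \<otimes> k \<otimes> inv m) \<otimes> (m \<otimes> inv t)"
        using x Mc Kc tc by (simp add: m_assoc inv_mult_cancel)
      moreover have "(m \<otimes> k \<otimes> inv m) \<otimes> (m \<otimes> inv t) \<in> K"
        using x M(2) by (intro subgroup.m_closed[OF K _ t(2)] conj) auto
      ultimately show "\<exists>t\<in>T. x \<otimes> inv t \<in> K" using t(1) by (intro bexI[of _ t]) simp_all
    qed
  qed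
  ultimately show ?thesis by blast
qed

lemma subquotient_Int:
  assumes "subquotient G H K" "subgroup N G"
  shows "subquotient G (H \<inter> N) (K \<inter> N)"
  using assms unfolding subquotient_def
  by (auto intro: subgroups_Inter_pair subgroup.m_closed subgroup.m_inv_closed)

text \<open>Finite subgroups of \<open>(H \<inter> N) / (K \<inter> N)\<close> have finite images in
  \<open>H / K\<close>, by \<open>subquotient_product\<close>.\<close>

lemma locally_finite_over_Int:
  assumes HK: "subquotient G H K" and N: "subgroup N G"
    and L: "L \<subseteq> H \<inter> N" "locally_finite_over G (H \<inter> N) (K \<inter> N) L"
  shows "locally_finite_over G H K L"
  unfolding locally_finite_over_def
proof (intro allI impI)
  fix S assume "finite S" "S \<subseteq> L"
  then obtain M where M: "subgroup M G" "S \<subseteq> M" "K \<inter> N \<subseteq> M" "M \<subseteq> H \<inter> N" "finitely_many_cosets G (K \<inter> N) M"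
    using L unfolding locally_finite_over_def by blast
  have "finitely_many_cosets G (K \<inter> M) M"
    by (rule finitely_many_cosets_change[OF M(5)])
      (use M in \<open>auto intro: subgroup.m_closed subgroup.m_inv_closed\<close>)
  then obtain P where "subgroup P G" "M \<subseteq> P" "K \<subseteq> P" "P \<subseteq> H" "finitely_many_cosets G K P"
    using subquotient_product[OF HK M(1)] M(4) by blast
  then show "\<exists>M. subgroup M G \<and> S \<subseteq> M \<and> K \<subseteq> M \<and> M \<subseteq> H \<and> finitely_many_cosets G K M"
    using M(2) by blast
qed

text \<open>\<open>(H \<inter> N) / (K \<inter> N)\<close> embeds in \<open>H / K\<close>, and both
  alternatives to finiteness carry over along the embedding.\<close>

lemma tame_of_Int:
  assumes HK: "subquotient G H K" and N: "subgroup N G" and t: "tame G (H \<inter> N) (K \<inter> N)"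
  shows "tame G H K \<or> finitely_many_cosets G (K \<inter> N) (H \<inter> N)"
proof -
  consider "finitely_many_cosets G (K \<inter> N) (H \<inter> N)"
    | x where "x \<in> H \<inter> N" "\<forall>n::nat. 0 < n \<longrightarrow> x [^] n \<notin> K \<inter> N"
    | L where "L \<subseteq> H \<inter> N" "\<not> finitely_many_cosets G (K \<inter> N) L" "locally_finite_over G (H \<inter> N) (K \<inter> N) L"
    using t unfolding tame_def by blast
  then show ?thesis
  proof cases
    case (2 x)
    have "x [^] n \<in> N" for n :: nat
      using 2(1) by (induction n) (auto intro: subgroup.one_closed[OF N] subgroup.m_closed[OF N])
    then show ?thesis using 2 by (auto intro!: tame_order[of x])
  next
    case (3 L)
    have "\<not> finitely_many_cosets G K L"
    proof
      assume "finitely_many_cosets G K L"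
      then have "finitely_many_cosets G (K \<inter> N) L"
        by (rule finitely_many_cosets_change)
          (use 3(1) N in \<open>auto intro: subgroup.m_closed subgroup.m_inv_closed\<close>)
      then show False using 3 by blast
    qed
    then show ?thesis using 3 locally_finite_over_Int[OF HK N 3(1,3)] by (auto intro: tame_locally_finite)
  qed simp
qed

lemma tame_group_finite: "finite (carrier G) \<Longrightarrow> tame_group G"
  unfolding tame_group_def
proof (intro conjI allI impI group_axioms)
  fix H K assume f: "finite (carrier G)" and "subquotient G H K"
  then have s: "subgroup H G" "subgroup K G" by (auto simp: subquotient_def)
  have "\<exists>t\<in>carrier G. x \<otimes> inv t \<in> K" if "x \<in> H" for x
    using subgroup.mem_carrier[OF s(1) that] subgroup.one_closed[OF s(2)] by (intro bexI[of _ x]) simp_all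
  then show "tame G H K"
    using subgroup.subset[OF s(1)] by (intro tame_finite finitely_many_cosetsI[OF s(2) _ f]) auto
qed

end

text \<open>If \<open>H / K\<close> is torsion, its finitely generated subgroups are finite:
  adjoining \<open>s\<close> with \<open>s^n\<close> in \<open>K\<close> multiplies the number of
  cosets by at most \<open>n\<close>.\<close>

lemma (in comm_group) tame_group_abelian: "tame_group G"
  unfolding tame_group_def
proof (intro conjI allI impI group_axioms)
  fix H K assume HK: "subquotient G H K"
  then have H: "subgroup H G" and K: "subgroup K G" and KH: "K \<subseteq> H" by (auto simp: subquotient_def)
  note Hc = subgroup.mem_carrier[OF H] and Kc = subgroup.mem_carrier[OF K]
  show "tame G H K"
  proof (cases "finitely_many_cosets G K H \<or> (\<exists>x\<in>H. \<forall>n::nat. 0 < n \<longrightarrow> x [^] n \<notin> K)")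
    case True
    then show ?thesis by (auto simp: tame_def)
  next
    case False
    then have tor: "\<exists>n::nat. 0 < n \<and> x [^] n \<in> K" if "x \<in> H" for x using that by blast
    have "locally_finite_over G H K H"
      unfolding locally_finite_over_def
    proof (intro allI impI)
      fix S assume "finite S" "S \<subseteq> H"
      then show "\<exists>M. subgroup M G \<and> S \<subseteq> M \<and> K \<subseteq> M \<and> M \<subseteq> H \<and> finitely_many_cosets G K M"
      proof (induction S rule: finite_induct)
        case empty
        have "finitely_many_cosets G K K"
          by (rule finitely_many_cosetsI[OF K _ finite.insertI[OF finite.emptyI, of \<one>]]) (use Kc in auto)
        then show ?case using K KH by blast
      next
        case (insert s S)
        then obtain M where M: "subgroup M G" "S \<subseteq> M" "K \<subseteq> M" "M \<subseteq> H" "finitely_many_cosets G K M"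
          by auto
        note Mc = subgroup.mem_carrier[OF M(1)]
        have s: "s \<in> H" "s \<in> carrier G" using insert.prems Hc by auto
        obtain n :: nat where n: "0 < n" "s [^] n \<in> K" using tor[OF s(1)] by blast
        obtain T where T: "finite T" "T \<subseteq> M" "\<And>x. x \<in> M \<Longrightarrow> \<exists>t\<in>T. x \<otimes> inv t \<in> K"
          using M(5) unfolding finitely_many_cosets_def by blast
        \<comment> \<open>Nonnegative exponents suffice, since a positive power of \<open>s\<close>
          lies in \<open>K\<close>.\<close>
        let ?P = "{m \<otimes> s [^] i |m i. m \<in> M \<and> i \<in> (UNIV :: nat set)}"
        have Pc: "?P \<subseteq> carrier G" using Mc s by auto
        have pown: "s [^] (n * i) \<in> K" for i
          using subgroup_int_pow_closed[OF K n(2), of "int i"] s by (simp add: nat_pow_pow int_pow_int)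
        have "subgroup ?P G"
        proof (rule subgroupI[OF Pc])
          show "?P \<noteq> {}" using subgroup.one_closed[OF M(1)] by blast
          fix a assume "a \<in> ?P"
          then obtain m i where a: "a = m \<otimes> s [^] (i::nat)" "m \<in> M" by blast
          \<comment> \<open>The truncated subtraction is harmless because \<open>n\<close> is
            positive.\<close>
          have e: "n * i - i + i = n * i" using n(1) by (cases n) auto
          have "inv (s [^] i) = inv (s [^] (n * i)) \<otimes> s [^] (n * i - i)"
          proof -
            have "s [^] (n * i - i) \<otimes> s [^] i = s [^] (n * i)" using s e by (simp add: nat_pow_mult)
            then show ?thesis using s by (metis inv_mult inv_mult_cancel inv_closed m_comm nat_pow_closed r_inv r_one m_assoc)
          qed
          then have "inv a = (inv m \<otimes> inv (s [^] (n * i))) \<otimes> s [^] (n * i - i)"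
            using a Mc s by (simp add: inv_mult m_assoc)
          moreover have "inv m \<otimes> inv (s [^] (n * i)) \<in> M"
            using a M pown by (auto intro!: subgroup.m_closed subgroup.m_inv_closed)
          ultimately show "inv a \<in> ?P" by blast
          fix b assume "b \<in> ?P"
          then obtain m' j where b: "b = m' \<otimes> s [^] (j::nat)" "m' \<in> M" by blast
          have "a \<otimes> b = (m \<otimes> m') \<otimes> s [^] (i + j)"
            using a b Mc s by (simp add: m_ac flip: nat_pow_mult)
          then show "a \<otimes> b \<in> ?P" using subgroup.m_closed[OF M(1) a(2) b(2)] by blast
        qed
        moreover have "M \<subseteq> ?P"
        proof
          fix m assume "m \<in> M"
          then show "m \<in> ?P" using Mc by (intro CollectI exI[of _ m] exI[of _ "0::nat"]) auto
        qed
        moreover have "s \<in> ?P"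
          using subgroup.one_closed[OF M(1)] s by (intro CollectI exI[of _ \<one>] exI[of _ "1::nat"]) auto
        moreover have "?P \<subseteq> H"
        proof -
          have "s [^] i \<in> H" for i :: nat
            using s(1) by (induction i) (auto intro: subgroup.one_closed[OF H] subgroup.m_closed[OF H])
          then show ?thesis using M(4) subgroup.m_closed[OF H] by blast
        qed
        moreover have "finitely_many_cosets G K ?P"
        proof (rule finitely_many_cosetsI[OF K Pc])
          let ?T = "(\<lambda>(t, i). t \<otimes> s [^] i) ` (T \<times> {..<n})"
          show "finite ?T" using T by simp
          show "?T \<subseteq> carrier G" using T Mc s by auto
          fix x assume "x \<in> ?P"
          then obtain m i where x: "x = m \<otimes> s [^] (i::nat)" "m \<in> M" by blast
          obtain t where t: "t \<in> T" "m \<otimes> inv t \<in> K" using T(3)[OF x(2)] by blast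
          have tc: "t \<in> carrier G" and mc: "m \<in> carrier G" using t T x Mc by auto
          \<comment> \<open>Division with remainder: the power with exponent divisible by
            \<open>n\<close> lies in \<open>K\<close>, and the remainder is one of finitely
            many.\<close>
          have si: "s [^] i = s [^] (n * (i div n)) \<otimes> s [^] (i mod n)"
            using s by (simp add: nat_pow_mult)
          have "x \<otimes> inv (t \<otimes> s [^] (i mod n)) = (m \<otimes> inv t) \<otimes> s [^] (n * (i div n))"
          proof -
            have "x \<otimes> inv (t \<otimes> s [^] (i mod n)) = m \<otimes> (s [^] (n * (i div n)) \<otimes> s [^] (i mod n) \<otimes> (inv (s [^] (i mod n)) \<otimes> inv t))"
              using tc mc s by (simp add: x si inv_mult_group m_assoc)
            also have "\<dots> = (m \<otimes> inv t) \<otimes> s [^] (n * (i div n))"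
              using tc mc s by (simp add: m_assoc mult_inv_cancel) (simp add: m_comm)
            finally show ?thesis .
          qed
          also have "\<dots> \<in> K" by (rule subgroup.m_closed[OF K t(2) pown])
          finally have "x \<otimes> inv (t \<otimes> s [^] (i mod n)) \<in> K" .
          moreover have "t \<otimes> s [^] (i mod n) \<in> ?T" using t(1) n(1) by (intro image_eqI[of _ _ "(t, i mod n)"]) auto
          ultimately show "\<exists>t\<in>?T. x \<otimes> inv t \<in> K" by blast
        qed
        ultimately show ?case using M(2,3) by (intro exI[of _ ?P]) blast
      qed
    qed
    then show ?thesis using False by (auto intro: tame_locally_finite[of H])
  qed
qed

context group
begin

lemma finitely_many_cosets_restrict:
  assumes "subgroup N G" "M \<subseteq> N"
  shows "finitely_many_cosets (G\<lparr>carrier := N\<rparr>) K M \<longleftrightarrow> finitely_many_cosets G K M"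
proof -
  have e: "x \<otimes>\<^bsub>G\<lparr>carrier := N\<rparr>\<^esub> inv\<^bsub>G\<lparr>carrier := N\<rparr>\<^esub> y = x \<otimes> inv y" if "y \<in> M" for x y
    using that assms m_inv_consistent[OF assms(1), of y] by auto
  show ?thesis
    by (rule iffI; erule finitely_many_cosets_change) (simp_all only: e)
qed

lemma subgroup_restrict:
  assumes "subgroup N G"
  shows "subgroup H (G\<lparr>carrier := N\<rparr>) \<longleftrightarrow> subgroup H G \<and> H \<subseteq> N"
  using incl_subgroup[OF assms] subgroup_incl[OF _ assms]
    subgroup.subset[of H "G\<lparr>carrier := N\<rparr>"] by auto

lemma subquotient_restrict:
  assumes N: "subgroup N G"
  shows "subquotient (G\<lparr>carrier := N\<rparr>) H K \<longleftrightarrow> subquotient G H K \<and> H \<subseteq> N"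
proof (cases "H \<subseteq> N")
  case True
  have "inv\<^bsub>G\<lparr>carrier := N\<rparr>\<^esub> h = inv h" if "h \<in> H" for h
    using that True m_inv_consistent[OF N] by auto
  then show ?thesis using True unfolding subquotient_def subgroup_restrict[OF N] by auto
qed (simp add: subquotient_def subgroup_restrict[OF N])

lemma tame_restrict:
  assumes N: "subgroup N G" and H: "H \<subseteq> N"
  shows "tame (G\<lparr>carrier := N\<rparr>) H K \<longleftrightarrow> tame G H K"
proof -
  have c: "finitely_many_cosets (G\<lparr>carrier := N\<rparr>) K M \<longleftrightarrow> finitely_many_cosets G K M" if "M \<subseteq> H" for M
    using that H by (intro finitely_many_cosets_restrict N) auto
  have l: "locally_finite_over (G\<lparr>carrier := N\<rparr>) H K L \<longleftrightarrow> locally_finite_over G H K L" for L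
  proof -
    have "(subgroup M (G\<lparr>carrier := N\<rparr>) \<and> S \<subseteq> M \<and> K \<subseteq> M \<and> M \<subseteq> H \<and> finitely_many_cosets (G\<lparr>carrier := N\<rparr>) K M)
      \<longleftrightarrow> (subgroup M G \<and> S \<subseteq> M \<and> K \<subseteq> M \<and> M \<subseteq> H \<and> finitely_many_cosets G K M)" for S M
      using c[of M] H by (auto simp: subgroup_restrict[OF N])
    then show ?thesis by (simp add: locally_finite_over_def)
  qed
  have p: "x [^]\<^bsub>G\<lparr>carrier := N\<rparr>\<^esub> n = x [^] n" for x and n :: nat
    by (rule nat_pow_consistent[symmetric])
  have "(\<exists>L\<subseteq>H. \<not> finitely_many_cosets (G\<lparr>carrier := N\<rparr>) K L \<and> locally_finite_over (G\<lparr>carrier := N\<rparr>) H K L)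
    \<longleftrightarrow> (\<exists>L\<subseteq>H. \<not> finitely_many_cosets G K L \<and> locally_finite_over G H K L)"
    using c l by (intro ex_cong1) auto
  then show ?thesis unfolding tame_def using c[of H] by (simp only: p order_refl simp_thms)
qed

lemma tame_group_subgroup:
  assumes "tame_group G" "subgroup N G"
  shows "tame_group (G\<lparr>carrier := N\<rparr>)"
  using assms unfolding tame_group_def
  by (auto simp: subquotient_restrict tame_restrict subgroup_imp_group)

lemma tame_Int_subgroup:
  assumes "subquotient G H K" "subgroup N G" "tame_group (G\<lparr>carrier := N\<rparr>)"
  shows "tame G (H \<inter> N) (K \<inter> N)"
proof -
  have "subquotient (G\<lparr>carrier := N\<rparr>) (H \<inter> N) (K \<inter> N)"
    using subquotient_Int[OF assms(1,2)] assms(2) by (simp add: subquotient_restrict)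
  then have "tame (G\<lparr>carrier := N\<rparr>) (H \<inter> N) (K \<inter> N)" using assms(3) unfolding tame_group_def by blast
  then show ?thesis using tame_restrict[OF assms(2), of "H \<inter> N" "K \<inter> N"] by simp
qed

text \<open>Either some member \<open>U\<close> has infinite
  \<open>(H \<inter> U) / (K \<inter> U)\<close>, and \<open>tame_of_Int\<close> decides; or all of
  these are finite, and then \<open>H / K\<close> is locally finite because every finite subset of
  \<open>H\<close> lies in one member.\<close>

lemma tame_group_directed_union:
  assumes ne: "\<H> \<noteq> {}" and sub: "\<And>H. H \<in> \<H> \<Longrightarrow> subgroup H G"
    and dir: "\<And>H K. H \<in> \<H> \<Longrightarrow> K \<in> \<H> \<Longrightarrow> \<exists>L\<in>\<H>. H \<union> K \<subseteq> L"
    and un: "carrier G = \<Union>\<H>" and t: "\<And>H. H \<in> \<H> \<Longrightarrow> tame_group (G\<lparr>carrier := H\<rparr>)"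
  shows "tame_group G"
  unfolding tame_group_def
proof (intro conjI allI impI group_axioms)
  fix H K assume HK: "subquotient G H K"
  then have H: "subgroup H G" and K: "subgroup K G" by (auto simp: subquotient_def)
  show "tame G H K"
  proof (cases "\<exists>U\<in>\<H>. \<not> finitely_many_cosets G (K \<inter> U) (H \<inter> U)")
    case True
    then show ?thesis using tame_of_Int[OF HK sub tame_Int_subgroup[OF HK sub t]] by blast
  next
    case False
    have cover: "\<exists>U\<in>\<H>. S \<subseteq> U" if "finite S" "S \<subseteq> H" for S
      using that
    proof (induction S rule: finite_induct)
      case empty
      then show ?case using ne by blast
    next
      case (insert s S)
      then obtain U where U: "U \<in> \<H>" "S \<subseteq> U" by auto
      obtain V where V: "V \<in> \<H>" "s \<in> V" using insert.prems un subgroup.subset[OF H] by blast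
      from dir[OF U(1) V(1)] obtain W where "W \<in> \<H>" "U \<union> V \<subseteq> W" by blast
      then show ?case using U V by (intro bexI[of _ W]) auto
    qed
    have "locally_finite_over G H K H"
      unfolding locally_finite_over_def
    proof (intro allI impI)
      fix S assume S: "finite S" "S \<subseteq> H"
      then obtain U where U: "U \<in> \<H>" "S \<subseteq> U" using cover by blast
      have M: "subgroup (H \<inter> U) G" by (rule subgroups_Inter_pair[OF H sub[OF U(1)]])
      have "finitely_many_cosets G (K \<inter> U) (H \<inter> U)" using False U by blast
      then have "finitely_many_cosets G (K \<inter> (H \<inter> U)) (H \<inter> U)"
        by (rule finitely_many_cosets_change)
          (use M in \<open>auto intro: subgroup.m_closed subgroup.m_inv_closed sub U H\<close>)
      then show "\<exists>M. subgroup M G \<and> S \<subseteq> M \<and> K \<subseteq> M \<and> M \<subseteq> H \<and> finitely_many_cosets G K M"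
        using subquotient_product[OF HK M] U S by blast
    qed
    then show ?thesis
      using tame_finite tame_locally_finite[OF order_refl] by blast
  qed
qed

end

context group_hom
begin

lemma preimage_subgroup:
  assumes "subgroup M H"
  shows "subgroup {x \<in> carrier G. h x \<in> M} G"
proof (rule G.subgroupI)
  show "{x \<in> carrier G. h x \<in> M} \<noteq> {}"
    using subgroup.one_closed[OF assms] by (auto intro!: exI[of _ "\<one>\<^bsub>G\<^esub>"])
qed (use assms in \<open>auto intro: subgroup.m_closed subgroup.m_inv_closed\<close>)

lemma preimage_subquotient:
  assumes "subquotient H A B"
  shows "subquotient G {x \<in> carrier G. h x \<in> A} {x \<in> carrier G. h x \<in> B}"
  using assms unfolding subquotient_def by (auto intro: preimage_subgroup)

lemma image_finitely_many_cosets: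
  assumes "M \<subseteq> carrier G" "finitely_many_cosets G K M"
    and "\<And>x. x \<in> carrier G \<Longrightarrow> x \<in> K \<Longrightarrow> h x \<in> K'"
  shows "finitely_many_cosets H K' (h ` M)"
proof -
  obtain T where T: "finite T" "T \<subseteq> M" "\<And>x. x \<in> M \<Longrightarrow> \<exists>t\<in>T. x \<otimes>\<^bsub>G\<^esub> inv\<^bsub>G\<^esub> t \<in> K"
    using assms(2) unfolding finitely_many_cosets_def by blast
  have "\<exists>t\<in>h ` T. y \<otimes>\<^bsub>H\<^esub> inv\<^bsub>H\<^esub> t \<in> K'" if y: "y \<in> h ` M" for y
  proof -
    obtain x where x: "x \<in> M" "y = h x" using y by blast
    obtain t where t: "t \<in> T" "x \<otimes>\<^bsub>G\<^esub> inv\<^bsub>G\<^esub> t \<in> K" using T(3)[OF x(1)] by blast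
    have c: "x \<in> carrier G" "t \<in> carrier G" using assms(1) x t T(2) by auto
    have "h (x \<otimes>\<^bsub>G\<^esub> inv\<^bsub>G\<^esub> t) \<in> K'" using t c by (intro assms(3)) auto
    then show ?thesis using c x t by (intro bexI[of _ "h t"]) auto
  qed
  then show ?thesis unfolding finitely_many_cosets_def using T by (intro exI[of _ "h ` T"]) auto
qed

lemma pow_hom: "x \<in> carrier G \<Longrightarrow> h (x [^]\<^bsub>G\<^esub> (n::nat)) = h x [^]\<^bsub>H\<^esub> n"
  by (rule hom_nat_pow)

text \<open>\<open>A / K\<close> is isomorphic to the quotient of the two preimages, and
  \<open>h\<close> transports each of the three alternatives.\<close>

lemma tame_image:
  assumes A: "A \<subseteq> carrier H" and surj: "h ` carrier G = carrier H"
    and K: "subgroup K H"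
    and t: "tame G {x \<in> carrier G. h x \<in> A} {x \<in> carrier G. h x \<in> K}"
  shows "tame H A K"
proof -
  let ?A = "{x \<in> carrier G. h x \<in> A}" and ?K = "{x \<in> carrier G. h x \<in> K}"
  have im: "h ` ?A = A" using A surj by auto
  consider "finitely_many_cosets G ?K ?A"
    | x where "x \<in> ?A" "\<forall>n::nat. 0 < n \<longrightarrow> x [^]\<^bsub>G\<^esub> n \<notin> ?K"
    | L where "L \<subseteq> ?A" "\<not> finitely_many_cosets G ?K L" "locally_finite_over G ?A ?K L"
    using t unfolding tame_def by blast
  then show ?thesis
  proof cases
    case 1
    have "finitely_many_cosets H K (h ` ?A)" by (rule image_finitely_many_cosets[OF _ 1]) auto
    then show ?thesis unfolding im by (rule tame_finite)
  next
    case (2 x)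
    show ?thesis
    proof (rule tame_order)
      show "h x \<in> A" using 2(1) by simp
      show "h x [^]\<^bsub>H\<^esub> n \<notin> K" if "0 < n" for n :: nat
      proof -
        have "h (x [^]\<^bsub>G\<^esub> n) = h x [^]\<^bsub>H\<^esub> n" using 2(1) by (intro pow_hom) simp
        moreover have "h (x [^]\<^bsub>G\<^esub> n) \<notin> K" using 2 that by simp
        ultimately show ?thesis by (simp only: not_False_eq_True)
      qed
    qed
  next
    case (3 L)
    have Lc: "L \<subseteq> carrier G" using 3(1) by auto
    have "\<not> finitely_many_cosets H K (h ` L)"
    proof
      assume "finitely_many_cosets H K (h ` L)"
      then obtain T where T: "finite T" "T \<subseteq> h ` L" "\<And>y. y \<in> h ` L \<Longrightarrow> \<exists>t\<in>T. y \<otimes>\<^bsub>H\<^esub> inv\<^bsub>H\<^esub> t \<in> K"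
        by (elim finitely_many_cosetsE) (rule that)
      obtain T' where T': "T' \<subseteq> L" "finite T'" "T = h ` T'" using finite_subset_image[OF T(1,2)] by blast
      have "finitely_many_cosets G ?K L"
        unfolding finitely_many_cosets_def
      proof (intro exI[of _ T'] conjI ballI T')
        fix x assume x: "x \<in> L"
        from T(3)[OF imageI[OF x]] T'(3)
        obtain t where t: "t \<in> T'" "h x \<otimes>\<^bsub>H\<^esub> inv\<^bsub>H\<^esub> h t \<in> K" by blast
        have "x \<in> carrier G" "t \<in> carrier G" using x t(1) T'(1) Lc by blast+
        then show "\<exists>t\<in>T'. x \<otimes>\<^bsub>G\<^esub> inv\<^bsub>G\<^esub> t \<in> ?K" using t by (intro bexI[of _ t]) auto
      qed
      then show False using 3 by blast
    qed
    moreover have "locally_finite_over H A K (h ` L)"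
      unfolding locally_finite_over_def
    proof (intro allI impI)
      fix S assume S: "finite S" "S \<subseteq> h ` L"
      obtain S' where S': "S' \<subseteq> L" "finite S'" "S = h ` S'" using finite_subset_image[OF S] by blast
      obtain M where M: "subgroup M G" "S' \<subseteq> M" "?K \<subseteq> M" "M \<subseteq> ?A" "finitely_many_cosets G ?K M"
        by (rule locally_finite_overE[OF 3(3) S'(2,1)]) (rule that)
      have "K \<subseteq> h ` M"
      proof
        fix k assume k: "k \<in> K"
        then have "k \<in> carrier H" using subgroup.mem_carrier[OF K] by blast
        then obtain x where "x \<in> carrier G" "k = h x" using surj by blast
        then show "k \<in> h ` M" using k M(3) by blast
      qed
      moreover have "h ` M \<subseteq> A" using M(4) by auto
      moreover have "subgroup (h ` M) H" by (rule subgroup_img_is_subgroup[OF M(1)])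
      moreover have "finitely_many_cosets H K (h ` M)"
        using M(4) by (intro image_finitely_many_cosets[OF _ M(5)]) auto
      ultimately show "\<exists>M. subgroup M H \<and> S \<subseteq> M \<and> K \<subseteq> M \<and> M \<subseteq> A \<and> finitely_many_cosets H K M"
        using M(2) S'(3) by (intro exI[of _ "h ` M"]) auto
    qed
    ultimately show ?thesis using 3(1) by (intro tame_locally_finite[of "h ` L"]) auto
  qed
qed

lemma tame_group_image:
  assumes "tame_group G" "h ` carrier G = carrier H"
  shows "tame_group H"
  unfolding tame_group_def
proof (intro conjI allI impI H.group_axioms)
  fix A K assume AK: "subquotient H A K"
  then have A: "A \<subseteq> carrier H" and K: "subgroup K H" by (auto simp: subquotient_def dest: subgroup.subset)
  have "tame G {x \<in> carrier G. h x \<in> A} {x \<in> carrier G. h x \<in> K}"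
    using assms(1) preimage_subquotient[OF AK] by (simp add: tame_group_def)
  then show "tame H A K" by (rule tame_image[OF A assms(2) K])
qed

text \<open>If \<open>A / K\<close> were not tame, \<open>(A \<inter> N) / (K \<inter> N)\<close>
  would be finite by \<open>tame_of_Int\<close>. It is, up to isomorphism, the kernel of the map
  from \<open>A / K\<close> onto the image subquotient, so finiteness lifts along that map, and with
  it all three alternatives.\<close>

lemma tame_group_extension:
  assumes surj: "h ` carrier G = carrier H" and ker: "N = {x \<in> carrier G. h x = \<one>\<^bsub>H\<^esub>}"
    and tN: "tame_group (G\<lparr>carrier := N\<rparr>)" and tQ: "tame_group H"
  shows "tame_group G"
  unfolding tame_group_def
proof (intro conjI allI impI G.group_axioms)
  fix A K assume AK: "subquotient G A K"
  then have A: "subgroup A G" and K: "subgroup K G" and KA: "K \<subseteq> A"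
    and conj: "\<And>x k. x \<in> A \<Longrightarrow> k \<in> K \<Longrightarrow> x \<otimes>\<^bsub>G\<^esub> k \<otimes>\<^bsub>G\<^esub> inv\<^bsub>G\<^esub> x \<in> K"
    by (auto simp: subquotient_def)
  note Ac = subgroup.mem_carrier[OF A] and Kc = subgroup.mem_carrier[OF K]
  have N: "subgroup N G"
    unfolding ker by (rule G.subgroupI) auto
  show "tame G A K"
  proof (rule ccontr)
    assume nt: "\<not> tame G A K"
    then have fin: "finitely_many_cosets G (K \<inter> N) (A \<inter> N)"
      using G.tame_of_Int[OF AK N G.tame_Int_subgroup[OF AK N tN]] by blast
    then obtain T where T: "finite T" "T \<subseteq> A \<inter> N"
      "\<And>x. x \<in> A \<inter> N \<Longrightarrow> \<exists>t\<in>T. x \<otimes>\<^bsub>G\<^esub> inv\<^bsub>G\<^esub> t \<in> K \<inter> N"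
      by (elim finitely_many_cosetsE) (rule that)
    have hA: "subgroup (h ` A) H" "subgroup (h ` K) H"
      by (rule subgroup_img_is_subgroup[OF A], rule subgroup_img_is_subgroup[OF K])
    have sq: "subquotient H (h ` A) (h ` K)"
      unfolding subquotient_def
    proof (intro conjI hA ballI)
      show "h ` K \<subseteq> h ` A" using KA by blast
      fix a k assume "a \<in> h ` A" "k \<in> h ` K"
      then obtain x y where xy: "a = h x" "x \<in> A" "k = h y" "y \<in> K" by blast
      have "a \<otimes>\<^bsub>H\<^esub> k \<otimes>\<^bsub>H\<^esub> inv\<^bsub>H\<^esub> a = h (x \<otimes>\<^bsub>G\<^esub> y \<otimes>\<^bsub>G\<^esub> inv\<^bsub>G\<^esub> x)"
        using xy Ac Kc by simp
      then show "a \<otimes>\<^bsub>H\<^esub> k \<otimes>\<^bsub>H\<^esub> inv\<^bsub>H\<^esub> a \<in> h ` K" using conj xy by blast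
    qed
    have lift: "finitely_many_cosets G K M" if M: "M \<subseteq> A" and f: "finitely_many_cosets H (h ` K) (h ` M)" for M
    proof -
      obtain U where U: "finite U" "U \<subseteq> h ` M" "\<And>y. y \<in> h ` M \<Longrightarrow> \<exists>t\<in>U. y \<otimes>\<^bsub>H\<^esub> inv\<^bsub>H\<^esub> t \<in> h ` K"
        using f by (elim finitely_many_cosetsE) (rule that)
      obtain U' where U': "U' \<subseteq> M" "finite U'" "U = h ` U'" using finite_subset_image[OF U(1,2)] by blast
      show ?thesis
      proof (rule G.finitely_many_cosetsI[OF K])
        let ?T = "(\<lambda>(t, u). t \<otimes>\<^bsub>G\<^esub> u) ` (T \<times> U')"
        show "M \<subseteq> carrier G" using M Ac by blast
        show "finite ?T" using T U' by simp
        show "?T \<subseteq> carrier G"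
        proof
          fix z assume "z \<in> ?T"
          then obtain t u where "t \<in> T" "u \<in> U'" "z = t \<otimes>\<^bsub>G\<^esub> u" by auto
          then show "z \<in> carrier G" using Ac[of t] Ac[of u] T(2) U'(1) M by blast
        qed
        fix x assume x: "x \<in> M"
        from U(3)[OF imageI[OF x]] U'(3)
        obtain u where u: "u \<in> U'" "h x \<otimes>\<^bsub>H\<^esub> inv\<^bsub>H\<^esub> h u \<in> h ` K" by blast
        from u(2) obtain k where k: "k \<in> K" "h x \<otimes>\<^bsub>H\<^esub> inv\<^bsub>H\<^esub> h u = h k" by blast
        have uA: "u \<in> A" and xA: "x \<in> A" using u(1) U'(1) x M by blast+
        note c = Ac[OF uA] Ac[OF xA] Kc[OF k(1)]
        \<comment> \<open>\<open>x\<close> and \<open>u\<close> have images in the same coset of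
          \<open>h K\<close>; correcting by \<open>k\<close> gives an element of the kernel, where
          the representatives \<open>T\<close> apply.\<close>
        let ?y = "inv\<^bsub>G\<^esub> k \<otimes>\<^bsub>G\<^esub> (x \<otimes>\<^bsub>G\<^esub> inv\<^bsub>G\<^esub> u)"
        have "h ?y = \<one>\<^bsub>H\<^esub>" using c k(2) by simp
        moreover have "?y \<in> A"
          using subsetD[OF KA k(1)] uA xA
          by (intro subgroup.m_closed[OF A] subgroup.m_inv_closed[OF A])
        ultimately have "?y \<in> A \<inter> N" using Ac unfolding ker by blast
        then obtain t where t: "t \<in> T" "?y \<otimes>\<^bsub>G\<^esub> inv\<^bsub>G\<^esub> t \<in> K" using T(3) by blast
        have tc: "t \<in> carrier G" using t(1) T(2) Ac by blast
        have "x \<otimes>\<^bsub>G\<^esub> inv\<^bsub>G\<^esub> (t \<otimes>\<^bsub>G\<^esub> u) = k \<otimes>\<^bsub>G\<^esub> (?y \<otimes>\<^bsub>G\<^esub> inv\<^bsub>G\<^esub> t)"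
          using c tc by (simp add: G.inv_mult_group G.m_assoc G.mult_inv_cancel)
        moreover have "k \<otimes>\<^bsub>G\<^esub> (?y \<otimes>\<^bsub>G\<^esub> inv\<^bsub>G\<^esub> t) \<in> K" by (rule subgroup.m_closed[OF K k(1) t(2)])
        ultimately have "x \<otimes>\<^bsub>G\<^esub> inv\<^bsub>G\<^esub> (t \<otimes>\<^bsub>G\<^esub> u) \<in> K" by simp
        moreover have "t \<otimes>\<^bsub>G\<^esub> u \<in> ?T" using t u by (intro image_eqI[of _ _ "(t, u)"]) auto
        ultimately show "\<exists>t\<in>?T. x \<otimes>\<^bsub>G\<^esub> inv\<^bsub>G\<^esub> t \<in> K" by (rule bexI)
      qed
    qed
    have "tame H (h ` A) (h ` K)" using tQ sq by (simp add: tame_group_def)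
    then consider "finitely_many_cosets H (h ` K) (h ` A)"
      | y where "y \<in> h ` A" "\<forall>n::nat. 0 < n \<longrightarrow> y [^]\<^bsub>H\<^esub> n \<notin> h ` K"
      | L where "L \<subseteq> h ` A" "\<not> finitely_many_cosets H (h ` K) L" "locally_finite_over H (h ` A) (h ` K) L"
      unfolding tame_def by blast
    then have "tame G A K"
    proof cases
      case 1
      then show ?thesis using lift[OF order_refl] by (intro tame_finite)
    next
      case (2 y)
      then obtain x where x: "x \<in> A" "y = h x" by blast
      show ?thesis
      proof (rule tame_order[OF x(1)])
        fix n :: nat assume n: "0 < n"
        show "x [^]\<^bsub>G\<^esub> n \<notin> K"
        proof
          assume "x [^]\<^bsub>G\<^esub> n \<in> K"
          then have "h (x [^]\<^bsub>G\<^esub> n) \<in> h ` K" by blast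
          then show False using 2(2) n x Ac by (simp add: pow_hom)
        qed
      qed
    next
      case (3 L)
      let ?L = "{x \<in> A. h x \<in> L}"
      have im: "h ` ?L = L" using 3(1) by auto
      have "\<not> finitely_many_cosets G K ?L"
      proof
        assume f: "finitely_many_cosets G K ?L"
        have "finitely_many_cosets H (h ` K) (h ` ?L)"
          by (rule image_finitely_many_cosets[OF _ f]) (use Ac in auto)
        then show False using 3(2) im by simp
      qed
      moreover have "locally_finite_over G A K ?L"
        unfolding locally_finite_over_def
      proof (intro allI impI)
        fix S assume S: "finite S" "S \<subseteq> ?L"
        then have hS: "finite (h ` S)" "h ` S \<subseteq> L" by auto
        obtain M where M: "subgroup M H" "h ` S \<subseteq> M" "h ` K \<subseteq> M" "M \<subseteq> h ` A"
          "finitely_many_cosets H (h ` K) M"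
          by (rule locally_finite_overE[OF 3(3) hS]) (rule that)
        let ?M = "{x \<in> carrier G. h x \<in> M} \<inter> A"
        have "h ` ?M = M" using M(4) Ac by auto
        then have "finitely_many_cosets G K ?M" using M(5) by (intro lift) auto
        moreover have "subgroup ?M G"
          by (rule G.subgroups_Inter_pair[OF preimage_subgroup[OF M(1)] A])
        moreover have "S \<subseteq> ?M" using S M(2) Ac by auto
        moreover have "K \<subseteq> ?M" using M(3) KA Kc by auto
        ultimately show "\<exists>M. subgroup M G \<and> S \<subseteq> M \<and> K \<subseteq> M \<and> M \<subseteq> A \<and> finitely_many_cosets G K M"
          by (intro exI[of _ ?M]) auto
      qed
      ultimately show ?thesis by (intro tame_locally_finite[of ?L]) blast+
    qed
    then show False using nt by blast
  qed
qed

end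

text \<open>Replaces a quotient, whose elements are cosets, by an epimorphism with prescribed
  kernel, the form in which the closure lemmas are stated.\<close>

lemma quotient_epimorphism:
  assumes N: "N \<lhd> G" and Q: "group Q" and iso: "G Mod N \<cong> Q"
  obtains h where "group_hom G Q h" "h ` carrier G = carrier Q" "N = {x \<in> carrier G. h x = \<one>\<^bsub>Q\<^esub>}"
proof -
  interpret N: normal N G by (rule N)
  obtain \<phi> where \<phi>: "\<phi> \<in> iso (G Mod N) Q" using iso by (auto simp: is_iso_def)
  then have hom: "\<phi> \<in> hom (G Mod N) Q" and bij: "bij_betw \<phi> (carrier (G Mod N)) (carrier Q)"
    by (auto simp: iso_def)
  interpret M: group "G Mod N" by (rule N.factorgroup_is_group)
  interpret P: group_hom "G Mod N" Q \<phi>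
    by (intro group_hom.intro group_hom_axioms.intro M.group_axioms Q hom)
  define h where "h x = \<phi> (N #>\<^bsub>G\<^esub> x)" for x
  have carM: "carrier (G Mod N) = (\<lambda>x. N #>\<^bsub>G\<^esub> x) ` carrier G"
    by (auto simp: FactGroup_def RCOSETS_def)
  have "h \<in> hom G Q"
    using hom_compose[OF N.r_coset_hom_Mod hom] by (simp add: h_def[abs_def] comp_def)
  then have 1: "group_hom G Q h"
    by (intro group_hom.intro group_hom_axioms.intro N.group_axioms Q)
  have 2: "h ` carrier G = carrier Q"
    using bij carM by (simp add: bij_betw_def h_def[abs_def] image_image)
  have "h x = \<one>\<^bsub>Q\<^esub> \<longleftrightarrow> x \<in> N" if x: "x \<in> carrier G" for x
  proof -
    have "h x = \<one>\<^bsub>Q\<^esub> \<longleftrightarrow> \<phi> (N #>\<^bsub>G\<^esub> x) = \<phi> \<one>\<^bsub>G Mod N\<^esub>"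
      unfolding h_def P.hom_one ..
    also have "\<dots> \<longleftrightarrow> N #>\<^bsub>G\<^esub> x = \<one>\<^bsub>G Mod N\<^esub>"
      using bij x carM M.one_closed by (intro inj_on_eq_iff[of \<phi> "carrier (G Mod N)"]) (auto simp: bij_betw_def)
    also have "\<dots> \<longleftrightarrow> x \<in> N"
      using N.coset_join1[OF _ x N.subgroup_axioms] N.coset_join2[OF x N.subgroup_axioms]
      by (auto simp: FactGroup_def)
    finally show ?thesis .
  qed
  then have 3: "N = {x \<in> carrier G. h x = \<one>\<^bsub>Q\<^esub>}" using N.subset by auto
  show thesis by (rule that[OF 1 2 3])
qed

lemma elementary_amenable_class_tame: "elementary_amenable_class G \<Longrightarrow> tame_group G"
proof (induction rule: elementary_amenable_class.induct)
  case (finite G)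
  then show ?case by (rule group.tame_group_finite)
next
  case (abelian G)
  then show ?case by (rule comm_group.tame_group_abelian)
next
  case (subgroup G H)
  have "group G" using subgroup.IH by (simp add: tame_group_def)
  then show ?case using subgroup.IH subgroup.hyps(2) by (rule group.tame_group_subgroup)
next
  case (quotient G N Q)
  obtain h where h: "group_hom G Q h" "h ` carrier G = carrier Q"
    by (rule quotient_epimorphism[OF quotient.hyps(2-4)]) (rule that)
  show ?case by (rule group_hom.tame_group_image[OF h(1) quotient.IH h(2)])
next
  case (extension N G Q)
  then have Q: "group Q" by (simp add: tame_group_def)
  obtain h where h: "group_hom G Q h" "h ` carrier G = carrier Q" "N = {x \<in> carrier G. h x = \<one>\<^bsub>Q\<^esub>}"
    by (rule quotient_epimorphism[OF extension.hyps(1) Q extension.hyps(4)]) (rule that)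
  show ?case by (rule group_hom.tame_group_extension[OF h extension.IH])
next
  case (directed_union G \<H>)
  show ?case
    by (rule group.tame_group_directed_union[OF directed_union.hyps(1-5) directed_union.IH])
qed

text \<open>With \<open>K\<close> trivial the subquotient is the group itself. The isomorphism with
  a group over \<open>'u\<close> is used as an epimorphism, which brings tameness back to the type
  of \<open>G\<close>.\<close>

theorem infinite_elementary_amenable_cases:
  fixes G (structure)
  assumes ea: "elementary_amenable TYPE('u) G" and inf: "infinite (carrier G)"
  obtains (infinite_order) x where "x \<in> carrier G" "\<And>n::nat. 0 < n \<Longrightarrow> x [^]\<^bsub>G\<^esub> n \<noteq> \<one>\<^bsub>G\<^esub>"
  | (finite_subgroups) B :: "nat \<Rightarrow> 'a set" where "\<And>n. subgroup (B n) G" "\<And>n. finite (B n)" "mono B"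
      "\<And>N. \<exists>n. N \<le> card (B n)"
proof -
  obtain K :: "'u monoid" where G: "group G" and K: "elementary_amenable_class K" and iso: "G \<cong> K"
    using ea by (auto simp: elementary_amenable_def)
  interpret group G by (rule G)
  have tK: "tame_group K" by (rule elementary_amenable_class_tame[OF K])
  then have gK: "group K" by (simp add: tame_group_def)
  have "K \<cong> G" using iso by (rule iso_sym)
  then obtain h where h: "h \<in> hom K G" "h ` carrier K = carrier G"
    by (auto simp: is_iso_def iso_def bij_betw_def)
  have "tame_group G"
    by (rule group_hom.tame_group_image[OF _ tK h(2)])
      (intro group_hom.intro group_hom_axioms.intro gK G h)
  moreover have "subquotient G (carrier G) {\<one>}"
    by (auto simp: subquotient_def subgroup_self triv_subgroup)
  ultimately have t: "tame G (carrier G) {\<one>}" by (simp add: tame_group_def)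
  have c1: "x = y" if "x \<otimes> inv y \<in> {\<one>}" "x \<in> carrier G" "y \<in> carrier G" for x y
    using that inv_equality[of x "inv y"] by simp
  have fin: "finite M" if M: "finitely_many_cosets G {\<one>} M" "M \<subseteq> carrier G" for M
  proof -
    obtain T where T: "finite T" "T \<subseteq> M" "\<And>x. x \<in> M \<Longrightarrow> \<exists>t\<in>T. x \<otimes> inv t \<in> {\<one>}"
      using M(1) by (elim finitely_many_cosetsE) (rule that)
    have "M \<subseteq> T"
    proof
      fix x assume x: "x \<in> M"
      obtain t where t: "t \<in> T" "x \<otimes> inv t \<in> {\<one>}" using T(3)[OF x] by blast
      have "x = t" using t x T(2) M(2) by (intro c1) auto
      then show "x \<in> T" using t by simp
    qed
    then show ?thesis using T(1) finite_subset by blast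
  qed
  consider "finitely_many_cosets G {\<one>} (carrier G)"
    | x where "x \<in> carrier G" "\<forall>n::nat. 0 < n \<longrightarrow> x [^] n \<notin> {\<one>}"
    | L where "L \<subseteq> carrier G" "\<not> finitely_many_cosets G {\<one>} L" "locally_finite_over G (carrier G) {\<one>} L"
    using t unfolding tame_def by blast
  then show thesis
  proof cases
    case 1
    then show ?thesis using fin inf by blast
  next
    case (2 x)
    then show ?thesis by (intro infinite_order[of x]) auto
  next
    case (3 L)
    have "infinite L"
    proof
      assume f: "finite L"
      have "finitely_many_cosets G {\<one>} L"
        by (rule finitely_many_cosetsI[OF triv_subgroup 3(1) f 3(1)]) (use 3(1) in \<open>force intro: bexI\<close>)
      then show False using 3(2) by simp
    qed
    \<comment> \<open>A countable part of \<open>L\<close> suffices: its first \<open>n\<close>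
      elements lie in a finite subgroup, so they generate a finite one, which has at least
      \<open>n\<close> elements.\<close>
    then obtain x :: "nat \<Rightarrow> 'a" where x: "inj x" "range x \<subseteq> L"
      using infinite_countable_subset by blast
    define B where "B n = generate G (x ` {..<n})" for n
    have xc: "x ` {..<n} \<subseteq> carrier G" for n using x(2) 3(1) by auto
    show ?thesis
    proof (rule finite_subgroups[of B])
      show "subgroup (B n) G" for n unfolding B_def by (rule generate_is_subgroup[OF xc])
      show f: "finite (B n)" for n
      proof -
        have s: "finite (x ` {..<n})" "x ` {..<n} \<subseteq> L" using x(2) by auto
        obtain M where M: "subgroup M G" "x ` {..<n} \<subseteq> M" "{\<one>} \<subseteq> M" "M \<subseteq> carrier G" "finitely_many_cosets G {\<one>} M"
          by (rule locally_finite_overE[OF 3(3) s]) (rule that)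
        have "B n \<subseteq> M" unfolding B_def by (rule generate_subgroup_incl[OF M(2,1)])
        then show ?thesis using fin[OF M(5,4)] finite_subset by blast
      qed
      show "mono B"
      proof (rule monoI)
        fix m n :: nat assume "m \<le> n"
        then have "x ` {..<m} \<subseteq> x ` {..<n}" by auto
        then show "B m \<subseteq> B n" unfolding B_def by (rule mono_generate)
      qed
      show "\<exists>n. N \<le> card (B n)" for N
      proof
        have "x ` {..<N} \<subseteq> B N" unfolding B_def by (auto intro: generate.incl)
        then have "card (x ` {..<N}) \<le> card (B N)" by (intro card_mono f)
        then show "N \<le> card (B N)" using card_image[OF inj_on_subset[OF x(1)], of "{..<N}"] by simp
      qed
    qed
  qed
qed

section \<open>The main theorem\<close>

theorem theorem1:
  fixes G :: "('a, 'm) monoid_scheme" and p :: real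
  assumes "group G" and "infinite (carrier G)"
    and "elementary_amenable TYPE('u) G"
    and "2 < p"
  shows "\<exists>F E. closed_invariant_subspace G p F \<and> F \<noteq> {\<lambda>_. 0}
           \<and> invariant_exhaustion G p E
           \<and> (\<forall>i. E i \<inter> F = {\<lambda>_. 0})"
  using assms(3,2)
proof (cases rule: infinite_elementary_amenable_cases)
  case (infinite_order x)
  then show ?thesis using assms(4) by (rule group.exhaustion_of_infinite_order[OF assms(1)])
next
  case (finite_subgroups B)
  then show ?thesis using assms(4) by (rule group.exhaustion_of_finite_subgroups[OF assms(1)])
qed

end
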